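(* Let $q\in\mathbb{N}$ and let $(X_t)_{t\in\mathbb{R}_+}$, $X_t=(X_{t,1},\ldots,X_{t,d})^\top$, be a multi-type CBI process with parameters $(d,c,\beta,B,\nu,\mu)$ such that $\mathbb{E}(\|X_0\|^q)<\infty$ and $$\int_{U_d}\|z\|^q\mathbf{1}_{\{\|z\|\ge 1\}}\,\nu(dz)<\infty,\qquad \int_{U_d}\|z\|^q\mathbf{1}_{\{\|z\|\ge1\}}\,\mu_i(dz)<\infty,\quad i\in\{1,\ldots,d\}.$$ Then for all $t\in\mathbb{R}_+$, $k\in\{1,\ldots,q\}$ and $i_1,\ldots,i_k\in\{1,\ldots,d\}$, there exists a polynomial $P_{t,k,i_1,\ldots,i_k}:\mathbb{R}^d\to\mathbb{R}$ having degree at most $\lfloor k/2\rfloor$ such that $$\mathbb{E}\big[(X_{t,i_1}-\mathbb{E}(X_{t,i_1}))\cdots(X_{t,i_k}-\mathbb{E}(X_{t,i_k}))\big]=\mathbb{E}\big(P_{t,k,i_1,\ldots,i_k}(X_0)\big).$$ The coefficients of the polynomial $P_{t,k,i_1,\ldots,i_k}$ depend on $d,c,\beta,B,\nu,\mu_1,\ldots,\mu_d$.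
   Context: Notation: $\mathbb{R}_+=[0,\infty)$, $\mathbb{N}=\{1,2,\ldots\}$, $x\wedge y=\min\{x,y\}$, $\|\cdot\|$ is the Euclidean norm, $e_1,\ldots,e_d$ is the natural basis of $\mathbb{R}^d$, $U_d=\mathbb{R}_+^d\setminus\{0\}$. Admissible parameters: $(d,c,\beta,B,\nu,\mu)$ is a set of admissible parameters if $d\in\mathbb{N}$; $c=(c_i)\in\mathbb{R}_+^d$; $\beta=(\beta_i)\in\mathbb{R}_+^d$; $B=(b_{i,j})\in\mathbb{R}^{d\times d}$ has non-negative off-diagonal entries; $\nu$ is a Borel measure on $U_d$ with $\int_{U_d}(1\wedge\|z\|)\,\nu(dz)<\infty$; $\mu=(\mu_1,\ldots,\mu_d)$, each $\mu_i$ a Borel measure on $U_d$ with $\int_{U_d}\big[\|z\|\wedge\|z\|^2+\sum_{j\ne i}z_j\big]\mu_i(dz)<\infty$. CBI process: a multi-type CBI process with (admissible) parameters $(d,c,\beta,B,\nu,\mu)$ is a conservative Markov process with state space $\mathbb{R}_+^d$ whose transition semigroup $(P_t)_{t\ge0}$ is determined by $$\int_{\mathbb{R}_+^d}e^{-\langle\lambda,y\rangle}P_t(x,dy)=e^{-\langle x,v(t,\lambda)\rangle-\int_0^t\psi(v(s,\lambda))\,ds},\qquad x,\lambda\in\mathbb{R}_+^d,\ t\in\mathbb{R}_+,$$ where the continuously differentiable function $t\mapsto v(t,\lambda)\in\mathbb{R}_+^d$ is the unique locally bounded solution of $\partial_tv_i(t,\lambda)=-\varphi_i(v(t,\lambda))$,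 $v_i(0,\lambda)=\lambda_i$, $i\in\{1,\ldots,d\}$, with $\varphi_i(\lambda)=c_i\lambda_i^2-\langle Be_i,\lambda\rangle+\int_{U_d}\big(e^{-\langle\lambda,z\rangle}-1+\lambda_i(1\wedge z_i)\big)\mu_i(dz)$ and $\psi(\lambda)=\langle\beta,\lambda\rangle-\int_{U_d}\big(e^{-\langle\lambda,z\rangle}-1\big)\nu(dz)$.
   Formalization: The polynomial is shown to depend only on the parameters (and t, k, the indices) when X_0 is almost surely constant; for random X_0 it may depend on the law of the process, since otherwise the claim fails (all parameters zero gives X_t = X_0, and Var(X_0) = E(a+bX_0) is impossible). *)

theory Defs
  imports "HOL-Probability.Probability"
begin

text \<open>The dimension \<open>d\<close> is the cardinality of the finite index type \<^typ>\<open>'d\<close>.\<close>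

definition orthant :: "(real ^ 'd::finite) set" where
  "orthant = {x. \<forall>i. 0 \<le> x $ i}"

abbreviation orthant_borel :: "(real ^ 'd::finite) measure" where
  "orthant_borel \<equiv> restrict_space borel orthant"

abbreviation punctured_borel :: "(real ^ 'd::finite) measure" where
  "punctured_borel \<equiv> restrict_space borel (orthant - {0})"

definition admissible ::
    "real ^ 'd::finite \<Rightarrow> real ^ 'd \<Rightarrow> real ^ 'd ^ 'd \<Rightarrow> (real ^ 'd) measure
      \<Rightarrow> ('d \<Rightarrow> (real ^ 'd) measure) \<Rightarrow> bool" where
  "admissible c \<beta> B \<nu> \<mu> \<longleftrightarrow>
     c \<in> orthant \<and> \<beta> \<in> orthant \<and>
     (\<forall>i j. i \<noteq> j \<longrightarrow> 0 \<le> B $ i $ j) \<and>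
     sets \<nu> = sets punctured_borel \<and>
     integrable \<nu> (\<lambda>z. min 1 (norm z)) \<and>
     (\<forall>i. sets (\<mu> i) = sets punctured_borel \<and>
          integrable (\<mu> i) (\<lambda>z. min (norm z) ((norm z)\<^sup>2) + (\<Sum>j\<in>UNIV - {i}. z $ j)))"

text \<open>The vector \<open>B *v axis i 1\<close> is \<open>B e\<^sub>i\<close>, the column of \<open>B\<close> with index \<open>i\<close>.\<close>

definition branching_mechanism ::
    "real ^ 'd::finite \<Rightarrow> real ^ 'd ^ 'd \<Rightarrow> ('d \<Rightarrow> (real ^ 'd) measure)
      \<Rightarrow> real ^ 'd \<Rightarrow> real ^ 'd" where
  "branching_mechanism c B \<mu> l =
     (\<chi> i. c $ i * (l $ i)\<^sup>2 - (B *v axis i 1) \<bullet> l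
          + (\<integral>z. (exp (- (l \<bullet> z)) - 1 + l $ i * min 1 (z $ i)) \<partial>\<mu> i))"

definition immigration_mechanism ::
    "real ^ 'd::finite \<Rightarrow> (real ^ 'd) measure \<Rightarrow> real ^ 'd \<Rightarrow> real" where
  "immigration_mechanism \<beta> \<nu> l = \<beta> \<bullet> l - (\<integral>z. (exp (- (l \<bullet> z)) - 1) \<partial>\<nu>)"

text \<open>
  The derivative at time \<open>0\<close> is one-sided. A continuously differentiable solution is
  locally bounded in time, and for admissible parameters there is exactly one, because the
  branching mechanism is then locally Lipschitz on the orthant.
\<close>

definition cbi_flow ::
    "real ^ 'd::finite \<Rightarrow> real ^ 'd ^ 'd \<Rightarrow> ('d \<Rightarrow> (real ^ 'd) measure)
      \<Rightarrow> (real \<Rightarrow> real ^ 'd \<Rightarrow> real ^ 'd) \<Rightarrow> bool" where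
  "cbi_flow c B \<mu> v \<longleftrightarrow>
     (\<forall>l\<in>orthant.
        v 0 l = l \<and>
        (\<forall>t\<ge>0. v t l \<in> orthant) \<and>
        (\<forall>t\<ge>0. ((\<lambda>s. v s l) has_vector_derivative - branching_mechanism c B \<mu> (v t l))
                   (at t within {0..})) \<and>
        continuous_on {0..} (\<lambda>t. branching_mechanism c B \<mu> (v t l)))"

text \<open>
  The codomain \<^const>\<open>prob_algebra\<close> (probability measures, not merely subprobability
  measures) expresses that the semigroup is conservative.
\<close>

definition transition_semigroup ::
    "(real \<Rightarrow> real ^ 'd::finite \<Rightarrow> (real ^ 'd) measure) \<Rightarrow> bool" where
  "transition_semigroup K \<longleftrightarrow>
     (\<forall>t\<ge>0. K t \<in> orthant_borel \<rightarrow>\<^sub>M prob_algebra orthant_borel) \<and>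
     (\<forall>x\<in>orthant. K 0 x = return orthant_borel x) \<and>
     (\<forall>s\<ge>0. \<forall>t\<ge>0. \<forall>x\<in>orthant. K (s + t) x = K s x \<bind> K t)"

definition cbi_semigroup ::
    "real ^ 'd::finite \<Rightarrow> real ^ 'd \<Rightarrow> real ^ 'd ^ 'd \<Rightarrow> (real ^ 'd) measure
      \<Rightarrow> ('d \<Rightarrow> (real ^ 'd) measure) \<Rightarrow> (real \<Rightarrow> real ^ 'd \<Rightarrow> (real ^ 'd) measure) \<Rightarrow> bool" where
  "cbi_semigroup c \<beta> B \<nu> \<mu> K \<longleftrightarrow>
     transition_semigroup K \<and>
     (\<exists>v. cbi_flow c B \<mu> v \<and>
        (\<forall>t\<ge>0. \<forall>x\<in>orthant. \<forall>l\<in>orthant.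
           (\<integral>y. exp (- (l \<bullet> y)) \<partial>K t x) =
           exp (- (x \<bullet> v t l) - integral {0..t} (\<lambda>s. immigration_mechanism \<beta> \<nu> (v s l)))))"

definition natural_filtration ::
    "'a measure \<Rightarrow> (real \<Rightarrow> 'a \<Rightarrow> real ^ 'd::finite) \<Rightarrow> real \<Rightarrow> 'a measure" where
  "natural_filtration M X s =
     sigma (space M) {X u -` A \<inter> space M | u A. 0 \<le> u \<and> u \<le> s \<and> A \<in> sets borel}"

text \<open>
  The Markov property is required with respect to the natural filtration only, which is
  implied by the Markov property with respect to any larger filtration \<open>X\<close> is adapted to.
\<close>

definition markov_process ::
    "(real \<Rightarrow> real ^ 'd::finite \<Rightarrow> (real ^ 'd) measure) \<Rightarrow> 'a measure
      \<Rightarrow> (real \<Rightarrow> 'a \<Rightarrow> real ^ 'd) \<Rightarrow> bool" where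
  "markov_process K M X \<longleftrightarrow>
     prob_space M \<and>
     (\<forall>t\<ge>0. X t \<in> M \<rightarrow>\<^sub>M orthant_borel) \<and>
     (\<forall>s\<ge>0. \<forall>t\<ge>0. \<forall>A\<in>sets orthant_borel.
        AE \<omega> in M. real_cond_exp M (natural_filtration M X s) (\<lambda>\<omega>. indicator A (X (s + t) \<omega>)) \<omega>
                  = measure (K t (X s \<omega>)) A)"

definition cbi_process ::
    "real ^ 'd::finite \<Rightarrow> real ^ 'd \<Rightarrow> real ^ 'd ^ 'd \<Rightarrow> (real ^ 'd) measure
      \<Rightarrow> ('d \<Rightarrow> (real ^ 'd) measure) \<Rightarrow> 'a measure \<Rightarrow> (real \<Rightarrow> 'a \<Rightarrow> real ^ 'd) \<Rightarrow> bool" where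
  "cbi_process c \<beta> B \<nu> \<mu> M X \<longleftrightarrow>
     admissible c \<beta> B \<nu> \<mu> \<and> (\<exists>K. cbi_semigroup c \<beta> B \<nu> \<mu> K \<and> markov_process K M X)"

definition multi_indices :: "nat \<Rightarrow> ('d::finite \<Rightarrow> nat) set" where
  "multi_indices n = {\<alpha>. (\<Sum>j\<in>UNIV. \<alpha> j) \<le> n}"

lemma finite_multi_indices: "finite (multi_indices n :: ('d::finite \<Rightarrow> nat) set)"
proof (rule finite_subset)
  show "multi_indices n \<subseteq> (UNIV :: 'd set) \<rightarrow>\<^sub>E {..n}"
  proof
    fix \<alpha> :: "'d \<Rightarrow> nat"
    assume "\<alpha> \<in> multi_indices n"
    then have "(\<Sum>j\<in>UNIV. \<alpha> j) \<le> n" by (simp add: multi_indices_def)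
    then have "\<alpha> j \<le> n" for j
      using member_le_sum[of j UNIV \<alpha>] by (force intro: order_trans)
    then show "\<alpha> \<in> UNIV \<rightarrow>\<^sub>E {..n}" by auto
  qed
  show "finite ((UNIV :: 'd set) \<rightarrow>\<^sub>E {..n})" by (intro finite_PiE) auto
qed

definition polynomial_of_degree_at_most :: "nat \<Rightarrow> (real ^ 'd::finite \<Rightarrow> real) \<Rightarrow> bool" where
  "polynomial_of_degree_at_most n p \<longleftrightarrow>
     (\<exists>a :: ('d \<Rightarrow> nat) \<Rightarrow> real.
        \<forall>x. p x = (\<Sum>\<alpha>\<in>multi_indices n. a \<alpha> * (\<Prod>j\<in>UNIV. (x $ j) ^ \<alpha> j)))"

end

theory Submission
  imports Defs
begin

text \<open>
  For a direction \<open>u\<close> in the orthant, \<open>h \<mapsto> E (exp (- h \<langle>u, X\<^sub>t\<rangle>))\<close> under the starting point \<open>x\<close> equals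
  \<open>exp (- \<langle>x, v t (h u)\<rangle> - \<integral>\<^sub>0\<^sup>t \<psi> (v s (h u)) ds)\<close>. Subtracting its linear part, the branching mechanism
  is a Taylor polynomial without terms of order below two plus \<open>o(\<parallel>\<lambda>\<parallel>\<^sup>q)\<close>, so each application of
  Duhamel's formula raises by one the order to which \<open>v t (h u)\<close> is known to expand in \<open>h\<close>, up to
  order \<open>q\<close>. Hence the exponent has an expansion of order \<open>q\<close> whose coefficients, the cumulants, are
  affine in \<open>x\<close>, and the existence of moments up to order \<open>q\<close> follows. A central moment of order \<open>k\<close> is
  a sum of products of cumulants of orders at least two adding up to \<open>k\<close>, so it has at most \<open>k div 2\<close>
  factors. Polarization passes from directions to mixed moments. For a random
  starting point the polynomial may depend on the law of the process, so a constant one suffices.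
\<close>

subsection \<open>Uniform asymptotic expansions\<close>

text \<open>The moments of \<open>X t\<close> are not known to exist beforehand, so the Laplace
  transform cannot be differentiated under the integral; its behaviour near the origin has to come
  from the differential equation. The origin is a boundary point of the orthant and the jump
  measures have tail moments of order \<open>q\<close> only. Expansions for h > 0 along rays, with
  error o(h^q), ask for no differentiability of the flow in its initial value, are stable under
  sums, products and time integrals, and still determine the moments, because the signed Taylor
  remainders of exp (- x) are nonnegative for x \<ge> 0. Uniformity in \<open>s\<close> is forced by
  Duhamel's formula, which integrates over time. The loop closes because the nonlinear part is at
  least quadratic: after division by \<open>h\<close>, an error in v t (h u) / h enters it with an
  additional factor \<open>h\<close>.\<close>

text \<open>An expansion \<open>F h s = a\<^sub>0 s + a\<^sub>1 s * h + \<dots> + a\<^sub>n s * h ^ n + o(h ^ n)\<close> as \<open>h\<close> tends to \<open>0\<close> from the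
  right, uniformly in \<open>s \<in> S\<close>, with continuous coefficients. The Horner form makes the closure
  properties plain inductions.\<close>

fun uexp :: "real set \<Rightarrow> nat \<Rightarrow> (real \<Rightarrow> real \<Rightarrow> real) \<Rightarrow> bool" where
  "uexp S 0 F \<longleftrightarrow> (\<forall>\<^sub>F h in at_right 0. continuous_on S (F h)) \<and>
     (\<exists>a. continuous_on S a \<and> uniform_limit S F a (at_right 0))"
| "uexp S (Suc n) F \<longleftrightarrow> (\<exists>a G. continuous_on S a \<and> uexp S n G \<and>
     (\<forall>\<^sub>F h in at_right 0. \<forall>s\<in>S. F h s = a s + h * G h s))"

lemma uexp_SucE:
  assumes "uexp S (Suc n) F"
  obtains a G where "continuous_on S a" "uexp S n G"
    "\<forall>\<^sub>F h in at_right 0. \<forall>s\<in>S. F h s = a s + h * G h s"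
  using assms by auto

lemma uexp_continuous:
  "uexp S n F \<Longrightarrow> \<forall>\<^sub>F h in at_right 0. continuous_on S (F h)"
proof (induction n arbitrary: F)
  case (Suc n)
  then obtain a G where a: "continuous_on S a" and G: "uexp S n G"
    and F: "\<forall>\<^sub>F h in at_right 0. \<forall>s\<in>S. F h s = a s + h * G h s"
    by auto
  show ?case
    using F Suc.IH[OF G]
  proof eventually_elim
    case (elim h)
    have "continuous_on S (\<lambda>s. a s + h * G h s)"
      by (intro continuous_intros a elim)
    then show ?case
      using elim(1) by (simp cong: continuous_on_cong)
  qed
qed simp

lemma uexp_cong:
  assumes "uexp S n F" and "\<forall>\<^sub>F h in at_right 0. \<forall>s\<in>S. F h s = F' h s"
  shows "uexp S n F'"
proof (cases n)
  case 0
  have "\<forall>\<^sub>F h in at_right 0. continuous_on S (F' h)"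
    using uexp_continuous[OF assms(1)] assms(2)
    by eventually_elim (simp cong: continuous_on_cong)
  moreover obtain a where "continuous_on S a" "uniform_limit S F a (at_right 0)"
    using assms(1) 0 by auto
  moreover from this(2) have "uniform_limit S F' a (at_right 0)"
    by (rule uniform_limit_cong[THEN iffD1, rotated 2])
      (use assms(2) in \<open>auto elim: eventually_mono\<close>)
  ultimately show ?thesis
    using 0 by auto
next
  case (Suc m)
  then obtain a G where a: "continuous_on S a" and G: "uexp S m G"
    and F: "\<forall>\<^sub>F h in at_right 0. \<forall>s\<in>S. F h s = a s + h * G h s"
    using assms(1) by auto
  have "\<forall>\<^sub>F h in at_right 0. \<forall>s\<in>S. F' h s = a s + h * G h s"
    using F assms(2) by eventually_elim auto
  then show ?thesis
    using a G Suc by auto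
qed

text \<open>Compactness of \<open>S\<close> bounds the continuous limit \<open>a\<close>, as the
  product rule for uniform limits requires.\<close>

lemma uniform_limit_theta_mult:
  fixes G :: "real \<Rightarrow> real \<Rightarrow> real"
  assumes "compact S" "continuous_on S a" "uniform_limit S G a (at_right 0)"
  shows "uniform_limit S (\<lambda>h s. h * G h s) (\<lambda>_. 0) (at_right 0)"
proof -
  have "uniform_limit S (\<lambda>h s. h * G h s) (\<lambda>s. 0 * a s) (at_right 0)"
  proof (rule uniform_lim_mult)
    show "uniform_limit S (\<lambda>h _. h) (\<lambda>_. 0) (at_right (0::real))"
      by (simp add: uniform_limit_iff dist_norm eventually_at_right_field)
        (meson)
    show "bounded (a ` S)"
      using assms by (intro compact_imp_bounded compact_continuous_image)
    show "bounded ((\<lambda>_. 0::real) ` S)"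
      by (auto intro!: finite_imp_bounded finite_subset[of _ "{0}"])
  qed (rule assms)
  then show ?thesis by simp
qed

lemma uexp_Suc_imp_uexp:
  assumes "compact S"
  shows "uexp S (Suc n) F \<Longrightarrow> uexp S n F"
proof (induction n arbitrary: F)
  case 0
  then obtain a G b where a: "continuous_on S a" and b: "continuous_on S b"
    and G: "uniform_limit S G b (at_right 0)"
    and F: "\<forall>\<^sub>F h in at_right 0. \<forall>s\<in>S. F h s = a s + h * G h s"
    by auto
  have "uniform_limit S (\<lambda>h s. a s + h * G h s) (\<lambda>s. a s + 0) (at_right 0)"
    by (intro uniform_limit_add uniform_limit_const uniform_limit_theta_mult[OF assms b G])
  then have "uniform_limit S F a (at_right 0)"
    by (rule uniform_limit_cong[THEN iffD1, rotated 2]) (use F in \<open>auto elim: eventually_mono\<close>)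
  then show ?case
    using a uexp_continuous[OF 0] by auto
next
  case (Suc n)
  from Suc.prems obtain a G where a: "continuous_on S a" and G: "uexp S (Suc n) G"
    and F: "\<forall>\<^sub>F h in at_right 0. \<forall>s\<in>S. F h s = a s + h * G h s"
    by (rule uexp_SucE)
  show ?case
    using a F Suc.IH[OF G] by auto
qed

lemma uexp_mono:
  assumes "compact S" "m \<le> n" "uexp S n F"
  shows "uexp S m F"
  using assms(2,3)
proof (induction rule: dec_induct)
  case (step n)
  then show ?case using uexp_Suc_imp_uexp[OF assms(1)] by blast
qed

lemma uexp_const: "continuous_on S a \<Longrightarrow> uexp S n (\<lambda>_. a)"
proof (induction n arbitrary: a)
  case 0
  then show ?case by (auto intro!: exI[of _ a] uniform_limit_const)
next
  case (Suc n)
  show ?case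
    unfolding uexp.simps(2) using Suc.IH[of "\<lambda>_. 0"] Suc.prems
    by (intro exI[of _ a] exI[of _ "\<lambda>_ _. 0"]) simp
qed

text \<open>A factor \<open>h\<close> buys one order, as a Horner form with leading coefficient 0.
  Each round of the bootstrap for the flow gains its order here.\<close>

lemma uexp_theta_mult: "uexp S n G \<Longrightarrow> uexp S (Suc n) (\<lambda>h s. h * G h s)"
  unfolding uexp.simps(2) by (intro exI[of _ "\<lambda>_. 0"] exI[of _ G]) simp

lemma uexp_add: "uexp S n F \<Longrightarrow> uexp S n F' \<Longrightarrow> uexp S n (\<lambda>h s. F h s + F' h s)"
proof (induction n arbitrary: F F')
  case 0
  then obtain a b where a: "continuous_on S a" "uniform_limit S F a (at_right 0)"
    and b: "continuous_on S b" "uniform_limit S F' b (at_right 0)"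
    by auto
  have "\<forall>\<^sub>F h in at_right 0. continuous_on S (\<lambda>s. F h s + F' h s)"
    using uexp_continuous[OF 0(1)] uexp_continuous[OF 0(2)]
    by eventually_elim (intro continuous_intros)
  then show ?case
    using a b by (auto intro!: exI[of _ "\<lambda>s. a s + b s"] continuous_intros uniform_limit_add)
next
  case (Suc n)
  then obtain a G b H where a: "continuous_on S a" "uexp S n G"
    and F: "\<forall>\<^sub>F h in at_right 0. \<forall>s\<in>S. F h s = a s + h * G h s"
    and b: "continuous_on S b" "uexp S n H"
    and F': "\<forall>\<^sub>F h in at_right 0. \<forall>s\<in>S. F' h s = b s + h * H h s"
    by auto
  have "\<forall>\<^sub>F h in at_right 0. \<forall>s\<in>S. F h s + F' h s = (a s + b s) + h * (G h s + H h s)"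
    using F F' by eventually_elim (auto simp: algebra_simps)
  then show ?case
    using Suc.IH[OF a(2) b(2)] continuous_on_add[OF a(1) b(1)] by auto
qed

lemma uexp_sum:
  "(\<And>i. i \<in> I \<Longrightarrow> uexp S n (F i)) \<Longrightarrow> uexp S n (\<lambda>h s. \<Sum>i\<in>I. F i h s)"
proof (induction I rule: infinite_finite_induct)
  case (insert x I)
  then have "uexp S n (\<lambda>h s. F x h s + (\<Sum>i\<in>I. F i h s))"
    by (intro uexp_add) blast+
  then show ?case using insert by simp
qed (simp_all add: uexp_const)

lemma uexp_mult:
  assumes "compact S"
  shows "uexp S n F \<Longrightarrow> uexp S n F' \<Longrightarrow> uexp S n (\<lambda>h s. F h s * F' h s)"
proof (induction n arbitrary: F F')
  case 0
  then obtain a b where a: "continuous_on S a" "uniform_limit S F a (at_right 0)"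
    and b: "continuous_on S b" "uniform_limit S F' b (at_right 0)"
    by auto
  have "\<forall>\<^sub>F h in at_right 0. continuous_on S (\<lambda>s. F h s * F' h s)"
    using uexp_continuous[OF 0(1)] uexp_continuous[OF 0(2)]
    by eventually_elim (intro continuous_intros)
  moreover have "bounded (a ` S)" "bounded (b ` S)"
    using assms a b by (auto intro!: compact_imp_bounded compact_continuous_image)
  ultimately show ?case
    using a b by (auto intro!: exI[of _ "\<lambda>s. a s * b s"] continuous_intros uniform_lim_mult)
next
  case (Suc n)
  then obtain a G b H where a: "continuous_on S a" "uexp S n G"
    and F: "\<forall>\<^sub>F h in at_right 0. \<forall>s\<in>S. F h s = a s + h * G h s"
    and b: "continuous_on S b" "uexp S n H"
    and F': "\<forall>\<^sub>F h in at_right 0. \<forall>s\<in>S. F' h s = b s + h * H h s"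
    by auto
  have "\<forall>\<^sub>F h in at_right 0. \<forall>s\<in>S.
      F h s * F' h s = a s * b s + h * (a s * H h s + b s * G h s + h * (G h s * H h s))"
    using F F' by eventually_elim (auto simp: algebra_simps)
  moreover have "uexp S n (\<lambda>h s. a s * H h s + b s * G h s + h * (G h s * H h s))"
    by (intro uexp_add Suc.IH uexp_const a b
        uexp_Suc_imp_uexp[OF assms uexp_theta_mult])
  ultimately show ?case
    using continuous_on_mult[OF a(1) b(1)] by auto
qed

lemma uexp_power:
  "compact S \<Longrightarrow> uexp S n F \<Longrightarrow> uexp S n (\<lambda>h s. F h s ^ j)"
  by (induction j) (simp_all add: uexp_const uexp_mult)

lemma uexp_theta_power_mult:
  assumes "compact S" "uexp S n F"
  shows "uexp S n (\<lambda>h s. h ^ j * F h s)"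
proof (induction j)
  case 0
  then show ?case using assms by simp
next
  case (Suc j)
  then have "uexp S n (\<lambda>h s. h * (h ^ j * F h s))"
    by (rule uexp_Suc_imp_uexp[OF assms(1) uexp_theta_mult])
  then show ?case by (simp add: mult.assoc)
qed

text \<open>All coefficients are 0: each division by \<open>h\<close> peels off one Horner layer and
  lowers the order demanded. Continuity is assumed separately because smallness in \<open>h\<close>
  says nothing about regularity in \<open>s\<close>.\<close>

lemma uexp_remainder:
  assumes "\<forall>\<^sub>F h in at_right 0. continuous_on S (R h)"
    and "uniform_limit S (\<lambda>h s. R h s / h ^ n) (\<lambda>_. 0) (at_right 0)"
  shows "uexp S n R"
  using assms
proof (induction n arbitrary: R)
  case 0
  then show ?case by (auto intro!: exI[of _ "\<lambda>_. 0"])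
next
  case (Suc n)
  have "\<forall>\<^sub>F h::real in at_right 0. h > 0"
    by (simp add: eventually_at_filter)
  then have "\<forall>\<^sub>F h in at_right 0. \<forall>s\<in>S. R h s = 0 + h * (R h s / h)"
    by eventually_elim auto
  moreover have "uexp S n (\<lambda>h s. R h s / h)"
  proof (rule Suc.IH)
    show "\<forall>\<^sub>F h in at_right 0. continuous_on S (\<lambda>s. R h s / h)"
      using Suc.prems(1) \<open>\<forall>\<^sub>F h::real in at_right 0. h > 0\<close>
      by eventually_elim (intro continuous_intros, auto)
    show "uniform_limit S (\<lambda>h s. R h s / h / h ^ n) (\<lambda>_. 0) (at_right 0)"
      using Suc.prems(2) by (simp add: mult.commute)
  qed
  ultimately show ?case
    unfolding uexp.simps(2)
    by (intro exI[of _ "\<lambda>_. 0"] exI[of _ "\<lambda>h s. R h s / h"] conjI) simp_all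
qed

lemma continuous_on_integral_upto:
  fixes a :: "real \<Rightarrow> real"
  assumes "continuous_on {0..T} a"
  shows "continuous_on {0..T} (\<lambda>s. integral {0..s} a)"
  by (intro indefinite_integral_continuous_1 integrable_continuous_real assms)

text \<open>Each coefficient is replaced by its time integral, so no order is lost. Uniformity in
  \<open>s\<close> carries the limit through the integral, and continuity makes the terms
  integrable.\<close>

lemma uexp_integral:
  "uexp {0..T} n F \<Longrightarrow> uexp {0..T} n (\<lambda>h s. integral {0..s} (F h))"
proof (induction n arbitrary: F)
  case 0
  then obtain a where a: "continuous_on {0..T} a" "uniform_limit {0..T} F a (at_right 0)"
    and F: "\<forall>\<^sub>F h in at_right 0. continuous_on {0..T} (F h)"
    by auto
  have "uniform_limit {0..T} (\<lambda>h s. integral {0..s} (F h)) (\<lambda>s. integral {0..s} a) (at_right 0)"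
    unfolding uniform_limit_iff
  proof (intro allI impI)
    fix e :: real assume "e > 0"
    \<comment> \<open>The sign of \<open>T\<close> is not fixed, hence the absolute value; the added
      1 keeps the denominator positive.\<close>
    define d where "d = e / (\<bar>T\<bar> + 1)"
    have "d > 0" "d * \<bar>T\<bar> < e"
      using \<open>e > 0\<close> by (auto simp: d_def field_simps)
    have "\<forall>\<^sub>F h in at_right 0. \<forall>s\<in>{0..T}. dist (F h s) (a s) < d"
      using a(2) \<open>d > 0\<close> by (auto simp: uniform_limit_iff)
    with F show "\<forall>\<^sub>F h in at_right 0. \<forall>s\<in>{0..T}. dist (integral {0..s} (F h)) (integral {0..s} a) < e"
    proof eventually_elim
      case (elim h)
      show ?case
      proof
        fix s assume s: "s \<in> {0..T}"
        have ints: "F h integrable_on {0..s}" "a integrable_on {0..s}"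
          using s by (auto intro!: integrable_continuous_real
              continuous_on_subset[OF elim(1)] continuous_on_subset[OF a(1)])
        have "norm (integral {0..s} (\<lambda>x. F h x - a x)) \<le> d * (s - 0)"
        proof (rule integral_bound)
          show "continuous_on {0..s} (\<lambda>x. F h x - a x)"
            using s by (intro continuous_on_diff continuous_on_subset[OF elim(1)]
                continuous_on_subset[OF a(1)]) auto
          show "norm (F h x - a x) \<le> d" if "x \<in> {0..s}" for x
            using elim(2) s that by (force simp: dist_norm)
        qed (use s in auto)
        also have "\<dots> \<le> d * \<bar>T\<bar>"
          using s \<open>d > 0\<close> by (intro mult_left_mono) auto
        finally show "dist (integral {0..s} (F h)) (integral {0..s} a) < e"
          using \<open>d * \<bar>T\<bar> < e\<close> ints by (simp add: dist_norm integral_diff)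
      qed
    qed
  qed
  moreover have "\<forall>\<^sub>F h in at_right 0. continuous_on {0..T} (\<lambda>s. integral {0..s} (F h))"
    using F by eventually_elim (rule continuous_on_integral_upto)
  ultimately show ?case
    using continuous_on_integral_upto[OF a(1)] by auto
next
  case (Suc n)
  then obtain a G where a: "continuous_on {0..T} a" and G: "uexp {0..T} n G"
    and F: "\<forall>\<^sub>F h in at_right 0. \<forall>s\<in>{0..T}. F h s = a s + h * G h s"
    by auto
  have "\<forall>\<^sub>F h in at_right 0. \<forall>s\<in>{0..T}.
      integral {0..s} (F h) = integral {0..s} a + h * integral {0..s} (G h)"
    using F uexp_continuous[OF G]
  proof eventually_elim
    case (elim h)
    show ?case
    proof
      fix s assume s: "s \<in> {0..T}"
      have ints: "G h integrable_on {0..s}" "a integrable_on {0..s}"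
        using s by (auto intro!: integrable_continuous_real
            continuous_on_subset[OF elim(2)] continuous_on_subset[OF a])
      have "integral {0..s} (F h) = integral {0..s} (\<lambda>s. a s + h * G h s)"
        using elim(1) s by (intro integral_cong) auto
      also have "\<dots> = integral {0..s} a + h * integral {0..s} (G h)"
        using ints by (subst integral_add) (auto intro!: integrable_on_mult_right)
      finally show "integral {0..s} (F h) = integral {0..s} a + h * integral {0..s} (G h)" .
    qed
  qed
  then show ?case
    using Suc.IH[OF G] continuous_on_integral_upto[OF a] by auto
qed

lemma uexp_imp_poly:
  assumes "uexp S n F" "s \<in> S"
  shows "\<exists>p. (\<lambda>h. F h s - poly p h) \<in> o[at_right 0](\<lambda>h. h ^ n)"
  using assms(1)
proof (induction n arbitrary: F)
  case 0
  then obtain a where "uniform_limit S F a (at_right 0)" by auto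
  then have "((\<lambda>h. F h s) \<longlongrightarrow> a s) (at_right 0)"
    using assms(2) by (rule tendsto_uniform_limitI)
  then have "((\<lambda>h. F h s - a s) \<longlongrightarrow> 0) (at_right 0)"
    by (rule LIM_zero)
  then show ?case
    by (intro exI[of _ "[:a s:]"]) (auto intro!: smalloI_tendsto)
next
  case (Suc n)
  then obtain a G where G: "uexp S n G"
    and F: "\<forall>\<^sub>F h in at_right 0. \<forall>s\<in>S. F h s = a s + h * G h s"
    by auto
  obtain p where p: "(\<lambda>h. G h s - poly p h) \<in> o[at_right 0](\<lambda>h. h ^ n)"
    using Suc.IH[OF G] by blast
  have "(\<lambda>h. h * (G h s - poly p h)) \<in> o[at_right 0](\<lambda>h. h * h ^ n)"
    using p by (intro landau_o.big_small_mult) auto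
  moreover have "\<forall>\<^sub>F h in at_right 0. h * (G h s - poly p h) = F h s - poly (pCons (a s) p) h"
    using F by eventually_elim (use assms(2) in \<open>auto simp: algebra_simps\<close>)
  ultimately show ?case
    by (intro exI[of _ "pCons (a s) p"]) (simp add: landau_o.small.in_cong)
qed

subsection \<open>Taylor remainders of the exponential function and the matrix exponential\<close>

text \<open>Up to the sign \<open>(-1)\<^sup>p\<close>, the remainder of the Taylor polynomial of \<open>exp (- x)\<close> of degree below \<open>p\<close>;
  with this sign it is nonnegative for \<open>x \<ge> 0\<close>.\<close>

primrec exp_rem :: "nat \<Rightarrow> real \<Rightarrow> real" where
  "exp_rem 0 x = exp (- x)"
| "exp_rem (Suc p) x = x ^ p / fact p - exp_rem p x"

lemma exp_rem_measurable [measurable]: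
  "f \<in> borel_measurable M \<Longrightarrow> (\<lambda>x. exp_rem p (f x)) \<in> borel_measurable M"
  by (induction p) auto

lemma exp_rem_at_0: "exp_rem (Suc p) 0 = 0"
  by (induction p) auto

text \<open>The sign convention turns the family into a ladder under differentiation: nonnegativity,
  monotonicity and Lipschitz bounds at one index follow from the index below.\<close>

lemma exp_rem_deriv: "(exp_rem (Suc p) has_real_derivative exp_rem p x) (at x)"
proof (induction p arbitrary: x)
  case 0
  have "((\<lambda>x. 1 - exp (- x)) has_real_derivative exp (- x)) (at x)"
    by (auto intro!: derivative_eq_intros)
  then show ?case by simp
next
  case (Suc p)
  have fact: "(1 + real p) * x ^ p / fact (Suc p) = x ^ p / fact p"
    by (simp add: divide_simps)
  have "((\<lambda>x. x ^ Suc p / fact (Suc p) - exp_rem (Suc p) x) has_real_derivative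
      (1 + real p) * x ^ p / fact (Suc p) - exp_rem p x) (at x)"
    by (rule derivative_eq_intros Suc.IH refl | simp)+
  then show ?case
    unfolding fact by simp
qed

lemma exp_rem_nonneg: "0 \<le> x \<Longrightarrow> 0 \<le> exp_rem p x"
proof (induction p arbitrary: x)
  case (Suc p)
  have "exp_rem (Suc p) 0 \<le> exp_rem (Suc p) x"
    by (rule DERIV_nonneg_imp_nondecreasing[OF Suc.prems]) (use exp_rem_deriv Suc.IH in blast)
  then show ?case by (simp add: exp_rem_at_0 del: exp_rem.simps)
qed simp

text \<open>This is nonnegativity of the next remainder, read through the recursion.\<close>

lemma exp_rem_le: "0 \<le> x \<Longrightarrow> exp_rem p x \<le> x ^ p / fact p"
  using exp_rem_nonneg[of x "Suc p"] by simp

lemma exp_rem_le_power: "0 \<le> x \<Longrightarrow> exp_rem p x \<le> x ^ p"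
proof -
  assume "0 \<le> x"
  then have "x ^ p / fact p \<le> x ^ p / 1"
    by (intro divide_left_mono) auto
  then show ?thesis
    using exp_rem_le[OF \<open>0 \<le> x\<close>, of p] by simp
qed

text \<open>The lower power serves large jumps, where no higher moment is available; the higher
  power serves small jumps and, after scaling, leaves the spare factor \<open>h\<close> that makes
  the remainder vanish.\<close>

lemma exp_rem_Suc_le_power: "0 \<le> x \<Longrightarrow> exp_rem (Suc p) x \<le> min (x ^ p) (x ^ Suc p)"
proof -
  assume "0 \<le> x"
  then have "x ^ p / fact p \<le> x ^ p / 1"
    by (intro divide_left_mono) auto
  then show ?thesis
    using exp_rem_le_power[OF \<open>0 \<le> x\<close>, of "Suc p"] exp_rem_nonneg[OF \<open>0 \<le> x\<close>, of p] by simp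
qed

lemma exp_rem_mono:
  assumes "0 \<le> x" "x \<le> y"
  shows "exp_rem (Suc p) x \<le> exp_rem (Suc p) y"
proof (rule DERIV_nonneg_imp_nondecreasing[OF assms(2)])
  fix z assume "x \<le> z" "z \<le> y"
  then show "\<exists>d. (exp_rem (Suc p) has_real_derivative d) (at z) \<and> 0 \<le> d"
    using assms(1) by (intro exI[of _ "exp_rem p z"] conjI exp_rem_deriv exp_rem_nonneg) simp
qed

lemma exp_rem_expand:
  "exp_rem p x = (\<Sum>j<r. (-1) ^ j * x ^ (p + j) / fact (p + j)) + (-1) ^ r * exp_rem (p + r) x"
  by (induction r) (simp_all add: algebra_simps)

lemma exp_rem_Suc_lipschitz:
  assumes "0 \<le> x" "0 \<le> y" "\<And>z. 0 \<le> z \<Longrightarrow> z \<le> max x y \<Longrightarrow> exp_rem p z \<le> K"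
  shows "\<bar>exp_rem (Suc p) x - exp_rem (Suc p) y\<bar> \<le> K * \<bar>x - y\<bar>"
proof -
  have "norm (exp_rem (Suc p) x - exp_rem (Suc p) y) \<le> K * norm (x - y)"
  proof (rule field_differentiable_bound[where S = "{0..max x y}" and f' = "exp_rem p"])
    show "(exp_rem (Suc p) has_field_derivative exp_rem p z) (at z within {0..max x y})" for z
      by (rule has_field_derivative_at_within[OF exp_rem_deriv])
    show "norm (exp_rem p z) \<le> K" if "z \<in> {0..max x y}" for z
      using assms(3)[of z] that exp_rem_nonneg[of z p] by simp
  qed (use assms in auto)
  then show ?thesis by simp
qed

section \<open>The matrix exponential as an entrywise power series, with its left and right
  derivative formulas\<close>

lemma mat_exp_exists:
  fixes A :: "real ^ 'd::finite ^ 'd"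
  shows "\<exists>E :: real \<Rightarrow> real ^ 'd ^ 'd. E 0 = mat 1 \<and>
    (\<forall>t i j. ((\<lambda>t. E t $ i $ j) has_real_derivative (E t ** A) $ i $ j) (at t)) \<and>
    (\<forall>t i j. ((\<lambda>t. E t $ i $ j) has_real_derivative (A ** E t) $ i $ j) (at t))"
proof -
  define pw where "pw n = (((**) A) ^^ n) (mat 1)" for n :: nat
  have pw_Suc: "pw (Suc n) = A ** pw n" for n
    by (simp add: pw_def)
  have pw_Suc': "pw (Suc n) = pw n ** A" for n
  proof (induction n)
    case (Suc n)
    then show ?case by (metis pw_Suc matrix_mul_assoc)
  qed (simp add: pw_def)
  \<comment> \<open>The sum of all absolute entries dominates every row sum, so the entries of the
    \<open>n\<close>-th power are at most \<open>K ^ n\<close> and the series is dominated by the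
    exponential series of \<open>K * \<bar>t\<bar>\<close>.\<close>
  define K where "K = (\<Sum>i\<in>UNIV. \<Sum>j\<in>UNIV. \<bar>A $ i $ j\<bar>)"
  have K: "\<bar>pw n $ i $ j\<bar> \<le> K ^ n" for n i j
  proof (induction n arbitrary: i)
    case 0
    then show ?case by (simp add: pw_def mat_def)
  next
    case (Suc n)
    have "\<bar>pw (Suc n) $ i $ j\<bar> \<le> (\<Sum>k\<in>UNIV. \<bar>A $ i $ k\<bar> * \<bar>pw n $ k $ j\<bar>)"
      unfolding pw_Suc matrix_matrix_mult_def by (simp add: sum_abs[THEN order_trans] abs_mult)
    also have "\<dots> \<le> (\<Sum>k\<in>UNIV. \<bar>A $ i $ k\<bar> * K ^ n)"
      by (intro sum_mono mult_left_mono Suc.IH) auto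
    also have "\<dots> = (\<Sum>k\<in>UNIV. \<bar>A $ i $ k\<bar>) * K ^ n"
      by (simp add: sum_distrib_right)
    also have "\<dots> \<le> K * K ^ n"
      unfolding K_def
      by (intro mult_right_mono zero_le_power sum_nonneg member_le_sum[of i UNIV "\<lambda>i. \<Sum>j\<in>UNIV. \<bar>A $ i $ j\<bar>"]) auto
    finally show ?case by simp
  qed
  define cf where "cf i j n = pw n $ i $ j / fact n" for i j n
  have summ: "summable (\<lambda>n. cf i j n * t ^ n)" for i j t
  proof (rule summable_comparison_test'[where N = 0])
    show "summable (\<lambda>n. inverse (fact n) * (K * \<bar>t\<bar>) ^ n)"
      by (rule summable_exp)
    show "norm (cf i j n * t ^ n) \<le> inverse (fact n) * (K * \<bar>t\<bar>) ^ n" for n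
      using mult_right_mono[OF K[of n i j], of "\<bar>t\<bar> ^ n / fact n"]
      by (simp add: cf_def abs_mult power_abs field_simps)
  qed
  define E where "E t = (\<chi> i j. \<Sum>n. cf i j n * t ^ n)" for t
  have d: "diffs (cf i j) n = pw (Suc n) $ i $ j / fact n" for i j n
    by (simp add: diffs_def cf_def divide_simps)
  have deriv: "((\<lambda>t. E t $ i $ j) has_real_derivative (\<Sum>n. diffs (cf i j) n * t ^ n)) (at t)" for i j t
    unfolding E_def by simp (rule termdiffs_strong_converges_everywhere[OF summ])
  have right: "(\<Sum>n. diffs (cf i j) n * t ^ n) = (E t ** A) $ i $ j" for i j t
  proof -
    have "(\<Sum>n. diffs (cf i j) n * t ^ n) = (\<Sum>n. \<Sum>k\<in>UNIV. cf i k n * t ^ n * A $ k $ j)"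
      unfolding d pw_Suc' cf_def matrix_matrix_mult_def
      by (simp add: sum_divide_distrib sum_distrib_right sum_distrib_left mult_ac)
    also have "\<dots> = (\<Sum>k\<in>UNIV. \<Sum>n. cf i k n * t ^ n * A $ k $ j)"
      by (rule suminf_sum) (intro summable_mult2 summ)
    also have "\<dots> = (E t ** A) $ i $ j"
      unfolding E_def matrix_matrix_mult_def by (simp add: suminf_mult2[OF summ])
    finally show ?thesis .
  qed
  have left: "(\<Sum>n. diffs (cf i j) n * t ^ n) = (A ** E t) $ i $ j" for i j t
  proof -
    have "(\<Sum>n. diffs (cf i j) n * t ^ n) = (\<Sum>n. \<Sum>k\<in>UNIV. A $ i $ k * (cf k j n * t ^ n))"
      unfolding d pw_Suc cf_def matrix_matrix_mult_def
      by (simp add: sum_divide_distrib sum_distrib_right sum_distrib_left mult_ac)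
    also have "\<dots> = (\<Sum>k\<in>UNIV. \<Sum>n. A $ i $ k * (cf k j n * t ^ n))"
      by (rule suminf_sum) (intro summable_mult summ)
    also have "\<dots> = (A ** E t) $ i $ j"
      unfolding E_def matrix_matrix_mult_def by (simp add: suminf_mult[OF summ])
    finally show ?thesis .
  qed
  have "E 0 $ i $ j = cf i j 0" for i j
    unfolding E_def by (simp add: powser_zero)
  then have "E 0 = mat 1"
    by (simp add: vec_eq_iff mat_def cf_def pw_def)
  then show ?thesis
    using deriv unfolding right using deriv unfolding left by (intro exI[of _ E]) auto
qed

text \<open>\<open>P t\<close> and \<open>Q t\<close> are exp (t A) and exp (- t A). Differentiating
  their product with the right formula for the first factor and the left formula for the second puts
  \<open>A\<close> between the factors with opposite signs, so the product is constant.\<close>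

lemma linear_flow_exists:
  fixes A :: "real ^ 'd::finite ^ 'd"
  obtains P Q :: "real \<Rightarrow> real ^ 'd ^ 'd"
  where "\<And>t. P t ** Q t = mat 1" "Q 0 = mat 1"
    "\<And>i j S. continuous_on S (\<lambda>t. P t $ i $ j)"
    "\<And>t i j. ((\<lambda>t. Q t $ i $ j) has_real_derivative - (Q t ** A) $ i $ j) (at t)"
proof -
  obtain E where E0: "E 0 = mat 1"
    and r: "\<And>t i j. ((\<lambda>t. E t $ i $ j) has_real_derivative (E t ** A) $ i $ j) (at t)"
    and l: "\<And>t i j. ((\<lambda>t. E t $ i $ j) has_real_derivative (A ** E t) $ i $ j) (at t)"
    using mat_exp_exists[of A] by blast
  have rm: "((\<lambda>t. E (- t) $ i $ j) has_real_derivative - (E (- t) ** A) $ i $ j) (at t)" for t i j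
    using DERIV_chain2[OF r[of i j "- t"] DERIV_minus[OF DERIV_ident]] by simp
  have lm: "((\<lambda>t. E (- t) $ i $ j) has_real_derivative - (A ** E (- t)) $ i $ j) (at t)" for t i j
    using DERIV_chain2[OF l[of i j "- t"] DERIV_minus[OF DERIV_ident]] by simp
  have "((\<lambda>t. (E t ** E (- t)) $ i $ j) has_real_derivative 0) (at t)" for i j t
  proof -
    have "((\<lambda>t. \<Sum>k\<in>UNIV. E t $ i $ k * E (- t) $ k $ j) has_real_derivative
        (\<Sum>k\<in>UNIV. (E t ** A) $ i $ k * E (- t) $ k $ j + - (A ** E (- t)) $ k $ j * E t $ i $ k)) (at t)"
      by (intro DERIV_sum DERIV_mult r lm)
    also have "(\<Sum>k\<in>UNIV. (E t ** A) $ i $ k * E (- t) $ k $ j + - (A ** E (- t)) $ k $ j * E t $ i $ k)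
       = ((E t ** A) ** E (- t)) $ i $ j - (E t ** (A ** E (- t))) $ i $ j"
      by (simp add: matrix_matrix_mult_def[of "E t ** A"] matrix_matrix_mult_def[of "E t" "A ** _"]
          sum_subtractf mult.commute)
    finally show ?thesis
      by (simp add: matrix_mul_assoc) (simp add: matrix_matrix_mult_def)
  qed
  then have "(E t ** E (- t)) $ i $ j = (E 0 ** E (- 0)) $ i $ j" for t i j
    by (intro DERIV_isconst_all) auto
  then have "E t ** E (- t) = mat 1" for t
    by (simp add: vec_eq_iff E0)
  moreover have "continuous_on S (\<lambda>t. E t $ i $ j)" for S i j
    by (intro continuous_at_imp_continuous_on ballI DERIV_isCont[OF r])
  ultimately show ?thesis
    using that[of E "\<lambda>t. E (- t)"] E0 rm by auto
qed

subsection \<open>Integrals of Taylor remainders against jump measures\<close>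

lemma orthant_inner_nonneg: "x \<in> orthant \<Longrightarrow> y \<in> orthant \<Longrightarrow> 0 \<le> x \<bullet> y"
  by (auto simp: orthant_def inner_vec_def intro!: sum_nonneg)

lemma orthant_scaleR: "x \<in> orthant \<Longrightarrow> 0 \<le> a \<Longrightarrow> a *\<^sub>R x \<in> orthant"
  by (auto simp: orthant_def)

lemma space_punctured: "sets m = sets punctured_borel \<Longrightarrow> space m = orthant - {0}"
  by (drule sets_eq_imp_space_eq) (simp add: space_restrict_space)

lemma measurable_punctured:
  assumes "sets m = sets punctured_borel" "f \<in> borel_measurable borel"
  shows "f \<in> borel_measurable m"
  unfolding measurable_cong_sets[OF assms(1) refl]
  by (rule measurable_restrict_space1[OF assms(2)])

definition rem_int :: "(real ^ 'd::finite) measure \<Rightarrow> nat \<Rightarrow> real ^ 'd \<Rightarrow> real" where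
  "rem_int m p l = (\<integral>z. exp_rem p (l \<bullet> z) \<partial>m)"

lemma rem_int_nonneg:
  assumes "sets m = sets punctured_borel" "l \<in> orthant"
  shows "0 \<le> rem_int m p l"
  unfolding rem_int_def using assms
  by (intro integral_nonneg_AE AE_I2 exp_rem_nonneg orthant_inner_nonneg) (auto simp: space_punctured)

text \<open>\<open>G z\<close> majorizes the derivative of the integrand in \<open>l\<close>, which
  is the remainder of index \<open>p\<close> times at most \<open>norm z\<close>; the mean value
  bound does the rest. This form covers both kinds of jump measure: for immigration
  \<open>p = 0\<close> with \<open>norm\<close> as majorant, for branching \<open>p = 1\<close> with
  a multiple of \<open>min (norm z) ((norm z)\<^sup>2)\<close>.\<close>

lemma integrable_exp_rem:
  assumes m: "sets m = sets punctured_borel" and G: "integrable m G" and l: "l \<in> orthant"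
    and le: "\<And>z x. z \<in> orthant \<Longrightarrow> 0 \<le> x \<Longrightarrow> x \<le> norm l * norm z \<Longrightarrow> exp_rem p x * norm z \<le> G z"
  shows "integrable m (\<lambda>z. exp_rem (Suc p) (l \<bullet> z))"
proof (rule Bochner_Integration.integrable_bound)
  show "integrable m (\<lambda>z. norm l * G z)"
    using G by simp
  show "(\<lambda>z. exp_rem (Suc p) (l \<bullet> z)) \<in> borel_measurable m"
    by (intro measurable_punctured[OF m] exp_rem_measurable) simp
  have "\<bar>exp_rem (Suc p) (l \<bullet> z)\<bar> \<le> \<bar>norm l * G z\<bar>" if "z \<in> space m" for z
  proof (cases "norm z = 0")
    case True
    then show ?thesis using exp_rem_at_0[of p] by (simp del: exp_rem.simps)
  next
    case False
    have z: "z \<in> orthant"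
      using that space_punctured[OF m] by simp
    have lz: "0 \<le> l \<bullet> z" "l \<bullet> z \<le> norm l * norm z"
      using orthant_inner_nonneg[OF l z] norm_cauchy_schwarz[of l z] by auto
    have "\<bar>exp_rem (Suc p) (l \<bullet> z) - exp_rem (Suc p) 0\<bar> \<le> (G z / norm z) * \<bar>l \<bullet> z - 0\<bar>"
    proof (rule exp_rem_Suc_lipschitz)
      fix x assume "0 \<le> x" "x \<le> max (l \<bullet> z) 0"
      then show "exp_rem p x \<le> G z / norm z"
        using le[OF z, of x] lz False by (simp add: field_simps)
    qed (use lz in auto)
    also have "\<dots> \<le> (G z / norm z) * (norm l * norm z)"
      using lz le[OF z, of 0] exp_rem_nonneg[of 0 p]
      by (intro mult_left_mono) (auto intro!: divide_nonneg_nonneg intro: order_trans[rotated])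
    finally show ?thesis
      using False by (simp add: exp_rem_at_0 mult.commute del: exp_rem.simps)
  qed
  then show "AE z in m. norm (exp_rem (Suc p) (l \<bullet> z)) \<le> norm (norm l * G z)"
    by simp
qed

lemma rem_int_lipschitz:
  assumes m: "sets m = sets punctured_borel" and G: "integrable m G"
    and le: "\<And>z x. z \<in> orthant \<Longrightarrow> 0 \<le> x \<Longrightarrow> x \<le> R * norm z \<Longrightarrow> exp_rem p x * norm z \<le> G z"
    and l: "l \<in> orthant" "norm l \<le> R" and l': "l' \<in> orthant" "norm l' \<le> R"
  shows "\<bar>rem_int m (Suc p) l - rem_int m (Suc p) l'\<bar> \<le> (\<integral>z. G z \<partial>m) * norm (l - l')"
proof -
  have le': "exp_rem p x * norm z \<le> G z"
    if "z \<in> orthant" "0 \<le> x" "x \<le> norm k * norm z" "norm k \<le> R" for z x and k :: "real ^ 'a"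
    using le[of z x] that mult_right_mono[OF \<open>norm k \<le> R\<close>, of "norm z"] by auto
  have int: "integrable m (\<lambda>z. exp_rem (Suc p) (l \<bullet> z))" "integrable m (\<lambda>z. exp_rem (Suc p) (l' \<bullet> z))"
    using l l' by (auto intro!: integrable_exp_rem[OF m G] le' simp del: exp_rem.simps)
  have ptw: "\<bar>exp_rem (Suc p) (l \<bullet> z) - exp_rem (Suc p) (l' \<bullet> z)\<bar> \<le> G z * norm (l - l')"
    if "z \<in> space m" for z
  proof -
    have z: "z \<in> orthant" "norm z > 0"
      using that space_punctured[OF m] by auto
    have lz: "0 \<le> l \<bullet> z" "l \<bullet> z \<le> norm l * norm z" "0 \<le> l' \<bullet> z" "l' \<bullet> z \<le> norm l' * norm z"
      using orthant_inner_nonneg[OF l(1) z(1)] norm_cauchy_schwarz[of l z]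
        orthant_inner_nonneg[OF l'(1) z(1)] norm_cauchy_schwarz[of l' z] by auto
    have "\<bar>exp_rem (Suc p) (l \<bullet> z) - exp_rem (Suc p) (l' \<bullet> z)\<bar> \<le> (G z / norm z) * \<bar>l \<bullet> z - l' \<bullet> z\<bar>"
    proof (rule exp_rem_Suc_lipschitz)
      fix x assume "0 \<le> x" "x \<le> max (l \<bullet> z) (l' \<bullet> z)"
      then have "x \<le> norm l * norm z \<or> x \<le> norm l' * norm z"
        using lz by auto
      then show "exp_rem p x \<le> G z / norm z"
        using le'[OF z(1) \<open>0 \<le> x\<close>] l l' z by (auto simp: field_simps)
    qed (use lz in auto)
    also have "\<dots> \<le> (G z / norm z) * (norm (l - l') * norm z)"
      using z le'[OF z(1), of 0 l] l exp_rem_nonneg[of 0 p] Cauchy_Schwarz_ineq2[of "l - l'" z]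
      by (intro mult_left_mono)
        (auto intro!: divide_nonneg_nonneg intro: order_trans[rotated] simp: inner_diff_left)
    finally show ?thesis
      using z by (simp add: field_simps)
  qed
  have "\<bar>rem_int m (Suc p) l - rem_int m (Suc p) l'\<bar>
      = \<bar>\<integral>z. exp_rem (Suc p) (l \<bullet> z) - exp_rem (Suc p) (l' \<bullet> z) \<partial>m\<bar>"
    unfolding rem_int_def by (subst Bochner_Integration.integral_diff[OF int]) simp
  also have "\<dots> \<le> (\<integral>z. \<bar>exp_rem (Suc p) (l \<bullet> z) - exp_rem (Suc p) (l' \<bullet> z)\<bar> \<partial>m)"
    by (rule integral_abs_bound)
  also have "\<dots> \<le> (\<integral>z. G z * norm (l - l') \<partial>m)"
    using int G ptw by (intro integral_mono) (auto simp del: exp_rem.simps)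
  finally show ?thesis by simp
qed

lemma integral_dominated_convergence_at_right_0:
  fixes s :: "real \<Rightarrow> 'a \<Rightarrow> 'b::{banach, second_countable_topology}" and w :: "'a \<Rightarrow> real"
  assumes "f \<in> borel_measurable M" "\<And>t. s t \<in> borel_measurable M" "integrable M w"
    and lim: "AE x in M. ((\<lambda>i. s i x) \<longlongrightarrow> f x) (at_right 0)"
    and bound: "\<forall>\<^sub>F i in at_right 0. AE x in M. norm (s i x) \<le> w x"
  shows "((\<lambda>t. integral\<^sup>L M (s t)) \<longlongrightarrow> integral\<^sup>L M f) (at_right 0)"
  unfolding filterlim_at_right_to_top
  using assms(1-3) lim[unfolded filterlim_at_right_to_top] bound[unfolded eventually_at_right_to_top]
  by (intro integral_dominated_convergence_at_top)

text \<open>Monotonicity of the remainder replaces the inner product with \<open>w h s\<close> by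
  \<open>D * norm z\<close>, giving a majorant \<open>g h\<close> free of \<open>s\<close>. One
  application of dominated convergence to \<open>g h\<close> then yields the limit uniformly in
  \<open>s\<close>.\<close>

lemma rem_int_uniform_limit:
  fixes w :: "real \<Rightarrow> real \<Rightarrow> real ^ 'd::finite"
  assumes m: "sets m = sets punctured_borel"
    and int: "integrable m (\<lambda>z. min (norm z ^ q) (norm z ^ Suc q))"
    and w: "\<forall>\<^sub>F h in at_right 0. \<forall>s\<in>S. w h s \<in> orthant \<and> norm (w h s) \<le> C"
  shows "uniform_limit S (\<lambda>h s. rem_int m (Suc q) (h *\<^sub>R w h s) / h ^ q) (\<lambda>_. 0) (at_right 0)"
proof -
  \<comment> \<open>With \<open>D \<ge> 1\<close> the single constant \<open>D ^ Suc q\<close>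
    serves both the bound of power \<open>q\<close> and that of power \<open>Suc q\<close>.\<close>
  define D where "D = max 1 C"
  have D: "D \<ge> 1" "D \<ge> C" by (auto simp: D_def)
  define g where "g h z = exp_rem (Suc q) (h * D * norm z) / h ^ q" for h and z :: "real ^ 'd"
  have gm: "g h \<in> borel_measurable m" for h
    unfolding g_def by (intro measurable_punctured[OF m] borel_measurable_divide exp_rem_measurable) auto
  have g_nn: "0 \<le> g h z" if "0 \<le> h" for h z
    using that D by (auto simp: g_def simp del: exp_rem.simps intro!: divide_nonneg_nonneg exp_rem_nonneg)
  have g_le: "g h z \<le> D ^ Suc q * norm z ^ q" "g h z \<le> h * (D ^ Suc q * norm z ^ Suc q)" if "0 < h" for h z
  proof -
    have x: "0 \<le> h * D * norm z" using that D by auto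
    have "g h z \<le> (h * D * norm z) ^ q / h ^ q"
      using exp_rem_Suc_le_power[OF x, of q] that unfolding g_def by (intro divide_right_mono) auto
    also have "\<dots> = D ^ q * norm z ^ q"
      using that by (simp add: power_mult_distrib)
    also have "\<dots> \<le> D ^ Suc q * norm z ^ q"
      using D by (intro mult_right_mono power_increasing) auto
    finally show "g h z \<le> D ^ Suc q * norm z ^ q" .
    have "g h z \<le> (h * D * norm z) ^ Suc q / h ^ q"
      using exp_rem_Suc_le_power[OF x, of q] that unfolding g_def by (intro divide_right_mono) auto
    also have "\<dots> = h * (D ^ Suc q * norm z ^ Suc q)"
      using that by (simp add: power_mult_distrib)
    finally show "g h z \<le> h * (D ^ Suc q * norm z ^ Suc q)" .
  qed
  have g_bd: "norm (g h z) \<le> D ^ Suc q * min (norm z ^ q) (norm z ^ Suc q)" if "0 < h" "h < 1" for h z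
  proof -
    have "h * (D ^ Suc q * norm z ^ Suc q) \<le> 1 * (D ^ Suc q * norm z ^ Suc q)"
      using that D by (intro mult_right_mono) auto
    then have "g h z \<le> D ^ Suc q * norm z ^ Suc q"
      using g_le(2)[OF that(1), of z] by simp
    then have "g h z \<le> min (D ^ Suc q * norm z ^ q) (D ^ Suc q * norm z ^ Suc q)"
      using g_le(1)[OF that(1), of z] by simp
    also have "\<dots> = D ^ Suc q * min (norm z ^ q) (norm z ^ Suc q)"
      using D by (simp only: min_mult_distrib_left) auto
    finally show ?thesis
      using g_nn[of h z] that by simp
  qed
  have pos: "\<forall>\<^sub>F h::real in at_right 0. 0 < h" and lt1: "\<forall>\<^sub>F h::real in at_right 0. h < 1"
    by (auto simp: eventually_at_right_field intro: exI[of _ 1])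
  have "((\<lambda>h. \<integral>z. g h z \<partial>m) \<longlongrightarrow> (\<integral>z. 0 \<partial>m)) (at_right 0)"
  proof (rule integral_dominated_convergence_at_right_0[where w = "\<lambda>z. D ^ Suc q * min (norm z ^ q) (norm z ^ Suc q)"])
    show "integrable m (\<lambda>z. D ^ Suc q * min (norm z ^ q) (norm z ^ Suc q))"
      using int by simp
    show "AE z in m. ((\<lambda>h. g h z) \<longlongrightarrow> 0) (at_right 0)"
    proof (rule AE_I2, rule tendsto_sandwich)
      fix z
      show "\<forall>\<^sub>F h in at_right 0. 0 \<le> g h z"
        using pos by eventually_elim (simp add: g_nn)
      show "\<forall>\<^sub>F h in at_right 0. g h z \<le> h * (D ^ Suc q * norm z ^ Suc q)"
        using pos by eventually_elim (rule g_le)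
      show "((\<lambda>h. h * (D ^ Suc q * norm z ^ Suc q)) \<longlongrightarrow> 0) (at_right 0)"
        by (rule tendsto_eq_intros refl)+ simp
    qed simp
    show "\<forall>\<^sub>F h in at_right 0. AE z in m. norm (g h z) \<le> D ^ Suc q * min (norm z ^ q) (norm z ^ Suc q)"
      using pos lt1 by eventually_elim (intro AE_I2 g_bd)
  qed (use gm in auto)
  then have lim: "((\<lambda>h. \<integral>z. g h z \<partial>m) \<longlongrightarrow> 0) (at_right 0)"
    by simp
  have bound: "\<forall>\<^sub>F h in at_right 0. \<forall>s\<in>S. \<bar>rem_int m (Suc q) (h *\<^sub>R w h s) / h ^ q\<bar> \<le> (\<integral>z. g h z \<partial>m)"
    using w pos lt1
  proof eventually_elim
    case (elim h)
    show ?case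
    proof
      fix s assume s: "s \<in> S"
      have le: "exp_rem (Suc q) ((h *\<^sub>R w h s) \<bullet> z) / h ^ q \<le> g h z" if "z \<in> space m" for z
        unfolding g_def
      proof (rule divide_right_mono[OF exp_rem_mono])
        have z: "z \<in> orthant" using that space_punctured[OF m] by auto
        show "0 \<le> (h *\<^sub>R w h s) \<bullet> z"
          using elim s by (intro orthant_inner_nonneg orthant_scaleR z) auto
        have "w h s \<bullet> z \<le> norm (w h s) * norm z"
          by (rule norm_cauchy_schwarz)
        also have "\<dots> \<le> D * norm z"
          using elim s D by (intro mult_right_mono) force+
        finally show "(h *\<^sub>R w h s) \<bullet> z \<le> h * D * norm z"
          using elim by (simp add: mult.assoc)
      qed (use elim in auto)
      have "integrable m (g h)"
      proof (rule Bochner_Integration.integrable_bound)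
        show "integrable m (\<lambda>z. D ^ Suc q * min (norm z ^ q) (norm z ^ Suc q))"
          using int by simp
        have "norm (g h z) \<le> norm (D ^ Suc q * min (norm z ^ q) (norm z ^ Suc q))" for z
          using g_bd[of h z] elim abs_ge_self order_trans unfolding real_norm_def by blast
        then show "AE z in m. norm (g h z) \<le> norm (D ^ Suc q * min (norm z ^ q) (norm z ^ Suc q))"
          by simp
      qed (rule gm)
      then have "(\<integral>z. exp_rem (Suc q) ((h *\<^sub>R w h s) \<bullet> z) / h ^ q \<partial>m) \<le> (\<integral>z. g h z \<partial>m)"
        using le g_nn elim by (intro integral_mono') auto
      moreover have "0 \<le> rem_int m (Suc q) (h *\<^sub>R w h s)"
        using elim s by (intro rem_int_nonneg[OF m] orthant_scaleR) auto
      ultimately show "\<bar>rem_int m (Suc q) (h *\<^sub>R w h s) / h ^ q\<bar> \<le> (\<integral>z. g h z \<partial>m)"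
        using elim by (simp add: rem_int_def del: exp_rem.simps)
    qed
  qed
  show ?thesis
    unfolding uniform_limit_iff
  proof (intro allI impI)
    fix e :: real assume "e > 0"
    then have "\<forall>\<^sub>F h in at_right 0. (\<integral>z. g h z \<partial>m) < e"
      using order_tendstoD(2)[OF lim] by blast
    then show "\<forall>\<^sub>F h in at_right 0. \<forall>s\<in>S. dist (rem_int m (Suc q) (h *\<^sub>R w h s) / h ^ q) 0 < e"
      using bound by eventually_elim (force simp: dist_norm)
  qed
qed

lemma integrable_inner_power:
  assumes m: "sets m = sets punctured_borel"
    and g: "g \<in> borel_measurable borel" "\<And>z. \<bar>g z\<bar> \<le> norm z ^ l"
    and int: "integrable m (\<lambda>z. norm z ^ (j + l))"
  shows "integrable m (\<lambda>z. (w \<bullet> z) ^ j * g z)"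
proof (rule Bochner_Integration.integrable_bound)
  show "integrable m (\<lambda>z. norm w ^ j * norm z ^ (j + l))"
    using int by simp
  show "(\<lambda>z. (w \<bullet> z) ^ j * g z) \<in> borel_measurable m"
    using g by (intro measurable_punctured[OF m]) simp
  have "\<bar>w \<bullet> z\<bar> ^ j * \<bar>g z\<bar> \<le> (norm w * norm z) ^ j * norm z ^ l" for z
    using g(2) Cauchy_Schwarz_ineq2[of w z] by (intro mult_mono power_mono) auto
  then show "AE z in m. norm ((w \<bullet> z) ^ j * g z) \<le> norm (norm w ^ j * norm z ^ (j + l))"
    by (simp add: abs_mult power_abs power_mult_distrib power_add mult_ac)
qed

text \<open>Writing one factor \<open>w h s \<bullet> z\<close> in coordinates moves a coordinate of
  \<open>z\<close> into \<open>g\<close> and a component of \<open>w\<close> out of the integral.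
  The exponent \<open>l\<close> counts the coordinates already moved, so the moment order
  \<open>j + l\<close> is unchanged; in the end only mixed moments of \<open>m\<close> and
  polynomials in \<open>w\<close> remain.\<close>

lemma uexp_moment:
  fixes w :: "real \<Rightarrow> real \<Rightarrow> real ^ 'd::finite"
  assumes m: "sets m = sets punctured_borel" and S: "compact S"
    and w: "\<And>i. uexp S n (\<lambda>h s. w h s $ i)"
  shows "g \<in> borel_measurable borel \<Longrightarrow> (\<And>z. \<bar>g z\<bar> \<le> norm z ^ l) \<Longrightarrow>
    integrable m (\<lambda>z. norm z ^ (j + l)) \<Longrightarrow>
    uexp S n (\<lambda>h s. \<integral>z. (w h s \<bullet> z) ^ j * g z \<partial>m)"
proof (induction j arbitrary: g l)
  case 0
  then show ?case by (simp add: uexp_const)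
next
  case (Suc j)
  have g': "(\<lambda>z. z $ i * g z) \<in> borel_measurable borel" "\<bar>z $ i * g z\<bar> \<le> norm z ^ Suc l" for i z
    using Suc.prems component_le_norm_cart[of z i] by (auto simp: abs_mult intro!: mult_mono)
  have int: "integrable m (\<lambda>z. norm z ^ (j + Suc l))"
    using Suc.prems(3) by simp
  have "uexp S n (\<lambda>h s. \<Sum>i\<in>UNIV. w h s $ i * (\<integral>z. (w h s \<bullet> z) ^ j * (z $ i * g z) \<partial>m))"
    by (intro uexp_sum uexp_mult S w Suc.IH[OF g' int])
  moreover have "(\<Sum>i\<in>UNIV. w h s $ i * (\<integral>z. (w h s \<bullet> z) ^ j * (z $ i * g z) \<partial>m))
      = (\<integral>z. (w h s \<bullet> z) ^ Suc j * g z \<partial>m)" for h s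
  proof -
    have "(\<Sum>i\<in>UNIV. w h s $ i * (\<integral>z. (w h s \<bullet> z) ^ j * (z $ i * g z) \<partial>m))
      = (\<integral>z. (\<Sum>i\<in>UNIV. w h s $ i * ((w h s \<bullet> z) ^ j * (z $ i * g z))) \<partial>m)"
      using integrable_inner_power[OF m g' int]
      by (subst Bochner_Integration.integral_sum) auto
    also have "(\<lambda>z. \<Sum>i\<in>UNIV. w h s $ i * ((w h s \<bullet> z) ^ j * (z $ i * g z)))
      = (\<lambda>z. (w h s \<bullet> z) ^ Suc j * g z)"
      by (rule ext) (simp add: inner_vec_def sum_distrib_left sum_distrib_right mult_ac)
    finally show ?thesis .
  qed
  ultimately show ?case by simp
qed

lemma rem_int_expand:
  assumes m: "sets m = sets punctured_borel" and l: "l \<in> orthant"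
    and int: "\<And>j. j < r \<Longrightarrow> integrable m (\<lambda>z. norm z ^ (p + j))"
    and rem: "integrable m (\<lambda>z. exp_rem (p + r) (l \<bullet> z))"
  shows "rem_int m p l = (\<Sum>j<r. (-1) ^ j / fact (p + j) * (\<integral>z. (l \<bullet> z) ^ (p + j) \<partial>m))
    + (-1) ^ r * rem_int m (p + r) l"
proof -
  have "integrable m (\<lambda>z. (l \<bullet> z) ^ (p + j))" if "j < r" for j
    using integrable_inner_power[OF m, of "\<lambda>_. 1" 0 "p + j" l] int[OF that] by simp
  then have *: "integrable m (\<lambda>z. (-1) ^ j * (l \<bullet> z) ^ (p + j) / fact (p + j))" if "j < r" for j
    using that by simp
  have "rem_int m p l = (\<integral>z. (\<Sum>j<r. (-1) ^ j * (l \<bullet> z) ^ (p + j) / fact (p + j)) + (-1) ^ r * exp_rem (p + r) (l \<bullet> z) \<partial>m)"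
    unfolding rem_int_def by (subst exp_rem_expand[where r = r]) simp
  also have "\<dots> = (\<Sum>j<r. \<integral>z. (-1) ^ j * (l \<bullet> z) ^ (p + j) / fact (p + j) \<partial>m) + (-1) ^ r * rem_int m (p + r) l"
    unfolding rem_int_def using * rem
    by (subst Bochner_Integration.integral_add) auto
  finally show ?thesis by simp
qed

subsection \<open>The flow\<close>

text \<open>The linear part of minus the branching mechanism at the origin: the transpose of
  \<open>B\<close>, corrected because the truncated compensator \<open>min 1 (z $ i)\<close> is
  exchanged for the full linear term.\<close>

definition drift :: "real ^ 'd::finite ^ 'd \<Rightarrow> ('d \<Rightarrow> (real ^ 'd) measure) \<Rightarrow> real ^ 'd ^ 'd" where
  "drift B \<mu> = (\<chi> i k. B $ k $ i + (\<integral>z. (z $ k - (if k = i then min 1 (z $ i) else 0)) \<partial>\<mu> i))"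

definition nonlin :: "real ^ 'd::finite \<Rightarrow> ('d \<Rightarrow> (real ^ 'd) measure) \<Rightarrow> real ^ 'd \<Rightarrow> real ^ 'd" where
  "nonlin c \<mu> l = (\<chi> i. c $ i * (l $ i)\<^sup>2 + rem_int (\<mu> i) 2 l)"

lemma admissible_sets:
  assumes "admissible c \<beta> B \<nu> \<mu>"
  shows "sets \<nu> = sets punctured_borel" "sets (\<mu> i) = sets punctured_borel"
  using assms by (auto simp: admissible_def)

lemma admissible_integrable:
  assumes adm: "admissible c \<beta> B \<nu> \<mu>"
  shows "integrable (\<mu> i) (\<lambda>z. min (norm z) ((norm z)\<^sup>2))"
    and "j \<noteq> i \<Longrightarrow> integrable (\<mu> i) (\<lambda>z. z $ j)"
proof -
  note m = admissible_sets(2)[OF adm, of i]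
  have int: "integrable (\<mu> i) (\<lambda>z. min (norm z) ((norm z)\<^sup>2) + (\<Sum>j\<in>UNIV - {i}. z $ j))"
    using adm by (simp add: admissible_def)
  have nn: "0 \<le> (\<Sum>j\<in>UNIV - {i}. z $ j)" "0 \<le> z $ j" if "z \<in> space (\<mu> i)" for z j
    using that space_punctured[OF m] by (auto simp: orthant_def intro!: sum_nonneg)
  show "integrable (\<mu> i) (\<lambda>z. min (norm z) ((norm z)\<^sup>2))"
    using nn(1) by (intro Bochner_Integration.integrable_bound[OF int] AE_I2 measurable_punctured[OF m]) auto
  show "integrable (\<mu> i) (\<lambda>z. z $ j)" if "j \<noteq> i"
  proof (intro Bochner_Integration.integrable_bound[OF int] AE_I2 measurable_punctured[OF m])
    fix z assume z: "z \<in> space (\<mu> i)"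
    have "z $ j \<le> (\<Sum>j\<in>UNIV - {i}. z $ j)"
      using that nn(2)[OF z] by (intro member_le_sum) auto
    then show "norm (z $ j) \<le> norm (min (norm z) ((norm z)\<^sup>2) + (\<Sum>j\<in>UNIV - {i}. z $ j))"
      using nn[OF z] by (simp add: add_increasing)
  qed simp
qed

lemma exp_rem_1_mult_le:
  assumes "0 \<le> x" "x \<le> R * norm z"
  shows "exp_rem 1 x * norm z \<le> max 1 R * min (norm z) ((norm z)\<^sup>2)"
proof -
  have e: "exp_rem 1 x \<le> 1" "exp_rem 1 x \<le> x"
    using exp_rem_Suc_le_power[OF assms(1), of 0] by auto
  have "exp_rem 1 x * norm z \<le> 1 * norm z"
    using e by (intro mult_right_mono) auto
  also have "\<dots> \<le> max 1 R * norm z"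
    by (intro mult_right_mono) auto
  finally have 1: "exp_rem 1 x * norm z \<le> max 1 R * norm z" .
  have "exp_rem 1 x * norm z \<le> (R * norm z) * norm z"
    using e assms by (intro mult_right_mono) auto
  also have "\<dots> \<le> max 1 R * (norm z)\<^sup>2"
    by (simp add: power2_eq_square mult.assoc[symmetric] mult_right_mono)
  finally have "exp_rem 1 x * norm z \<le> max 1 R * (norm z)\<^sup>2" .
  with 1 show ?thesis
    by (simp only: min_mult_distrib_left) auto
qed

lemma integrable_exp_rem_2:
  assumes adm: "admissible c \<beta> B \<nu> \<mu>" and l: "l \<in> orthant"
  shows "integrable (\<mu> i) (\<lambda>z. exp_rem 2 (l \<bullet> z))"
proof -
  have "integrable (\<mu> i) (\<lambda>z. exp_rem (Suc 1) (l \<bullet> z))"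
    using admissible_integrable(1)[OF adm]
    by (intro integrable_exp_rem[OF admissible_sets(2)[OF adm] _ l, where G = "\<lambda>z. max 1 (norm l) * min (norm z) ((norm z)\<^sup>2)"]
        exp_rem_1_mult_le) auto
  then show ?thesis by (simp add: numeral_2_eq_2)
qed

text \<open>\<open>exp_rem 2 x\<close> is exp (- x) - 1 + x, compensated by the whole of x instead
  of a truncated coordinate. The difference is linear in \<open>l\<close>, with finite coefficients:
  \<open>z $ i - min 1 (z $ i)\<close> vanishes when \<open>z $ i \<le> 1\<close> and is otherwise
  below \<open>norm z\<close>, and the other coordinates are integrable by admissibility.\<close>

lemma branching_mechanism_decomp:
  assumes adm: "admissible c \<beta> B \<nu> \<mu>" and l: "l \<in> orthant"
  shows "branching_mechanism c B \<mu> l = nonlin c \<mu> l - drift B \<mu> *v l"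
proof -
  have "branching_mechanism c B \<mu> l $ i = (nonlin c \<mu> l - drift B \<mu> *v l) $ i" for i
  proof -
    note m = admissible_sets(2)[OF adm, of i]
    define \<zeta> where "\<zeta> k z = z $ k - (if k = i then min 1 (z $ i) else 0)" for k and z :: "real ^ 'a"
    have \<zeta>: "integrable (\<mu> i) (\<zeta> k)" for k
    proof (cases "k = i")
      case True
      show ?thesis
      proof (intro Bochner_Integration.integrable_bound[OF admissible_integrable(1)[OF adm]] AE_I2)
        fix z
        have "z $ i \<le> norm z"
          using component_le_norm_cart[of z i] by auto
        moreover have "norm z \<le> (norm z)\<^sup>2" if "1 \<le> norm z"
          using that by (simp add: self_le_power)
        ultimately show "norm (\<zeta> k z) \<le> norm (min (norm z) ((norm z)\<^sup>2))"
          by (auto simp: \<zeta>_def True min_def)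
      next
        show "\<zeta> k \<in> borel_measurable (\<mu> i)"
          unfolding \<zeta>_def True by (intro measurable_punctured[OF m]) simp
      qed
    next
      case False
      then show ?thesis
        using admissible_integrable(2)[OF adm] by (simp add: \<zeta>_def[abs_def])
    qed
    have "exp (- (l \<bullet> z)) - 1 + l $ i * min 1 (z $ i) = exp_rem 2 (l \<bullet> z) - (\<Sum>k\<in>UNIV. l $ k * \<zeta> k z)" for z
    proof -
      have "(\<Sum>k\<in>UNIV. l $ k * \<zeta> k z) = l \<bullet> z - (\<Sum>k\<in>UNIV. if k = i then l $ i * min 1 (z $ i) else 0)"
        unfolding \<zeta>_def inner_vec_def sum_subtractf[symmetric]
        by (intro sum.cong) (auto simp: algebra_simps)
      then show ?thesis
        by (simp add: numeral_2_eq_2)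
    qed
    then have "(\<integral>z. (exp (- (l \<bullet> z)) - 1 + l $ i * min 1 (z $ i)) \<partial>\<mu> i)
        = rem_int (\<mu> i) 2 l - (\<Sum>k\<in>UNIV. l $ k * (\<integral>z. \<zeta> k z \<partial>\<mu> i))"
      unfolding rem_int_def using integrable_exp_rem_2[OF adm l, of i] \<zeta>
      by (simp add: Bochner_Integration.integral_sum)
    then show ?thesis
      by (simp add: branching_mechanism_def nonlin_def drift_def matrix_vector_mult_def \<zeta>_def
          inner_vec_def axis_def sum.distrib distrib_right if_distrib cong: if_cong)
        (simp add: mult.commute)
  qed
  then show ?thesis by (simp add: vec_eq_iff)
qed

lemma nonlin_nonneg:
  assumes adm: "admissible c \<beta> B \<nu> \<mu>" and l: "l \<in> orthant"
  shows "0 \<le> nonlin c \<mu> l $ i"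
  using adm rem_int_nonneg[OF admissible_sets(2)[OF adm] l]
  by (auto simp: nonlin_def admissible_def orthant_def)

lemma branching_mechanism_lipschitz:
  assumes adm: "admissible c \<beta> B \<nu> \<mu>"
  shows "\<exists>L. \<forall>l\<in>orthant. \<forall>l'\<in>orthant. norm l \<le> R \<longrightarrow> norm l' \<le> R \<longrightarrow>
    norm (branching_mechanism c B \<mu> l - branching_mechanism c B \<mu> l') \<le> L * norm (l - l')"
proof -
  define G where "G z = max 1 R * min (norm z) ((norm z)\<^sup>2)" for z :: "real ^ 'a"
  have G: "integrable (\<mu> i) G" for i
    unfolding G_def using admissible_integrable(1)[OF adm] by auto
  define K where "K i = 2 * R * c $ i + (\<integral>z. G z \<partial>\<mu> i) + (\<Sum>k\<in>UNIV. \<bar>drift B \<mu> $ i $ k\<bar>)" for i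
  show ?thesis
  proof (intro exI[of _ "\<Sum>i\<in>UNIV. K i"] ballI impI)
    fix l l' :: "real ^ 'a" assume l: "l \<in> orthant" "norm l \<le> R" and l': "l' \<in> orthant" "norm l' \<le> R"
    have "\<bar>(branching_mechanism c B \<mu> l - branching_mechanism c B \<mu> l') $ i\<bar> \<le> K i * norm (l - l')" for i
    proof -
      have "\<bar>rem_int (\<mu> i) (Suc 1) l - rem_int (\<mu> i) (Suc 1) l'\<bar> \<le> (\<integral>z. G z \<partial>\<mu> i) * norm (l - l')"
        using l l' unfolding G_def
        by (intro rem_int_lipschitz[OF admissible_sets(2)[OF adm] G[unfolded G_def], of R] exp_rem_1_mult_le) auto
      then have 1: "\<bar>rem_int (\<mu> i) 2 l - rem_int (\<mu> i) 2 l'\<bar> \<le> (\<integral>z. G z \<partial>\<mu> i) * norm (l - l')"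
        by (simp add: numeral_2_eq_2)
      have "\<bar>(l $ i)\<^sup>2 - (l' $ i)\<^sup>2\<bar> = \<bar>l $ i + l' $ i\<bar> * \<bar>(l - l') $ i\<bar>"
        by (simp add: abs_mult[symmetric] power2_eq_square algebra_simps)
      also have "\<dots> \<le> (2 * R) * norm (l - l')"
        using component_le_norm_cart[of l i] component_le_norm_cart[of l' i] l l' component_le_norm_cart[of "l - l'" i]
        by (intro mult_mono) (auto intro: order_trans[OF norm_ge_zero])
      finally have 2: "\<bar>c $ i * ((l $ i)\<^sup>2 - (l' $ i)\<^sup>2)\<bar> \<le> c $ i * ((2 * R) * norm (l - l'))"
        using adm by (auto simp: abs_mult admissible_def orthant_def intro!: mult_left_mono)
      have "\<bar>(drift B \<mu> *v (l - l')) $ i\<bar> \<le> (\<Sum>k\<in>UNIV. \<bar>drift B \<mu> $ i $ k\<bar> * \<bar>(l - l') $ k\<bar>)"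
        unfolding matrix_vector_mult_def by (simp add: sum_abs[THEN order_trans] abs_mult)
      also have "\<dots> \<le> (\<Sum>k\<in>UNIV. \<bar>drift B \<mu> $ i $ k\<bar> * norm (l - l'))"
        by (intro sum_mono mult_left_mono component_le_norm_cart) auto
      finally have 3: "\<bar>(drift B \<mu> *v (l - l')) $ i\<bar> \<le> (\<Sum>k\<in>UNIV. \<bar>drift B \<mu> $ i $ k\<bar>) * norm (l - l')"
        by (simp add: sum_distrib_right)
      have "(branching_mechanism c B \<mu> l - branching_mechanism c B \<mu> l') $ i
        = c $ i * ((l $ i)\<^sup>2 - (l' $ i)\<^sup>2) + (rem_int (\<mu> i) 2 l - rem_int (\<mu> i) 2 l') - (drift B \<mu> *v (l - l')) $ i"
        using l l' by (simp add: branching_mechanism_decomp[OF adm] nonlin_def matrix_vector_mult_diff_distrib algebra_simps)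
      then show ?thesis
        using 1 2 3 by (simp add: K_def algebra_simps)
    qed
    then have "(\<Sum>i\<in>UNIV. \<bar>(branching_mechanism c B \<mu> l - branching_mechanism c B \<mu> l') $ i\<bar>) \<le> (\<Sum>i\<in>UNIV. K i * norm (l - l'))"
      by (intro sum_mono)
    then show "norm (branching_mechanism c B \<mu> l - branching_mechanism c B \<mu> l') \<le> (\<Sum>i\<in>UNIV. K i) * norm (l - l')"
      using norm_le_l1_cart order_trans unfolding sum_distrib_right by blast
  qed
qed

section \<open>A priori bound, Duhamel's formula and uniqueness for the flow\<close>

lemma gronwall_le:
  fixes f :: "real \<Rightarrow> real"
  assumes deriv: "\<And>t. t \<in> {0..T} \<Longrightarrow> (f has_real_derivative f' t) (at t within {0..T})"
    and le: "\<And>t. t \<in> {0..T} \<Longrightarrow> f' t \<le> K * f t" and t: "t \<in> {0..T}"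
  shows "f t \<le> exp (K * t) * f 0"
proof (cases "t = 0")
  case False
  define g where "g s = exp (- K * s) * f s" for s
  have g: "(g has_real_derivative exp (- K * s) * (f' s - K * f s)) (at s within {0..t})" if "s \<in> {0..t}" for s
  proof -
    have "(f has_real_derivative f' s) (at s within {0..t})"
      using deriv[of s] that t by (auto intro: DERIV_subset)
    then show ?thesis
      unfolding g_def by (auto intro!: derivative_eq_intros simp: algebra_simps)
  qed
  have "\<exists>x\<in>{0<..<t}. g t - g 0 = exp (- K * x) * (f' x - K * f x) * (t - 0)"
    using False t g unfolding has_field_derivative_def
    by (intro mvt_simple) auto
  then obtain x where "x \<in> {0<..<t}" "g t - g 0 = exp (- K * x) * (f' x - K * f x) * t"
    by auto
  moreover have "f' x - K * f x \<le> 0"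
    using le[of x] \<open>x \<in> {0<..<t}\<close> t by auto
  then have "exp (- K * x) * (f' x - K * f x) * t \<le> 0"
    using t by (intro mult_nonpos_nonneg mult_nonneg_nonpos) auto
  ultimately have "g t \<le> g 0"
    by simp
  then show ?thesis
    by (simp add: g_def exp_minus field_simps)
qed simp

context
  fixes c \<beta> :: "real ^ 'd::finite" and B \<nu> \<mu> v
  assumes adm: "admissible c \<beta> B \<nu> \<mu>" and flow: "cbi_flow c B \<mu> v"
begin

lemma flow_orthant: "l \<in> orthant \<Longrightarrow> 0 \<le> t \<Longrightarrow> v t l \<in> orthant"
  and flow_0: "l \<in> orthant \<Longrightarrow> v 0 l = l"
  using flow by (auto simp: cbi_flow_def)

lemma flow_deriv:
  assumes "l \<in> orthant" "0 \<le> t" "S \<subseteq> {0..}"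
  shows "((\<lambda>s. v s l $ i) has_real_derivative - branching_mechanism c B \<mu> (v t l) $ i) (at t within S)"
proof -
  have "((\<lambda>s. v s l) has_vector_derivative - branching_mechanism c B \<mu> (v t l)) (at t within S)"
    using flow assms by (auto simp: cbi_flow_def intro: has_vector_derivative_within_subset)
  from bounded_linear.has_vector_derivative[OF bounded_linear_vec_nth[of i] this]
  show ?thesis
    by (simp add: has_real_derivative_iff_has_vector_derivative)
qed

lemma flow_deriv':
  assumes "l \<in> orthant" "0 \<le> t" "S \<subseteq> {0..}"
  shows "((\<lambda>s. v s l $ i) has_real_derivative (drift B \<mu> *v v t l) $ i - nonlin c \<mu> (v t l) $ i) (at t within S)"
  using flow_deriv[OF assms, of i] flow_orthant[OF assms(1,2)]
  by (simp add: branching_mechanism_decomp[OF adm])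

lemma flow_continuous:
  assumes "l \<in> orthant" "S \<subseteq> {0..}"
  shows "continuous_on S (\<lambda>s. v s l $ i)"
  using assms flow_deriv[OF assms(1) _ assms(2)]
  by (intro DERIV_continuous_on) auto

lemma nonlin_flow_continuous:
  assumes "l \<in> orthant"
  shows "continuous_on {0..} (\<lambda>s. nonlin c \<mu> (v s l) $ i)"
proof -
  have "continuous_on {0..} (\<lambda>s. branching_mechanism c B \<mu> (v s l) $ i + (drift B \<mu> *v v s l) $ i)"
    unfolding matrix_vector_mult_def vec_lambda_beta
    using flow assms unfolding cbi_flow_def
    by (intro continuous_on_add continuous_on_sum continuous_on_mult continuous_on_const
        flow_continuous continuous_on_component) auto
  then show ?thesis
    by (rule continuous_on_eq) (simp add: branching_mechanism_decomp[OF adm flow_orthant[OF assms]])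
qed

text \<open>The sum of the components acts as a Lyapunov function: on the orthant the nonlinear part
  only decreases it, so the linear Gronwall inequality applies. The bound is proportional to
  \<open>norm l\<close>, which is what survives the later division by \<open>h\<close>.\<close>

lemma flow_bound:
  assumes "0 \<le> T"
  obtains C where "\<And>l t. l \<in> orthant \<Longrightarrow> t \<in> {0..T} \<Longrightarrow> norm (v t l) \<le> C * norm l"
proof -
  define K where "K = (\<Sum>i\<in>UNIV. \<Sum>k\<in>UNIV. \<bar>drift B \<mu> $ i $ k\<bar>)"
  have K: "K \<ge> 0" by (auto simp: K_def intro!: sum_nonneg)
  have "norm (v t l) \<le> exp (K * T) * CARD('d) * norm l" if l: "l \<in> orthant" and t: "t \<in> {0..T}" for l t
  proof -
    define f where "f t = (\<Sum>i\<in>UNIV. v t l $ i)" for t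
    have nn: "0 \<le> v s l $ i" if "0 \<le> s" for s i
      using flow_orthant[OF l that] by (simp add: orthant_def)
    have "f t \<le> exp (K * t) * f 0"
    proof (rule gronwall_le[OF _ _ t])
      show "(f has_real_derivative (\<Sum>i\<in>UNIV. (drift B \<mu> *v v t l) $ i - nonlin c \<mu> (v t l) $ i)) (at t within {0..T})"
        if "t \<in> {0..T}" for t
        unfolding f_def using that l by (intro DERIV_sum flow_deriv') auto
      show "(\<Sum>i\<in>UNIV. (drift B \<mu> *v v t l) $ i - nonlin c \<mu> (v t l) $ i) \<le> K * f t" if "t \<in> {0..T}" for t
      proof -
        have "(\<Sum>i\<in>UNIV. (drift B \<mu> *v v t l) $ i - nonlin c \<mu> (v t l) $ i) \<le> (\<Sum>i\<in>UNIV. (drift B \<mu> *v v t l) $ i)"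
          using that by (intro sum_mono) (auto intro!: nonlin_nonneg[OF adm] flow_orthant[OF l])
        also have "\<dots> = (\<Sum>i\<in>UNIV. \<Sum>k\<in>UNIV. drift B \<mu> $ i $ k * v t l $ k)"
          by (simp add: matrix_vector_mult_def)
        also have "\<dots> \<le> (\<Sum>i\<in>UNIV. \<Sum>k\<in>UNIV. \<bar>drift B \<mu> $ i $ k\<bar> * f t)"
          unfolding f_def using that nn
          by (intro sum_mono mult_mono member_le_sum) auto
        also have "\<dots> = K * f t"
          by (simp add: K_def sum_distrib_right)
        finally show ?thesis .
      qed
    qed
    also have "\<dots> \<le> exp (K * T) * (CARD('d) * norm l)"
    proof (rule mult_mono)
      have "l $ i \<le> norm l" for i
        using component_le_norm_cart[of l i] by simp
      then have "f 0 \<le> (\<Sum>i\<in>(UNIV::'d set). norm l)"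
        unfolding f_def flow_0[OF l] by (intro sum_mono)
      then show "f 0 \<le> CARD('d) * norm l"
        by simp
      show "0 \<le> f 0"
        using nn by (auto simp: f_def intro!: sum_nonneg)
    qed (use t K in \<open>auto intro!: mult_left_mono\<close>)
    finally have "f t \<le> exp (K * T) * CARD('d) * norm l"
      by simp
    moreover have "norm (v t l) \<le> f t"
      using norm_le_l1_cart[of "v t l"] nn t by (simp add: f_def)
    ultimately show ?thesis by simp
  qed
  then show ?thesis using that by blast
qed

text \<open>Multiplying the flow by \<open>Q s\<close> cancels the drift, so only the nonlinear part
  is left to integrate; \<open>P t\<close> undoes the multiplication.\<close>

lemma flow_duhamel:
  assumes PQ: "\<And>t. P t ** Q t = mat 1" "Q 0 = mat 1"
    and Q: "\<And>t i j. ((\<lambda>t. Q t $ i $ j) has_real_derivative - (Q t ** drift B \<mu>) $ i $ j) (at t)"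
    and l: "l \<in> orthant" and t: "0 \<le> t"
  shows "v t l $ i = (\<Sum>j\<in>UNIV. P t $ i $ j *
    (l $ j - integral {0..t} (\<lambda>s. \<Sum>k\<in>UNIV. Q s $ j $ k * nonlin c \<mu> (v s l) $ k)))"
proof -
  define y where "y s = Q s *v v s l" for s
  have y: "((\<lambda>s. y s $ j) has_real_derivative - (\<Sum>k\<in>UNIV. Q s $ j $ k * nonlin c \<mu> (v s l) $ k)) (at s within {0..t})"
    if "s \<in> {0..t}" for s j
  proof -
    have "((\<lambda>s. \<Sum>k\<in>UNIV. Q s $ j $ k * v s l $ k) has_real_derivative
      (\<Sum>k\<in>UNIV. - (Q s ** drift B \<mu>) $ j $ k * v s l $ k
        + ((drift B \<mu> *v v s l) $ k - nonlin c \<mu> (v s l) $ k) * Q s $ j $ k)) (at s within {0..t})"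
      using that by (intro DERIV_sum DERIV_mult flow_deriv' l has_field_derivative_at_within[OF Q]) auto
    also have "(\<Sum>k\<in>UNIV. - (Q s ** drift B \<mu>) $ j $ k * v s l $ k
        + ((drift B \<mu> *v v s l) $ k - nonlin c \<mu> (v s l) $ k) * Q s $ j $ k)
      = - ((Q s ** drift B \<mu>) *v v s l) $ j + (Q s *v (drift B \<mu> *v v s l)) $ j
        - (\<Sum>k\<in>UNIV. Q s $ j $ k * nonlin c \<mu> (v s l) $ k)"
      by (simp add: matrix_vector_mult_def[of "Q s ** drift B \<mu>"] matrix_vector_mult_def[of "Q s" "drift B \<mu> *v _"]
          sum.distrib sum_negf sum_subtractf algebra_simps)
    finally show ?thesis
      by (simp add: matrix_vector_mul_assoc) (simp add: y_def matrix_vector_mult_def)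
  qed
  have "y t $ j = l $ j - integral {0..t} (\<lambda>s. \<Sum>k\<in>UNIV. Q s $ j $ k * nonlin c \<mu> (v s l) $ k)" for j
  proof -
    have "((\<lambda>s. - (\<Sum>k\<in>UNIV. Q s $ j $ k * nonlin c \<mu> (v s l) $ k)) has_integral (y t $ j - y 0 $ j)) {0..t}"
      using t y by (intro fundamental_theorem_of_calculus)
        (auto simp: has_real_derivative_iff_has_vector_derivative[symmetric])
    from has_integral_neg[OF this] have "integral {0..t} (\<lambda>s. \<Sum>k\<in>UNIV. Q s $ j $ k * nonlin c \<mu> (v s l) $ k) = y 0 $ j - y t $ j"
      by (simp add: integral_unique)
    then show ?thesis
      by (simp add: y_def PQ flow_0[OF l])
  qed
  moreover have "P t *v y t = v t l"
    by (simp add: y_def matrix_vector_mul_assoc PQ)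
  then have "v t l $ i = (\<Sum>j\<in>UNIV. P t $ i $ j * y t $ j)"
    by (simp add: matrix_vector_mult_def flip: \<open>P t *v y t = v t l\<close>)
  ultimately show ?thesis by simp
qed

end

text \<open>Each semigroup comes with some flow of its own. Uniqueness identifies these flows, so
  the cumulants depend on the parameters only and the polynomials can be chosen before the process.
  Both flows stay in a common ball, where the mechanism is Lipschitz.\<close>

lemma cbi_flow_unique:
  assumes adm: "admissible c \<beta> B \<nu> \<mu>" and flow: "cbi_flow c B \<mu> v" "cbi_flow c B \<mu> v'"
    and l: "l \<in> orthant" and t: "0 \<le> t"
  shows "v' t l = v t l"
proof -
  obtain C where C: "\<And>s. s \<in> {0..t} \<Longrightarrow> norm (v s l) \<le> C * norm l"
    using flow_bound[OF adm flow(1) t] l by metis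
  obtain C' where C': "\<And>s. s \<in> {0..t} \<Longrightarrow> norm (v' s l) \<le> C' * norm l"
    using flow_bound[OF adm flow(2) t] l by metis
  define R where "R = max (C' * norm l) (C * norm l)"
  obtain L where L: "\<And>a b. a \<in> orthant \<Longrightarrow> b \<in> orthant \<Longrightarrow> norm a \<le> R \<Longrightarrow> norm b \<le> R \<Longrightarrow>
      norm (branching_mechanism c B \<mu> a - branching_mechanism c B \<mu> b) \<le> L * norm (a - b)"
    using branching_mechanism_lipschitz[OF adm, of R] by blast
  define \<phi> where "\<phi> = branching_mechanism c B \<mu>"
  define f where "f s = (\<Sum>i\<in>UNIV. (v s l $ i - v' s l $ i)\<^sup>2)" for s
  have f_norm: "f s = (norm (v s l - v' s l))\<^sup>2" for s
    by (simp add: f_def norm_vec_def L2_set_def sum_nonneg)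
  have "f t \<le> exp (2 * L * t) * f 0"
  proof (rule gronwall_le)
    show "(f has_real_derivative (\<Sum>i\<in>UNIV. 2 * (v s l $ i - v' s l $ i) * (\<phi> (v' s l) $ i - \<phi> (v s l) $ i))) (at s within {0..t})"
      if s: "s \<in> {0..t}" for s
    proof -
      have "((\<lambda>s. (v s l $ i - v' s l $ i)\<^sup>2) has_real_derivative
          2 * (v s l $ i - v' s l $ i) * (\<phi> (v' s l) $ i - \<phi> (v s l) $ i)) (at s within {0..t})" for i
        using s by (auto intro!: derivative_eq_intros flow_deriv[OF adm flow(1) l] flow_deriv[OF adm flow(2) l] simp: \<phi>_def)
      then show ?thesis
        unfolding f_def by (intro DERIV_sum)
    qed
    show "(\<Sum>i\<in>UNIV. 2 * (v s l $ i - v' s l $ i) * (\<phi> (v' s l) $ i - \<phi> (v s l) $ i)) \<le> 2 * L * f s"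
      if s: "s \<in> {0..t}" for s
    proof -
      have "(\<Sum>i\<in>UNIV. 2 * (v s l $ i - v' s l $ i) * (\<phi> (v' s l) $ i - \<phi> (v s l) $ i))
        = 2 * ((v s l - v' s l) \<bullet> (\<phi> (v' s l) - \<phi> (v s l)))"
        by (simp only: inner_vec_def sum_distrib_left mult.assoc) simp
      also have "\<dots> \<le> 2 * (norm (v s l - v' s l) * norm (\<phi> (v' s l) - \<phi> (v s l)))"
        by (simp add: norm_cauchy_schwarz)
      also have "\<dots> \<le> 2 * (norm (v s l - v' s l) * (L * norm (v' s l - v s l)))"
        using s l unfolding \<phi>_def
        by (intro mult_left_mono L flow_orthant[OF adm flow(1)] flow_orthant[OF adm flow(2)])
          (auto simp: R_def intro: order_trans[OF C'] order_trans[OF C])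
      also have "\<dots> = 2 * L * f s"
        by (simp add: f_norm power2_eq_square norm_minus_commute)
      finally show ?thesis .
    qed
  qed (use t in auto)
  moreover have "f 0 = 0"
    using l by (simp add: f_def flow_0[OF adm flow(1)] flow_0[OF adm flow(2)])
  ultimately show ?thesis
    by (simp add: f_norm)
qed

subsection \<open>Expansion of the flow in the initial value\<close>

lemma integrable_power_from_tail:
  assumes m: "sets m = sets punctured_borel" and int: "integrable m f"
    and tail: "set_integrable m {z. 1 \<le> norm z} (\<lambda>z. norm z ^ q)"
    and g: "g \<in> borel_measurable borel"
    and small: "\<And>z. norm z < 1 \<Longrightarrow> \<bar>g z\<bar> \<le> f z" and large: "\<And>z. 1 \<le> norm z \<Longrightarrow> \<bar>g z\<bar> \<le> norm z ^ q"
    and f: "\<And>z. 0 \<le> f z"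
  shows "integrable m g"
proof (rule Bochner_Integration.integrable_bound)
  show "integrable m (\<lambda>z. f z + indicator {z. 1 \<le> norm z} z *\<^sub>R norm z ^ q)"
    using int tail by (auto simp: set_integrable_def)
  show "AE z in m. norm (g z) \<le> norm (f z + indicator {z. 1 \<le> norm z} z *\<^sub>R norm z ^ q)"
  proof (rule AE_I2)
    fix z
    show "norm (g z) \<le> norm (f z + indicator {z. 1 \<le> norm z} z *\<^sub>R norm z ^ q)"
      using small[of z] large[of z] f[of z] by (cases "1 \<le> norm z") auto
  qed
qed (rule measurable_punctured[OF m g])

text \<open>Orders start at 2 because near the origin admissibility controls only the square of the
  coordinate \<open>i\<close>, and the first moment may be infinite. The minimum in the second claim
  makes the remainder of index \<open>Suc q\<close> integrable even if the moment of order
  \<open>Suc q\<close> is infinite.\<close>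

lemma branching_moments_integrable:
  assumes adm: "admissible c \<beta> B \<nu> \<mu>" and q: "1 \<le> q"
    and tail: "set_integrable (\<mu> i) {z. 1 \<le> norm z} (\<lambda>z. norm z ^ q)"
  shows "2 \<le> j \<Longrightarrow> j \<le> q \<Longrightarrow> integrable (\<mu> i) (\<lambda>z. norm z ^ j)"
    and "integrable (\<mu> i) (\<lambda>z. min (norm z ^ q) (norm z ^ Suc q))"
proof -
  note int = integrable_power_from_tail[OF admissible_sets(2)[OF adm] admissible_integrable(1)[OF adm] tail]
  have small: "norm z ^ j \<le> min (norm z) ((norm z)\<^sup>2)" if "norm z < 1" "2 \<le> j" for z :: "real ^ 'a" and j
    using power_decreasing[OF \<open>2 \<le> j\<close>, of "norm z"] power_decreasing[of 1 2 "norm z"] that by simp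
  show "2 \<le> j \<Longrightarrow> j \<le> q \<Longrightarrow> integrable (\<mu> i) (\<lambda>z. norm z ^ j)"
    by (rule int) (auto simp: small[simplified] intro: power_increasing)
  show "integrable (\<mu> i) (\<lambda>z. min (norm z ^ q) (norm z ^ Suc q))"
  proof (rule int)
    fix z :: "real ^ 'a"
    show "\<bar>min (norm z ^ q) (norm z ^ Suc q)\<bar> \<le> min (norm z) ((norm z)\<^sup>2)" if "norm z < 1"
      using small[OF that, of "Suc q"] q by (simp add: min_def split: if_splits)
    show "\<bar>min (norm z ^ q) (norm z ^ Suc q)\<bar> \<le> norm z ^ q" if "1 \<le> norm z"
      by (simp add: min_def)
  qed auto
qed

lemma immigration_moments_integrable:
  assumes adm: "admissible c \<beta> B \<nu> \<mu>"
    and tail: "set_integrable \<nu> {z. 1 \<le> norm z} (\<lambda>z. norm z ^ q)"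
    and j: "1 \<le> j" "j \<le> q"
  shows "integrable \<nu> (\<lambda>z. norm z ^ j)"
proof (rule integrable_power_from_tail[OF admissible_sets(1)[OF adm] _ tail])
  show "integrable \<nu> (\<lambda>z. min 1 (norm z))"
    using adm by (simp add: admissible_def)
  show "\<bar>norm z ^ j\<bar> \<le> min 1 (norm z)" if "norm z < 1" for z :: "real ^ 'a"
    using power_decreasing[OF j(1), of "norm z"] that by simp
qed (use j in \<open>auto intro: power_increasing\<close>)

lemma immigration_mechanism_eq: "immigration_mechanism \<beta> \<nu> l = \<beta> \<bullet> l + rem_int \<nu> 1 l"
proof -
  have "(\<integral>z. exp_rem 1 (l \<bullet> z) \<partial>\<nu>) = (\<integral>z. - (exp (- (l \<bullet> z)) - 1) \<partial>\<nu>)"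
    by (simp add: One_nat_def)
  also have "\<dots> = - (\<integral>z. exp (- (l \<bullet> z)) - 1 \<partial>\<nu>)"
    by (rule Bochner_Integration.integral_minus)
  finally show ?thesis
    by (simp add: immigration_mechanism_def rem_int_def)
qed

lemma integrable_exp_rem_Suc:
  assumes m: "sets m = sets punctured_borel" and l: "l \<in> orthant"
    and int: "integrable m (\<lambda>z. min (norm z ^ q) (norm z ^ Suc q))"
  shows "integrable m (\<lambda>z. exp_rem (Suc q) (l \<bullet> z))"
proof (rule Bochner_Integration.integrable_bound)
  define D where "D = max 1 (norm l)"
  show "integrable m (\<lambda>z. D ^ Suc q * min (norm z ^ q) (norm z ^ Suc q))"
    using int by simp
  show "(\<lambda>z. exp_rem (Suc q) (l \<bullet> z)) \<in> borel_measurable m"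
    by (intro measurable_punctured[OF m] exp_rem_measurable) simp
  show "AE z in m. norm (exp_rem (Suc q) (l \<bullet> z)) \<le> norm (D ^ Suc q * min (norm z ^ q) (norm z ^ Suc q))"
  proof (rule AE_I2)
    fix z assume "z \<in> space m"
    then have z: "z \<in> orthant" using space_punctured[OF m] by simp
    have nn: "0 \<le> l \<bullet> z" by (rule orthant_inner_nonneg[OF l z])
    have le: "l \<bullet> z \<le> D * norm z"
      using norm_cauchy_schwarz[of l z] mult_right_mono[of "norm l" D "norm z"] by (simp add: D_def)
    have "exp_rem (Suc q) (l \<bullet> z) \<le> min ((l \<bullet> z) ^ q) ((l \<bullet> z) ^ Suc q)"
      by (rule exp_rem_Suc_le_power[OF nn])
    also have "\<dots> \<le> min (D ^ Suc q * norm z ^ q) (D ^ Suc q * norm z ^ Suc q)"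
    proof (rule min.mono)
      have "(l \<bullet> z) ^ q \<le> D ^ q * norm z ^ q"
        using power_mono[OF le nn, of q] by (simp add: power_mult_distrib)
      also have "\<dots> \<le> D ^ Suc q * norm z ^ q"
        by (intro mult_right_mono power_increasing) (auto simp: D_def)
      finally show "(l \<bullet> z) ^ q \<le> D ^ Suc q * norm z ^ q" .
      show "(l \<bullet> z) ^ Suc q \<le> D ^ Suc q * norm z ^ Suc q"
        using power_mono[OF le nn, of "Suc q"] by (simp only: power_mult_distrib)
    qed
    also have "\<dots> = D ^ Suc q * min (norm z ^ q) (norm z ^ Suc q)"
      by (simp only: min_mult_distrib_left) (auto simp: D_def)
    finally show "norm (exp_rem (Suc q) (l \<bullet> z)) \<le> norm (D ^ Suc q * min (norm z ^ q) (norm z ^ Suc q))"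
      using exp_rem_nonneg[OF nn, of "Suc q"] by (simp del: exp_rem.simps)
  qed
qed

text \<open>The flow vanishes to first order at the origin. Dividing by \<open>h\<close> fixes the
  initial value at \<open>u\<close> and keeps the family bounded; an expansion of order
  \<open>n\<close> here is one of order \<open>Suc n\<close> for the flow.\<close>

definition dirflow :: "(real \<Rightarrow> real ^ 'd::finite \<Rightarrow> real ^ 'd) \<Rightarrow> real ^ 'd \<Rightarrow> real \<Rightarrow> real \<Rightarrow> real ^ 'd" where
  "dirflow v u h s = (1 / h) *\<^sub>R v s (h *\<^sub>R u)"

lemma eventually_at_right_0_pos: "\<forall>\<^sub>F h::real in at_right 0. 0 < h"
  by (auto simp: eventually_at_right_field intro: exI[of _ 1])

section \<open>The bootstrap for the rescaled flow along a ray, and the immigration term\<close>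

context
  fixes c \<beta> :: "real ^ 'd::finite" and B \<nu> \<mu> v q and T :: real and u :: "real ^ 'd"
  assumes adm: "admissible c \<beta> B \<nu> \<mu>" and flow: "cbi_flow c B \<mu> v" and q: "1 \<le> q"
    and nu_tail: "set_integrable \<nu> {z. 1 \<le> norm z} (\<lambda>z. norm z ^ q)"
    and mu_tail: "\<And>i. set_integrable (\<mu> i) {z. 1 \<le> norm z} (\<lambda>z. norm z ^ q)"
    and T: "0 \<le> T" and u: "u \<in> orthant"
begin

lemma dirflow_scale: "0 < h \<Longrightarrow> v s (h *\<^sub>R u) = h *\<^sub>R dirflow v u h s"
  by (simp add: dirflow_def)

lemma dirflow_bound:
  obtains C where "0 \<le> C" "\<forall>\<^sub>F h in at_right 0. \<forall>s\<in>{0..T}. dirflow v u h s \<in> orthant \<and> norm (dirflow v u h s) \<le> C"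
proof -
  obtain C where C: "\<And>l t. l \<in> orthant \<Longrightarrow> t \<in> {0..T} \<Longrightarrow> norm (v t l) \<le> C * norm l"
    using flow_bound[OF adm flow T] by metis
  have "dirflow v u h s \<in> orthant \<and> norm (dirflow v u h s) \<le> \<bar>C * norm u\<bar>" if h: "0 < h" and s: "s \<in> {0..T}" for h s
  proof
    have hu: "h *\<^sub>R u \<in> orthant"
      using u h by (intro orthant_scaleR) auto
    show "dirflow v u h s \<in> orthant"
      unfolding dirflow_def using h s by (intro orthant_scaleR[OF flow_orthant[OF adm flow hu]]) auto
    have "norm (dirflow v u h s) \<le> C * norm u"
      using C[OF hu s] h by (simp add: dirflow_def field_simps)
    then show "norm (dirflow v u h s) \<le> \<bar>C * norm u\<bar>"
      by simp
  qed
  then have "\<forall>\<^sub>F h in at_right 0. \<forall>s\<in>{0..T}. dirflow v u h s \<in> orthant \<and> norm (dirflow v u h s) \<le> \<bar>C * norm u\<bar>"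
    using eventually_at_right_0_pos by (auto elim: eventually_mono)
  then show ?thesis using that by (meson abs_ge_zero)
qed

lemma nonlin_dirflow_continuous:
  "\<forall>\<^sub>F h in at_right 0. continuous_on {0..T} (\<lambda>s. nonlin c \<mu> (v s (h *\<^sub>R u)) $ i / h)"
  using eventually_at_right_0_pos
proof eventually_elim
  case (elim h)
  have "continuous_on {0..T} (\<lambda>s. nonlin c \<mu> (v s (h *\<^sub>R u)) $ i)"
    using elim u by (intro continuous_on_subset[OF nonlin_flow_continuous[OF adm flow]] orthant_scaleR) auto
  then show ?case
    using elim by (intro continuous_on_divide continuous_on_const) auto
qed

text \<open>Duhamel's formula divided by \<open>h\<close>: matrix factors and the time integral
  preserve the order, so the flow inherits whatever order is known for the nonlinear part.\<close>

lemma uexp_dirflow: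
  assumes "\<And>k. uexp {0..T} n (\<lambda>h s. nonlin c \<mu> (v s (h *\<^sub>R u)) $ k / h)"
  shows "uexp {0..T} n (\<lambda>h s. dirflow v u h s $ i)"
proof -
  obtain P Q :: "real \<Rightarrow> real ^ 'd ^ 'd" where PQ: "\<And>t. P t ** Q t = mat 1" "Q 0 = mat 1"
    and P: "\<And>i j S. continuous_on S (\<lambda>t. P t $ i $ j)"
    and Q: "\<And>t i j. ((\<lambda>t. Q t $ i $ j) has_real_derivative - (Q t ** drift B \<mu>) $ i $ j) (at t)"
    by (rule linear_flow_exists[of "drift B \<mu>"]) (rule that)
  have Qc: "continuous_on S (\<lambda>t. Q t $ i $ j)" for S i j
    by (intro continuous_at_imp_continuous_on ballI DERIV_isCont[OF Q])
  let ?I = "\<lambda>h j s. integral {0..s} (\<lambda>r. \<Sum>k\<in>UNIV. Q r $ j $ k * (nonlin c \<mu> (v r (h *\<^sub>R u)) $ k / h))"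
  have "uexp {0..T} n (\<lambda>h s. \<Sum>j\<in>UNIV. P s $ i $ j * (u $ j + (- 1) * ?I h j s))"
    by (intro uexp_sum uexp_mult uexp_add uexp_const uexp_integral compact_Icc P Qc assms continuous_on_const)
  then show ?thesis
  proof (rule uexp_cong)
    show "\<forall>\<^sub>F h in at_right 0. \<forall>s\<in>{0..T}. (\<Sum>j\<in>UNIV. P s $ i $ j * (u $ j + (- 1) * ?I h j s)) = dirflow v u h s $ i"
      using eventually_at_right_0_pos
    proof eventually_elim
      case (elim h)
      show ?case
      proof
        fix s assume s: "s \<in> {0..T}"
        have hu: "h *\<^sub>R u \<in> orthant"
          using u elim by (intro orthant_scaleR) auto
        have "?I h j s = integral {0..s} (\<lambda>r. \<Sum>k\<in>UNIV. Q r $ j $ k * nonlin c \<mu> (v r (h *\<^sub>R u)) $ k) / h" for j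
          by (subst integral_divide[symmetric]) (simp add: sum_divide_distrib)
        moreover have "dirflow v u h s $ i = (\<Sum>j\<in>UNIV. P s $ i $ j *
            ((h *\<^sub>R u) $ j - integral {0..s} (\<lambda>r. \<Sum>k\<in>UNIV. Q r $ j $ k * nonlin c \<mu> (v r (h *\<^sub>R u)) $ k))) / h"
          using flow_duhamel[OF adm flow PQ Q hu, of s i] s by (simp add: dirflow_def)
        ultimately show "(\<Sum>j\<in>UNIV. P s $ i $ j * (u $ j + (- 1) * ?I h j s)) = dirflow v u h s $ i"
          using elim by (auto simp: sum_divide_distrib intro!: sum.cong) (simp add: field_simps)
      qed
    qed
  qed
qed

text \<open>The bootstrap starts without any expansion of the flow. The a priori bound alone makes
  the quadratic term O(h) and the jump term o(1), so the limit is 0.\<close>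

lemma uexp_nonlin_0: "uexp {0..T} 0 (\<lambda>h s. nonlin c \<mu> (v s (h *\<^sub>R u)) $ k / h)"
proof -
  obtain C where C: "0 \<le> C" and w: "\<forall>\<^sub>F h in at_right 0. \<forall>s\<in>{0..T}. dirflow v u h s \<in> orthant \<and> norm (dirflow v u h s) \<le> C"
    by (rule dirflow_bound) (rule that)
  have "integrable (\<mu> k) (\<lambda>z. min (norm z ^ 1) (norm z ^ Suc 1))"
    using admissible_integrable(1)[OF adm] by (simp add: power2_eq_square)
  from rem_int_uniform_limit[OF admissible_sets(2)[OF adm] this w]
  have rem: "uniform_limit {0..T} (\<lambda>h s. rem_int (\<mu> k) 2 (h *\<^sub>R dirflow v u h s) / h) (\<lambda>_. 0) (at_right 0)"
    by (simp add: numeral_2_eq_2)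
  have quad: "uniform_limit {0..T} (\<lambda>h s. h * (c $ k * (dirflow v u h s $ k)\<^sup>2)) (\<lambda>_. 0) (at_right 0)"
    unfolding uniform_limit_iff
  proof (intro allI impI)
    fix e :: real assume "e > 0"
    have "((\<lambda>h. h * (\<bar>c $ k\<bar> * C\<^sup>2)) \<longlongrightarrow> 0) (at_right 0)"
      by (rule tendsto_eq_intros refl)+ simp
    then have "\<forall>\<^sub>F h in at_right 0. h * (\<bar>c $ k\<bar> * C\<^sup>2) < e"
      using \<open>e > 0\<close> by (rule order_tendstoD)
    then show "\<forall>\<^sub>F h in at_right 0. \<forall>s\<in>{0..T}. dist (h * (c $ k * (dirflow v u h s $ k)\<^sup>2)) 0 < e"
      using w eventually_at_right_0_pos
    proof eventually_elim
      case (elim h)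
      show ?case
      proof
        fix s assume "s \<in> {0..T}"
        then have "\<bar>dirflow v u h s $ k\<bar> \<le> C"
          using elim component_le_norm_cart[of "dirflow v u h s" k] by force
        then have "(dirflow v u h s $ k)\<^sup>2 \<le> C\<^sup>2"
          using C by (simp add: abs_le_square_iff[symmetric])
        then have "h * (\<bar>c $ k\<bar> * (dirflow v u h s $ k)\<^sup>2) \<le> h * (\<bar>c $ k\<bar> * C\<^sup>2)"
          using elim by (intro mult_left_mono) auto
        also note elim(1)
        finally show "dist (h * (c $ k * (dirflow v u h s $ k)\<^sup>2)) 0 < e"
          using elim by (simp add: abs_mult)
      qed
    qed
  qed
  have "uniform_limit {0..T} (\<lambda>h s. h * (c $ k * (dirflow v u h s $ k)\<^sup>2) + rem_int (\<mu> k) 2 (h *\<^sub>R dirflow v u h s) / h)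
      (\<lambda>_. 0 + 0) (at_right 0)"
    by (rule uniform_limit_add[OF quad rem])
  then have "uniform_limit {0..T} (\<lambda>h s. nonlin c \<mu> (v s (h *\<^sub>R u)) $ k / h / h ^ 0) (\<lambda>_. 0) (at_right 0)"
  proof (rule uniform_limit_cong[THEN iffD1, rotated 2])
    show "\<forall>\<^sub>F h in at_right 0. \<forall>s\<in>{0..T}. h * (c $ k * (dirflow v u h s $ k)\<^sup>2) + rem_int (\<mu> k) 2 (h *\<^sub>R dirflow v u h s) / h
        = nonlin c \<mu> (v s (h *\<^sub>R u)) $ k / h / h ^ 0"
      using eventually_at_right_0_pos
      by eventually_elim (simp add: dirflow_scale nonlin_def power2_eq_square field_simps)
  qed simp
  then show ?thesis
    by (intro uexp_remainder nonlin_dirflow_continuous)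
qed

lemma uexp_rem_int_expansion:
  assumes m: "sets m = sets punctured_borel"
    and w: "\<And>i. uexp {0..T} n (\<lambda>h s. dirflow v u h s $ i)"
    and p: "0 < p" and r: "\<And>j. j < r \<Longrightarrow> integrable m (\<lambda>z. norm z ^ (p + j))"
  shows "uexp {0..T} n (\<lambda>h s. \<Sum>j<r. h ^ j * ((-1) ^ j / fact (p + j) * (\<integral>z. (dirflow v u h s \<bullet> z) ^ (p + j) \<partial>m)))"
proof -
  have "uexp {0..T} n (\<lambda>h s. \<integral>z. (dirflow v u h s \<bullet> z) ^ (p + j) \<partial>m)" if "j < r" for j
    using uexp_moment[OF m _ w, of "\<lambda>_. 1" 0 "p + j"] r[OF that] by simp
  then show ?thesis
    by (intro uexp_sum uexp_theta_power_mult compact_Icc uexp_mult uexp_const continuous_on_const) auto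
qed

lemma rem_int_dirflow_expand:
  assumes m: "sets m = sets punctured_borel" and h: "0 < h" and s: "s \<in> {0..T}"
    and r: "\<And>j. j < r \<Longrightarrow> integrable m (\<lambda>z. norm z ^ (p + j))"
    and rem: "integrable m (\<lambda>z. exp_rem (p + r) (v s (h *\<^sub>R u) \<bullet> z))"
  shows "rem_int m p (v s (h *\<^sub>R u)) =
    h ^ p * (\<Sum>j<r. h ^ j * ((-1) ^ j / fact (p + j) * (\<integral>z. (dirflow v u h s \<bullet> z) ^ (p + j) \<partial>m)))
    + (-1) ^ r * rem_int m (p + r) (h *\<^sub>R dirflow v u h s)"
proof -
  have "v s (h *\<^sub>R u) \<in> orthant"
    using u h s by (intro flow_orthant[OF adm flow] orthant_scaleR) auto
  from rem_int_expand[OF m this r rem] show ?thesis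
    by (simp add: dirflow_scale[OF h] power_mult_distrib power_add sum_distrib_left mult_ac)
qed

text \<open>The nonlinear part starts at order two, so one division by \<open>h\<close> leaves a
  factor \<open>h\<close> in front of a polynomial expression in the flow, and this factor raises
  the order. The Taylor remainder is only o(h^(q-1)) after the division, which stops the bootstrap
  at order \<open>q - 1\<close>.\<close>

lemma uexp_nonlin_Suc:
  assumes wi: "\<And>i. uexp {0..T} n (\<lambda>h s. dirflow v u h s $ i)" and n: "n + 2 \<le> q"
  shows "uexp {0..T} (Suc n) (\<lambda>h s. nonlin c \<mu> (v s (h *\<^sub>R u)) $ k / h)"
proof -
  note m = admissible_sets(2)[OF adm, of k]
  note int = branching_moments_integrable[OF adm q mu_tail]
  \<comment> \<open>The jump terms have orders 2 to \<open>q\<close>, hence \<open>q - 1\<close> of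
    them. Of the common factor h^2, one \<open>h\<close> is spent on the division and the other
    stands in front of \<open>main\<close>.\<close>
  define main where "main h s = c $ k * (dirflow v u h s $ k)\<^sup>2 +
    (\<Sum>j<q-1. h ^ j * ((-1) ^ j / fact (2 + j) * (\<integral>z. (dirflow v u h s \<bullet> z) ^ (2 + j) \<partial>\<mu> k)))" for h s
  define rest where "rest h s = (-1) ^ (q-1) * rem_int (\<mu> k) (Suc q) (h *\<^sub>R dirflow v u h s) / h" for h s
  have main: "uexp {0..T} (Suc n) (\<lambda>h s. h * main h s)"
    unfolding main_def
    by (intro uexp_theta_mult uexp_add uexp_mult uexp_const continuous_on_const uexp_power wi
        uexp_rem_int_expansion[OF m wi] int) (use q in auto)
  have split: "\<forall>\<^sub>F h in at_right 0. \<forall>s\<in>{0..T}. nonlin c \<mu> (v s (h *\<^sub>R u)) $ k / h = h * main h s + rest h s"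
    using eventually_at_right_0_pos
  proof eventually_elim
    case (elim h)
    show ?case
    proof
      fix s assume s: "s \<in> {0..T}"
      have vs: "v s (h *\<^sub>R u) \<in> orthant"
        using u elim s by (intro flow_orthant[OF adm flow] orthant_scaleR) auto
      have Suc_q: "2 + (q - 1) = Suc q" using q by simp
      have "rem_int (\<mu> k) 2 (v s (h *\<^sub>R u)) =
        h ^ 2 * (\<Sum>j<q-1. h ^ j * ((-1) ^ j / fact (2 + j) * (\<integral>z. (dirflow v u h s \<bullet> z) ^ (2 + j) \<partial>\<mu> k)))
        + (-1) ^ (q-1) * rem_int (\<mu> k) (Suc q) (h *\<^sub>R dirflow v u h s)"
      proof (rule rem_int_dirflow_expand[OF m elim s, where p = 2 and r = "q - 1", unfolded Suc_q])
        show "integrable (\<mu> k) (\<lambda>z. norm z ^ (2 + j))" if "j < q - 1" for j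
          using that by (intro int(1)) auto
      qed (rule integrable_exp_rem_Suc[OF m vs int(2)])
      then show "nonlin c \<mu> (v s (h *\<^sub>R u)) $ k / h = h * main h s + rest h s"
        using elim by (simp add: nonlin_def main_def rest_def dirflow_scale[OF elim] power2_eq_square field_simps)
    qed
  qed
  obtain C where "0 \<le> C" and w: "\<forall>\<^sub>F h in at_right 0. \<forall>s\<in>{0..T}. dirflow v u h s \<in> orthant \<and> norm (dirflow v u h s) \<le> C"
    by (rule dirflow_bound) (rule that)
  from rem_int_uniform_limit[OF m int(2) w]
  have "uniform_limit {0..T} (\<lambda>h s. (-1) ^ (q-1) * (rem_int (\<mu> k) (Suc q) (h *\<^sub>R dirflow v u h s) / h ^ q)) (\<lambda>s. (-1) ^ (q-1) * 0) (at_right 0)"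
    by (intro uniform_limit_intros)
  moreover have "h * h ^ (q - 1) = h ^ q" for h :: real
    using q by (metis One_nat_def Suc_pred less_eq_Suc_le power_Suc)
  ultimately have lim: "uniform_limit {0..T} (\<lambda>h s. rest h s / h ^ (q-1)) (\<lambda>_. 0) (at_right 0)"
    by (simp add: rest_def)
  \<comment> \<open>The remainder integral is not shown continuous directly: it is the difference of
    the nonlinear part and the expanded part, both already continuous.\<close>
  have "\<forall>\<^sub>F h in at_right 0. continuous_on {0..T} (rest h)"
    using split uexp_continuous[OF main] nonlin_dirflow_continuous[of k]
  proof eventually_elim
    case (elim h)
    have "continuous_on {0..T} (\<lambda>s. nonlin c \<mu> (v s (h *\<^sub>R u)) $ k / h - h * main h s)"
      by (rule continuous_on_diff[OF elim(3,2)])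
    then show ?case
      by (rule continuous_on_eq) (use elim(1) in auto)
  qed
  from uexp_remainder[OF this lim] have "uexp {0..T} (Suc n) rest"
    using n by (rule_tac uexp_mono) auto
  with main have "uexp {0..T} (Suc n) (\<lambda>h s. h * main h s + rest h s)"
    by (rule uexp_add)
  then show ?thesis
    by (rule uexp_cong) (use split in \<open>auto elim: eventually_mono\<close>)
qed

lemma uexp_dirflow_order: "n \<le> q - 1 \<Longrightarrow> uexp {0..T} n (\<lambda>h s. dirflow v u h s $ i)"
proof (induction n arbitrary: i)
  case 0
  show ?case by (intro uexp_dirflow uexp_nonlin_0)
next
  case (Suc n)
  then show ?case by (intro uexp_dirflow[OF uexp_nonlin_Suc[OF Suc.IH]]) auto
qed

lemma immigration_flow_continuous:
  assumes l: "l \<in> orthant"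
  shows "continuous_on {0..T} (\<lambda>s. immigration_mechanism \<beta> \<nu> (v s l))"
proof -
  note m = admissible_sets(1)[OF adm]
  obtain C where C: "\<And>s. s \<in> {0..T} \<Longrightarrow> norm (v s l) \<le> C * norm l"
    using flow_bound[OF adm flow T] l by metis
  have int: "integrable \<nu> norm"
    using immigration_moments_integrable[OF adm nu_tail, of 1] q by simp
  have "\<forall>a\<in>orthant \<inter> cball 0 (C * norm l). \<forall>b\<in>orthant \<inter> cball 0 (C * norm l).
      \<bar>rem_int \<nu> (Suc 0) a - rem_int \<nu> (Suc 0) b\<bar> \<le> (\<integral>z. norm z \<partial>\<nu>) * norm (a - b)"
    by (intro ballI rem_int_lipschitz[OF m int, where R = "C * norm l"]) (auto intro!: mult_left_le_one_le)
  then have "(\<integral>z. norm z \<partial>\<nu>)-lipschitz_on (orthant \<inter> cball 0 (C * norm l)) (rem_int \<nu> 1)"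
    by (intro lipschitz_onI) (auto simp: dist_norm)
  then have "continuous_on (orthant \<inter> cball 0 (C * norm l)) (rem_int \<nu> 1)"
    by (rule lipschitz_on_continuous_on)
  moreover have vc: "continuous_on {0..T} (\<lambda>s. v s l)"
    unfolding continuous_on_eq_continuous_within
  proof
    fix s assume s: "s \<in> {0..T}"
    have "((\<lambda>s. v s l) has_vector_derivative - branching_mechanism c B \<mu> (v s l)) (at s within {0..})"
      using flow l s unfolding cbi_flow_def by auto
    then have "continuous (at s within {0..}) (\<lambda>s. v s l)"
      by (rule has_vector_derivative_continuous)
    then show "continuous (at s within {0..T}) (\<lambda>s. v s l)"
      by (rule continuous_within_subset) auto
  qed
  moreover have "(\<lambda>s. v s l) ` {0..T} \<subseteq> orthant \<inter> cball 0 (C * norm l)"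
    using C flow_orthant[OF adm flow l] by auto
  ultimately have "continuous_on {0..T} (\<lambda>s. rem_int \<nu> 1 (v s l))"
    by (rule continuous_on_compose2)
  then show ?thesis
    unfolding immigration_mechanism_eq by (intro continuous_on_add continuous_on_inner continuous_on_const vc)
qed

text \<open>Immigration has terms of order one, so the division by \<open>h\<close> leaves no spare
  factor and no order is gained. None is needed, since the flow is already expanded to order
  \<open>q - 1\<close>.\<close>

lemma uexp_immigration:
  "uexp {0..T} (q - 1) (\<lambda>h s. integral {0..s} (\<lambda>r. immigration_mechanism \<beta> \<nu> (v r (h *\<^sub>R u))) / h)"
proof -
  note m = admissible_sets(1)[OF adm]
  note mom = immigration_moments_integrable[OF adm nu_tail]
  have int: "integrable \<nu> (\<lambda>z. min (norm z ^ q) (norm z ^ Suc q))"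
    by (rule Bochner_Integration.integrable_bound[OF mom[OF q order_refl]])
      (auto intro!: measurable_punctured[OF m] simp: min_def)
  define main where "main h s = (\<Sum>i\<in>UNIV. \<beta> $ i * dirflow v u h s $ i) +
    (\<Sum>j<q. h ^ j * ((-1) ^ j / fact (1 + j) * (\<integral>z. (dirflow v u h s \<bullet> z) ^ (1 + j) \<partial>\<nu>)))" for h s
  define rest where "rest h s = (-1) ^ q * rem_int \<nu> (Suc q) (h *\<^sub>R dirflow v u h s) / h" for h s
  have main: "uexp {0..T} (q - 1) main"
    unfolding main_def
    by (intro uexp_add uexp_sum[of UNIV] uexp_mult uexp_const continuous_on_const uexp_dirflow_order
        uexp_rem_int_expansion[OF m] mom) (use q in auto)
  have split: "\<forall>\<^sub>F h in at_right 0. \<forall>s\<in>{0..T}. immigration_mechanism \<beta> \<nu> (v s (h *\<^sub>R u)) / h = main h s + rest h s"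
    using eventually_at_right_0_pos
  proof eventually_elim
    case (elim h)
    show ?case
    proof
      fix s assume s: "s \<in> {0..T}"
      have vs: "v s (h *\<^sub>R u) \<in> orthant"
        using u elim s by (intro flow_orthant[OF adm flow] orthant_scaleR) auto
      have "rem_int \<nu> 1 (v s (h *\<^sub>R u)) =
        h ^ 1 * (\<Sum>j<q. h ^ j * ((-1) ^ j / fact (1 + j) * (\<integral>z. (dirflow v u h s \<bullet> z) ^ (1 + j) \<partial>\<nu>)))
        + (-1) ^ q * rem_int \<nu> (1 + q) (h *\<^sub>R dirflow v u h s)"
        using integrable_exp_rem_Suc[OF m vs int] by (intro rem_int_dirflow_expand[OF m elim s] mom) auto
      moreover have "\<beta> \<bullet> v s (h *\<^sub>R u) = h * (\<Sum>i\<in>UNIV. \<beta> $ i * dirflow v u h s $ i)"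
        by (simp add: dirflow_scale[OF elim] inner_vec_def sum_distrib_left mult_ac)
      ultimately show "immigration_mechanism \<beta> \<nu> (v s (h *\<^sub>R u)) / h = main h s + rest h s"
        using elim by (simp add: immigration_mechanism_eq main_def rest_def field_simps)
    qed
  qed
  obtain C where "0 \<le> C" and w: "\<forall>\<^sub>F h in at_right 0. \<forall>s\<in>{0..T}. dirflow v u h s \<in> orthant \<and> norm (dirflow v u h s) \<le> C"
    by (rule dirflow_bound) (rule that)
  from rem_int_uniform_limit[OF m int w]
  have "uniform_limit {0..T} (\<lambda>h s. (-1) ^ q * (rem_int \<nu> (Suc q) (h *\<^sub>R dirflow v u h s) / h ^ q)) (\<lambda>s. (-1) ^ q * 0) (at_right 0)"
    by (intro uniform_limit_intros)
  moreover have "h * h ^ (q - 1) = h ^ q" for h :: real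
    using q by (metis One_nat_def Suc_pred less_eq_Suc_le power_Suc)
  ultimately have lim: "uniform_limit {0..T} (\<lambda>h s. rest h s / h ^ (q-1)) (\<lambda>_. 0) (at_right 0)"
    by (simp add: rest_def)
  have "\<forall>\<^sub>F h in at_right 0. continuous_on {0..T} (rest h)"
    using split uexp_continuous[OF main] eventually_at_right_0_pos
  proof eventually_elim
    case (elim h)
    have "continuous_on {0..T} (\<lambda>s. immigration_mechanism \<beta> \<nu> (v s (h *\<^sub>R u)) / h - main h s)"
      using elim u
      by (intro continuous_on_diff continuous_on_divide continuous_on_const immigration_flow_continuous orthant_scaleR) auto
    then show ?case
      by (rule continuous_on_eq) (use elim(1) in auto)
  qed
  from uexp_add[OF main uexp_remainder[OF this lim]]
  have "uexp {0..T} (q - 1) (\<lambda>h s. immigration_mechanism \<beta> \<nu> (v s (h *\<^sub>R u)) / h)"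
    by (rule uexp_cong) (use split in \<open>auto elim: eventually_mono\<close>)
  then have "uexp {0..T} (q - 1) (\<lambda>h s. integral {0..s} (\<lambda>r. immigration_mechanism \<beta> \<nu> (v r (h *\<^sub>R u)) / h))"
    by (rule uexp_integral)
  then show ?thesis by simp
qed

end

subsection \<open>Moments from expansions of the Laplace transform\<close>

lemma poly_coeff_limit:
  fixes p :: "real poly"
  shows "((\<lambda>h. (poly p h - (\<Sum>i<j. coeff p i * h ^ i)) / h ^ j) \<longlongrightarrow> coeff p j) (at_right 0)"
proof -
  have eq: "poly p h = (\<Sum>i<j. coeff p i * h ^ i) + h ^ j * poly (poly_shift j p) h" for h
  proof (induction j)
    case (Suc j)
    have "poly_shift j p = pCons (coeff p j) (poly_shift (Suc j) p)"
      by (simp add: poly_eq_iff coeff_poly_shift coeff_pCons split: nat.splits)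
    then have "poly (poly_shift j p) h = coeff p j + h * poly (poly_shift (Suc j) p) h"
      by (metis poly_pCons)
    then show ?case using Suc by (simp add: algebra_simps)
  qed simp
  have "\<forall>\<^sub>F h in at_right 0. (poly p h - (\<Sum>i<j. coeff p i * h ^ i)) / h ^ j = poly (poly_shift j p) h"
    using eventually_at_right_0_pos
  proof eventually_elim
    case (elim h)
    then show ?case by (subst eq) simp
  qed
  moreover have "((\<lambda>h. poly (poly_shift j p) h) \<longlongrightarrow> poly (poly_shift j p) 0) (at_right 0)"
    by (intro tendsto_intros)
  moreover have "poly (poly_shift j p) 0 = coeff p j"
    by (simp add: poly_0_coeff_0 coeff_poly_shift)
  ultimately show ?thesis
    by (simp add: filterlim_cong)
qed

lemma smallo_power_tendsto_0:
  fixes f :: "real \<Rightarrow> real"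
  assumes "f \<in> o[at_right 0](\<lambda>h. h ^ q)" "j \<le> q"
  shows "((\<lambda>h. f h / h ^ j) \<longlongrightarrow> 0) (at_right 0)"
proof (rule smalloD_tendsto)
  have "(\<lambda>h::real. h ^ q) \<in> O[at_right 0](\<lambda>h. h ^ j)"
  proof (rule landau_o.bigI[of 1])
    have "\<forall>\<^sub>F h::real in at_right 0. h < 1"
      by (auto simp: eventually_at_right_field intro: exI[of _ 1])
    then show "\<forall>\<^sub>F h::real in at_right 0. norm (h ^ q) \<le> 1 * norm (h ^ j)"
      using eventually_at_right_0_pos
      by eventually_elim (use assms(2) in \<open>auto simp: power_decreasing\<close>)
  qed simp
  then show "f \<in> o[at_right 0](\<lambda>h. h ^ j)"
    using assms(1) by (rule landau_o.small_big_trans[rotated])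
qed

lemma poly_coeff_unique:
  fixes p p' :: "real poly"
  assumes "(\<lambda>h. poly p h - poly p' h) \<in> o[at_right 0](\<lambda>h. h ^ q)" "j \<le> q"
  shows "coeff p j = coeff p' j"
  using assms(2)
proof (induction j rule: less_induct)
  case (less j)
  then have "coeff (p - p') i = 0" if "i < j" for i
    using that by simp
  then have "((\<lambda>h. poly (p - p') h / h ^ j) \<longlongrightarrow> coeff (p - p') j) (at_right 0)"
    using poly_coeff_limit[of "p - p'" j] by simp
  moreover have "((\<lambda>h. poly (p - p') h / h ^ j) \<longlongrightarrow> 0) (at_right 0)"
    using smallo_power_tendsto_0[OF assms(1) less.prems] by simp
  ultimately have "coeff (p - p') j = 0"
    by (rule tendsto_unique[rotated]) simp
  then show ?case by simp
qed

lemma exp_rem_scaled_tendsto: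
  assumes "0 \<le> z"
  shows "((\<lambda>h. exp_rem j (h * z) / h ^ j) \<longlongrightarrow> z ^ j / fact j) (at_right 0)"
proof (rule tendsto_sandwich)
  show "\<forall>\<^sub>F h in at_right 0. z ^ j / fact j - h * z ^ Suc j \<le> exp_rem j (h * z) / h ^ j"
    using eventually_at_right_0_pos
  proof eventually_elim
    case (elim h)
    have "exp_rem (Suc j) (h * z) / h ^ j \<le> (h * z) ^ Suc j / h ^ j"
      using elim assms by (intro divide_right_mono exp_rem_le_power) auto
    then show ?case
      using elim by (simp add: power_mult_distrib diff_divide_distrib)
  qed
  show "\<forall>\<^sub>F h in at_right 0. exp_rem j (h * z) / h ^ j \<le> z ^ j / fact j"
    using eventually_at_right_0_pos
  proof eventually_elim
    case (elim h)
    have "exp_rem j (h * z) / h ^ j \<le> (h * z) ^ j / fact j / h ^ j"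
      using elim assms by (intro divide_right_mono exp_rem_le) auto
    then show ?case
      using elim by (simp add: power_mult_distrib)
  qed
  show "((\<lambda>h. z ^ j / fact j - h * z ^ Suc j) \<longlongrightarrow> z ^ j / fact j) (at_right 0)"
    by (rule tendsto_eq_intros refl)+ simp
qed simp

text \<open>If the Laplace transform has the expansion up to order \<open>q\<close>, then Fatou's lemma applied to
  the nonnegative Taylor remainders bounds the next moment, and dominated convergence identifies it.\<close>

lemma moments_of_laplace_expansion:
  fixes Z :: "'a \<Rightarrow> real"
  assumes N: "prob_space N" and Z: "Z \<in> borel_measurable N" and nn: "\<And>y. y \<in> space N \<Longrightarrow> 0 \<le> Z y"
    and L: "(\<lambda>h. (\<integral>y. exp (- (h * Z y)) \<partial>N) - poly p h) \<in> o[at_right 0](\<lambda>h. h ^ q)"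
    and j: "j \<le> q"
  shows "integrable N (\<lambda>y. Z y ^ j) \<and> coeff p j = (- 1) ^ j * (\<integral>y. Z y ^ j \<partial>N) / fact j"
  using j
proof (induction j rule: less_induct)
  case (less j)
  interpret N: prob_space N by (rule N)
  define L where "L h = (\<integral>y. exp (- (h * Z y)) \<partial>N)" for h
  have int: "integrable N (\<lambda>y. Z y ^ i)" and cf: "coeff p i = (- 1) ^ i * (\<integral>y. Z y ^ i \<partial>N) / fact i" if "i < j" for i
    using less.IH[OF that] less.prems that by auto
  have int_exp: "integrable N (\<lambda>y. exp (- (h * Z y)))" if "0 < h" for h
    using Z nn that by (intro N.integrable_const_bound[where B = 1]) auto
  have rem_eq: "exp_rem j x = (- 1) ^ j * (exp (- x) - (\<Sum>i<j. (- 1) ^ i * x ^ i / fact i))" for x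
    using exp_rem_expand[of 0 x j] by (simp add: power_mult_distrib[symmetric] mult.assoc[symmetric])
  have sum_int: "integrable N (\<lambda>y. \<Sum>i<j. (- 1) ^ i * (h * Z y) ^ i / fact i)" for h
    using int by (auto simp: power_mult_distrib)
  have int_rem: "integrable N (\<lambda>y. exp_rem j (h * Z y))" if "0 < h" for h
    unfolding rem_eq using int_exp[OF that] sum_int by auto
  \<comment> \<open>By induction the moments below \<open>j\<close> are the coefficients of
    \<open>p\<close>, so the integrated remainder is the transform minus the part of
    \<open>p\<close> below order \<open>j\<close>.\<close>
  have rem_int: "(\<integral>y. exp_rem j (h * Z y) \<partial>N) = (- 1) ^ j * (L h - (\<Sum>i<j. coeff p i * h ^ i))" if "0 < h" for h
  proof -
    have "(\<integral>y. (\<Sum>i<j. (- 1) ^ i * (h * Z y) ^ i / fact i) \<partial>N) = (\<Sum>i<j. coeff p i * h ^ i)"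
      using int cf by (subst Bochner_Integration.integral_sum)
        (auto simp: power_mult_distrib mult_ac intro!: sum.cong)
    then show ?thesis
      unfolding rem_eq L_def using int_exp[OF that] sum_int by simp
  qed
  have "((\<lambda>h. (- 1) ^ j * ((L h - poly p h) / h ^ j + (poly p h - (\<Sum>i<j. coeff p i * h ^ i)) / h ^ j))
      \<longlongrightarrow> (- 1) ^ j * (0 + coeff p j)) (at_right 0)"
    using smallo_power_tendsto_0[OF L less.prems]
    by (intro tendsto_intros poly_coeff_limit) (auto simp: L_def)
  then have lim: "((\<lambda>h. (\<integral>y. exp_rem j (h * Z y) / h ^ j \<partial>N)) \<longlongrightarrow> (- 1) ^ j * coeff p j) (at_right 0)"
  proof (rule filterlim_cong[THEN iffD1, rotated -1])
    show "\<forall>\<^sub>F h in at_right 0. (- 1) ^ j * ((L h - poly p h) / h ^ j + (poly p h - (\<Sum>i<j. coeff p i * h ^ i)) / h ^ j)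
      = (\<integral>y. exp_rem j (h * Z y) / h ^ j \<partial>N)"
      using eventually_at_right_0_pos
      by eventually_elim (simp add: rem_int add_divide_distrib[symmetric])
  qed simp_all
  have rem_nn: "0 \<le> exp_rem j (h * Z y) / h ^ j" if "0 < h" "y \<in> space N" for h y
    using that nn by (intro divide_nonneg_nonneg exp_rem_nonneg) auto
  have int_j: "integrable N (\<lambda>y. Z y ^ j)"
  proof -
    \<comment> \<open>Fatou's lemma is applied along a sequence of positive scales tending to
      0.\<close>
    define hn where "hn n = inverse (real (Suc n))" for n
    have hn: "filterlim hn (at_right 0) sequentially" "\<And>n. 0 < hn n"
      using LIMSEQ_inverse_real_of_nat by (auto simp: filterlim_at hn_def[abs_def])
    have "(\<integral>\<^sup>+ y. ennreal (Z y ^ j / fact j) \<partial>N)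
      = (\<integral>\<^sup>+ y. liminf (\<lambda>n. ennreal (exp_rem j (hn n * Z y) / hn n ^ j)) \<partial>N)"
    proof (rule nn_integral_cong)
      fix y assume "y \<in> space N"
      then have "((\<lambda>h. exp_rem j (h * Z y) / h ^ j) \<longlongrightarrow> Z y ^ j / fact j) (at_right 0)"
        by (intro exp_rem_scaled_tendsto nn)
      from filterlim_compose[OF this hn(1)]
      have "(\<lambda>n. ennreal (exp_rem j (hn n * Z y) / hn n ^ j)) \<longlonglongrightarrow> ennreal (Z y ^ j / fact j)"
        by (rule tendsto_ennrealI)
      then show "ennreal (Z y ^ j / fact j) = liminf (\<lambda>n. ennreal (exp_rem j (hn n * Z y) / hn n ^ j))"
        by (rule lim_imp_Liminf[OF trivial_limit_sequentially, symmetric])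
    qed
    also have "\<dots> \<le> liminf (\<lambda>n. \<integral>\<^sup>+ y. ennreal (exp_rem j (hn n * Z y) / hn n ^ j) \<partial>N)"
      using Z by (intro nn_integral_liminf) auto
    also have "(\<lambda>n. \<integral>\<^sup>+ y. ennreal (exp_rem j (hn n * Z y) / hn n ^ j) \<partial>N)
      = (\<lambda>n. ennreal (\<integral>y. exp_rem j (hn n * Z y) / hn n ^ j \<partial>N))"
      using rem_nn hn(2) int_rem by (intro ext nn_integral_eq_integral AE_I2) auto
    also have "liminf \<dots> = ennreal ((- 1) ^ j * coeff p j)"
      using filterlim_compose[OF lim hn(1)]
      by (intro lim_imp_Liminf trivial_limit_sequentially tendsto_ennrealI)
    also have "\<dots> < \<infinity>" by simp
    finally have "integrable N (\<lambda>y. Z y ^ j / fact j)"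
      using Z nn by (intro integrableI_nonneg AE_I2) auto
    from integrable_mult_left[OF this, of "fact j"] show ?thesis by simp
  qed
  have "((\<lambda>h. \<integral>y. exp_rem j (h * Z y) / h ^ j \<partial>N) \<longlongrightarrow> (\<integral>y. Z y ^ j / fact j \<partial>N)) (at_right 0)"
  proof (rule integral_dominated_convergence_at_right_0[where w = "\<lambda>y. Z y ^ j"])
    show "AE y in N. ((\<lambda>h. exp_rem j (h * Z y) / h ^ j) \<longlongrightarrow> Z y ^ j / fact j) (at_right 0)"
      by (intro AE_I2 exp_rem_scaled_tendsto nn)
    show "\<forall>\<^sub>F h in at_right 0. AE y in N. norm (exp_rem j (h * Z y) / h ^ j) \<le> Z y ^ j"
      using eventually_at_right_0_pos
    proof eventually_elim
      case (elim h)
      show ?case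
      proof (rule AE_I2)
        fix y assume y: "y \<in> space N"
        have "exp_rem j (h * Z y) / h ^ j \<le> (h * Z y) ^ j / h ^ j"
          using elim nn[OF y] by (intro divide_right_mono exp_rem_le_power) auto
        then show "norm (exp_rem j (h * Z y) / h ^ j) \<le> Z y ^ j"
          using rem_nn[OF elim y] elim by (simp add: power_mult_distrib)
      qed
    qed
  qed (use Z int_j in auto)
  from tendsto_unique[OF _ lim this] have "(- 1) ^ j * coeff p j = (\<integral>y. Z y ^ j \<partial>N) / fact j"
    by simp
  then have "(- 1) ^ j * ((- 1) ^ j * coeff p j) = (- 1) ^ j * (\<integral>y. Z y ^ j \<partial>N) / fact j"
    by simp
  then show ?case
    using int_j by (simp add: mult.assoc[symmetric] power_mult_distrib[symmetric])
qed

text \<open>The exponential series cut at the power \<open>q\<close>, not a polynomial cut at degree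
  \<open>q\<close>: if \<open>coeff p 0 = 0\<close>, its coefficients up to \<open>q\<close> are
  those of exp p, while the higher ones carry no meaning.\<close>

definition exp_poly :: "nat \<Rightarrow> real poly \<Rightarrow> real poly" where
  "exp_poly q p = (\<Sum>r\<le>q. smult (1 / fact r) (p ^ r))"

lemma poly_bigo_1: "(\<lambda>h. poly p h) \<in> O[at_right 0](\<lambda>_. 1 :: real)"
  by (rule bigoI_tendsto[of _ _ "poly p 0"]) (auto intro!: tendsto_eq_intros)

lemma exp_expansion:
  fixes f :: "real \<Rightarrow> real"
  assumes f: "(\<lambda>h. f h - poly p h) \<in> o[at_right 0](\<lambda>h. h ^ q)" and p: "coeff p 0 = 0"
  shows "(\<lambda>h. exp (f h) - poly (exp_poly q p) h) \<in> o[at_right 0](\<lambda>h. h ^ q)"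
proof -
  have p_lim: "((\<lambda>h. poly p h) \<longlongrightarrow> 0) (at_right 0)"
    by (rule tendsto_eq_intros refl)+ (simp add: poly_0_coeff_0 p)
  have e_lim: "((\<lambda>h. f h - poly p h) \<longlongrightarrow> 0) (at_right 0)"
    using smallo_power_tendsto_0[OF f, of 0] by simp
  have "(\<lambda>h. exp (f h - poly p h) - 1) \<in> O[at_right 0](\<lambda>h. f h - poly p h)"
  proof (rule landau_o.bigI[of 2])
    have "\<forall>\<^sub>F h in at_right 0. dist (f h - poly p h) 0 < 1 / 2"
      by (rule tendstoD[OF e_lim]) simp
    then show "\<forall>\<^sub>F h in at_right 0. norm (exp (f h - poly p h) - 1) \<le> 2 * norm (f h - poly p h)"
    proof eventually_elim
      case (elim h)
      define x where "x = f h - poly p h"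
      have "exp x \<le> 1 + 2 * \<bar>x\<bar>"
        using exp_bound_lemma[of x] elim by (simp add: dist_norm x_def)
      moreover have "1 + x \<le> exp x"
        by (rule exp_ge_add_one_self)
      ultimately have "\<bar>exp x - 1\<bar> \<le> 2 * \<bar>x\<bar>"
        by linarith
      then show ?case
        by (simp add: x_def)
    qed
  qed simp
  then have "(\<lambda>h. exp (f h - poly p h) - 1) \<in> o[at_right 0](\<lambda>h. h ^ q)"
    using f by (rule landau_o.big_small_trans)
  moreover have "((\<lambda>h. exp (poly p h)) \<longlongrightarrow> exp 0) (at_right 0)"
    by (intro tendsto_exp p_lim)
  then have "(\<lambda>h. exp (poly p h)) \<in> O[at_right 0](\<lambda>_. 1)"
    by (intro bigoI_tendsto[of _ _ "exp 0"]) auto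
  ultimately have "(\<lambda>h. exp (poly p h) * (exp (f h - poly p h) - 1)) \<in> o[at_right 0](\<lambda>h. 1 * h ^ q)"
    by (rule landau_o.big_small_mult[rotated])
  then have 1: "(\<lambda>h. exp (f h) - exp (poly p h)) \<in> o[at_right 0](\<lambda>h. h ^ q)"
    by (simp add: algebra_simps exp_diff)
  \<comment> \<open>Without constant term, p is h times a polynomial; the Lagrange remainder of the
    exponential series is therefore O(h^(q+1)).\<close>
  obtain p' where p': "p = pCons 0 p'"
    using p by (metis pCons_cases coeff_pCons_0)
  have "(\<lambda>h. exp (poly p h) - poly (exp_poly q p) h) \<in> O[at_right 0](\<lambda>h. poly p h ^ Suc q)"
  proof (rule landau_o.bigI[of "exp 1"])
    have "\<forall>\<^sub>F h in at_right 0. dist (poly p h) 0 < 1"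
      by (rule tendstoD[OF p_lim]) simp
    then show "\<forall>\<^sub>F h in at_right 0. norm (exp (poly p h) - poly (exp_poly q p) h) \<le> exp 1 * norm (poly p h ^ Suc q)"
    proof eventually_elim
      case (elim h)
      obtain t where t: "\<bar>t\<bar> \<le> \<bar>poly p h\<bar>"
        "exp (poly p h) = (\<Sum>m<Suc q. poly p h ^ m / fact m) + exp t / fact (Suc q) * poly p h ^ Suc q"
        using Maclaurin_exp_le by blast
      have "poly (exp_poly q p) h = (\<Sum>m<Suc q. poly p h ^ m / fact m)"
        by (simp add: exp_poly_def poly_sum lessThan_Suc_atMost)
      with t(2) have "exp (poly p h) - poly (exp_poly q p) h = exp t / fact (Suc q) * poly p h ^ Suc q"
        by linarith
      moreover have "exp t / fact (Suc q) \<le> exp 1 / 1"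
        using t(1) elim fact_ge_1[of "Suc q", where ?'a = real] by (intro frac_le) auto
      ultimately show ?case
        by (simp only: norm_mult) (intro mult_right_mono, auto)
    qed
  qed simp
  also have "(\<lambda>h. poly p h ^ Suc q) = (\<lambda>h. h ^ Suc q * poly p' h ^ Suc q)"
    by (simp add: p' power_mult_distrib mult_ac)
  also have "(\<lambda>h. h ^ Suc q * poly p' h ^ Suc q) \<in> O[at_right 0](\<lambda>h. h ^ Suc q * 1 ^ Suc q)"
    by (intro landau_o.big.mult landau_o.big_power poly_bigo_1) simp
  also have "(\<lambda>h::real. h ^ Suc q * 1 ^ Suc q) \<in> o[at_right 0](\<lambda>h. h ^ q)"
  proof (rule smalloI_tendsto)
    have "((\<lambda>h::real. h) \<longlongrightarrow> 0) (at_right 0)" by simp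
    then show "((\<lambda>h::real. h ^ Suc q * 1 ^ Suc q / h ^ q) \<longlongrightarrow> 0) (at_right 0)"
      by (rule filterlim_cong[THEN iffD1, rotated -1])
        (use eventually_at_right_0_pos in \<open>auto elim!: eventually_mono\<close>)
    show "\<forall>\<^sub>F h::real in at_right 0. h ^ q \<noteq> 0"
      using eventually_at_right_0_pos by eventually_elim simp
  qed
  finally have 2: "(\<lambda>h. exp (poly p h) - poly (exp_poly q p) h) \<in> o[at_right 0](\<lambda>h. h ^ q)" .
  from sum_in_smallo(1)[OF 1 2] show ?thesis by simp
qed

lemma coeff_exp_poly_1:
  assumes "coeff p 0 = 0" "1 \<le> q"
  shows "coeff (exp_poly q p) 1 = coeff p 1"
proof -
  obtain p' where p': "p = pCons 0 p'"
    using assms(1) by (metis pCons_cases coeff_pCons_0)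
  have "p = monom 1 1 * p'"
    by (simp add: p' monom_Suc monom_0)
  then have pow: "p ^ r = monom 1 r * p' ^ r" for r
    by (simp add: power_mult_distrib monom_power)
  have "coeff (p ^ r) 1 = (if r = 1 then coeff p 1 else 0)" for r
  proof (cases "r = 0 \<or> r = 1")
    case False
    then show ?thesis unfolding pow by (simp add: coeff_monom_mult)
  qed auto
  then have "coeff (exp_poly q p) 1 = (\<Sum>r\<le>q. if r = 1 then coeff p 1 else 0)"
    unfolding exp_poly_def coeff_sum by (intro sum.cong) auto
  then show ?thesis using assms(2) by simp
qed

lemma exp_poly_expansion:
  "coeff p 0 = 0 \<Longrightarrow> (\<lambda>h. exp (poly p h) - poly (exp_poly q p) h) \<in> o[at_right 0](\<lambda>h. h ^ q)"
  using exp_expansion[of "poly p" p q] by simp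

lemma smallo_mult_expansion:
  fixes f g :: "real \<Rightarrow> real"
  assumes f: "(\<lambda>h. f h - poly p h) \<in> o[at_right 0](\<lambda>h. h ^ q)"
    and g: "(\<lambda>h. g h - poly p' h) \<in> o[at_right 0](\<lambda>h. h ^ q)"
  shows "(\<lambda>h. f h * g h - poly (p * p') h) \<in> o[at_right 0](\<lambda>h. h ^ q)"
proof -
  have "((\<lambda>h. f h - poly p h) \<longlongrightarrow> 0) (at_right 0)"
    using smallo_power_tendsto_0[OF f, of 0] by simp
  then have "((\<lambda>h. (f h - poly p h) + poly p h) \<longlongrightarrow> 0 + poly p 0) (at_right 0)"
    by (intro tendsto_intros)
  then have "f \<in> O[at_right 0](\<lambda>_. 1)"
    by (intro bigoI_tendsto[of _ _ "poly p 0"]) auto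
  from landau_o.big_small_mult[OF this g]
  have 1: "(\<lambda>h. f h * (g h - poly p' h)) \<in> o[at_right 0](\<lambda>h. h ^ q)" by simp
  from landau_o.big_small_mult[OF poly_bigo_1[of p'] f]
  have 2: "(\<lambda>h. poly p' h * (f h - poly p h)) \<in> o[at_right 0](\<lambda>h. h ^ q)" by simp
  from sum_in_smallo(1)[OF 1 2] show ?thesis by (simp add: algebra_simps)
qed

lemma integrable_power_diff_const:
  fixes Z :: "'a \<Rightarrow> real"
  assumes "\<And>i. i \<le> j \<Longrightarrow> integrable N (\<lambda>y. Z y ^ i)"
  shows "integrable N (\<lambda>y. (Z y - m) ^ j)"
proof -
  have "(Z y - m) ^ j = (\<Sum>i\<le>j. of_nat (j choose i) * (- m) ^ (j - i) * Z y ^ i)" for y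
    using binomial_ring[of "Z y" "- m" j] by (simp add: mult_ac)
  then show ?thesis
    using assms by (auto intro!: Bochner_Integration.integrable_sum integrable_mult_right)
qed

text \<open>Centring multiplies the transform by exp (m h), and since \<open>m\<close> is the linear
  coefficient of \<open>\<kappa>\<close> this deletes exactly that term from the exponent. The
  centred variable takes both signs, so the Laplace criterion is applied to \<open>Z\<close> only;
  the binomial formula links the raw and central moments.\<close>

lemma central_moments_of_cumulant_expansion:
  fixes Z :: "'a \<Rightarrow> real"
  assumes N: "prob_space N" and Z: "Z \<in> borel_measurable N" and nn: "\<And>y. y \<in> space N \<Longrightarrow> 0 \<le> Z y"
    and f: "(\<lambda>h. f h - poly \<kappa> h) \<in> o[at_right 0](\<lambda>h. h ^ q)" and \<kappa>: "coeff \<kappa> 0 = 0" and q: "1 \<le> q"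
    and L: "\<And>h. 0 < h \<Longrightarrow> (\<integral>y. exp (- (h * Z y)) \<partial>N) = exp (- f h)"
    and j: "j \<le> q"
  shows "integrable N (\<lambda>y. Z y ^ j)" (is ?int)
    and "(\<integral>y. Z y ^ j \<partial>N) = (- 1) ^ j * fact j * coeff (exp_poly q (- \<kappa>)) j" (is ?raw)
    and "integrable N (\<lambda>y. (Z y - (\<integral>y. Z y \<partial>N)) ^ j)" (is ?cint)
    and "(\<integral>y. (Z y - (\<integral>y. Z y \<partial>N)) ^ j \<partial>N)
      = (- 1) ^ j * fact j * coeff (exp_poly q (- (\<kappa> - monom (coeff \<kappa> 1) 1))) j" (is ?central)
proof -
  have "(\<lambda>h. - f h - poly (- \<kappa>) h) \<in> o[at_right 0](\<lambda>h. h ^ q)"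
    using landau_o.small.uminus_in_iff[THEN iffD2, OF f] by simp
  then have "(\<lambda>h. exp (- f h) - poly (exp_poly q (- \<kappa>)) h) \<in> o[at_right 0](\<lambda>h. h ^ q)"
    using \<kappa> by (intro exp_expansion) simp_all
  moreover have "\<forall>\<^sub>F h in at_right 0. exp (- f h) - poly (exp_poly q (- \<kappa>)) h
      = (\<integral>y. exp (- (h * Z y)) \<partial>N) - poly (exp_poly q (- \<kappa>)) h"
    using eventually_at_right_0_pos by eventually_elim (simp add: L)
  ultimately have Lexp: "(\<lambda>h. (\<integral>y. exp (- (h * Z y)) \<partial>N) - poly (exp_poly q (- \<kappa>)) h) \<in> o[at_right 0](\<lambda>h. h ^ q)"
    by (simp add: landau_o.small.in_cong)
  note mom = moments_of_laplace_expansion[OF N Z nn Lexp]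
  have int: "integrable N (\<lambda>y. Z y ^ i)" if "i \<le> q" for i
    using mom[OF _ that] by simp
  have raw: "coeff (exp_poly q (- \<kappa>)) i = (- 1) ^ i * (\<integral>y. Z y ^ i \<partial>N) / fact i" if "i \<le> q" for i
    using mom[OF _ that] by simp
  show ?int using int[OF j] .
  show ?raw
    using raw[OF j] by (simp add: power_mult_distrib[symmetric] mult.assoc[symmetric])
  define m where "m = (\<integral>y. Z y \<partial>N)"
  have m: "m = coeff \<kappa> 1"
    using raw[OF q] coeff_exp_poly_1[of "- \<kappa>" q] \<kappa> q by (simp add: m_def)
  have binom: "(Z y - m) ^ j = (\<Sum>i\<le>j. of_nat (j choose i) * (- m) ^ (j - i) * Z y ^ i)" for y
    using binomial_ring[of "Z y" "- m" j] by (simp add: mult_ac)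
  show ?cint
    using int j by (intro integrable_power_diff_const) auto
  have central: "(\<integral>y. (Z y - m) ^ j \<partial>N) = (\<Sum>i\<le>j. of_nat (j choose i) * (- m) ^ (j - i) * (\<integral>y. Z y ^ i \<partial>N))"
    unfolding binom using int j by (subst Bochner_Integration.integral_sum) auto
  have "(\<lambda>h. exp (poly (monom m 1) h) - poly (exp_poly q (monom m 1)) h) \<in> o[at_right 0](\<lambda>h. h ^ q)"
    by (rule exp_poly_expansion) simp
  from smallo_mult_expansion[OF this exp_expansion[of "\<lambda>h. - f h" "- \<kappa>" q]]
  have 1: "(\<lambda>h. exp (m * h - f h) - poly (exp_poly q (monom m 1) * exp_poly q (- \<kappa>)) h) \<in> o[at_right 0](\<lambda>h. h ^ q)"
    using \<open>(\<lambda>h. - f h - poly (- \<kappa>) h) \<in> _\<close> \<kappa> by (simp add: poly_monom exp_add[symmetric])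
  have 2: "(\<lambda>h. exp (m * h - f h) - poly (exp_poly q (- (\<kappa> - monom m 1))) h) \<in> o[at_right 0](\<lambda>h. h ^ q)"
    using \<open>(\<lambda>h. - f h - poly (- \<kappa>) h) \<in> _\<close> \<kappa> by (intro exp_expansion) (simp_all add: poly_monom algebra_simps)
  \<comment> \<open>The same function exp (m h - f h) is expanded once as a product and once from
    the centred exponent; uniqueness equates the coefficients up to order \<open>q\<close>.\<close>
  from sum_in_smallo(2)[OF 2 1]
  have "(\<lambda>h. poly (exp_poly q (monom m 1) * exp_poly q (- \<kappa>)) h - poly (exp_poly q (- (\<kappa> - monom m 1))) h)
      \<in> o[at_right 0](\<lambda>h. h ^ q)"
    by simp
  from poly_coeff_unique[OF this j]
  have "coeff (exp_poly q (- (\<kappa> - monom m 1))) j = coeff (exp_poly q (monom m 1) * exp_poly q (- \<kappa>)) j"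
    by simp
  also have "\<dots> = (\<Sum>i\<le>j. coeff (exp_poly q (- \<kappa>)) i * coeff (exp_poly q (monom m 1)) (j - i))"
    by (subst mult.commute) (rule coeff_mult)
  also have "\<dots> = (\<Sum>i\<le>j. ((- 1) ^ i * (\<integral>y. Z y ^ i \<partial>N) / fact i) * (m ^ (j - i) / fact (j - i)))"
  proof (intro sum.cong refl)
    fix i assume "i \<in> {..j}"
    have "coeff (exp_poly q (monom m 1)) n = m ^ n / fact n" if "n \<le> q" for n
    proof -
      have "coeff (exp_poly q (monom m 1)) n = (\<Sum>r\<le>q. if r = n then m ^ n / fact n else 0)"
        unfolding exp_poly_def coeff_sum by (intro sum.cong) (auto simp: monom_power)
      then show ?thesis using that by simp
    qed
    then show "coeff (exp_poly q (- \<kappa>)) i * coeff (exp_poly q (monom m 1)) (j - i)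
      = ((- 1) ^ i * (\<integral>y. Z y ^ i \<partial>N) / fact i) * (m ^ (j - i) / fact (j - i))"
      using raw[of i] \<open>i \<in> {..j}\<close> j by simp
  qed
  also have "(- 1) ^ j * fact j * \<dots> = (\<Sum>i\<le>j. of_nat (j choose i) * (- m) ^ (j - i) * (\<integral>y. Z y ^ i \<partial>N))"
    unfolding sum_distrib_left
  proof (intro sum.cong refl)
    fix i assume "i \<in> {..j}"
    then have i: "i \<le> j" by simp
    have "(- 1 :: real) ^ j = (- 1) ^ (j - i) * (- 1) ^ i"
      using i by (simp add: power_add[symmetric])
    then have "(- 1 :: real) ^ j * (- 1) ^ i = (- 1) ^ (j - i)"
      by (simp add: mult.assoc power_mult_distrib[symmetric])
    moreover have "(fact j :: real) / (fact i * fact (j - i)) = of_nat (j choose i)"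
      using binomial_fact[OF i, where ?'a = real] by simp
    moreover have "(- m) ^ (j - i) = (- 1) ^ (j - i) * m ^ (j - i)"
      by (rule power_minus)
    ultimately show "(- 1) ^ j * fact j * (((- 1) ^ i * (\<integral>y. Z y ^ i \<partial>N) / fact i) * (m ^ (j - i) / fact (j - i)))
      = of_nat (j choose i) * (- m) ^ (j - i) * (\<integral>y. Z y ^ i \<partial>N)"
      by (simp add: field_simps)
  qed
  finally show ?central
    unfolding m_def[symmetric] central m[symmetric] by simp
qed

subsection \<open>Polynomial dependence on the starting point\<close>

lemma polynomial_of_degree_at_mostE:
  assumes "polynomial_of_degree_at_most n p"
  obtains a where "p = (\<lambda>x. \<Sum>\<alpha>\<in>multi_indices n. a \<alpha> * (\<Prod>j\<in>UNIV. (x $ j) ^ \<alpha> j))"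
  using assms by (auto simp: polynomial_of_degree_at_most_def fun_eq_iff)

lemma polynomial_of_degree_at_most_monomial:
  assumes "(\<Sum>j\<in>UNIV. \<alpha> j) \<le> n"
  shows "polynomial_of_degree_at_most n (\<lambda>x :: real ^ 'd::finite. \<Prod>j\<in>UNIV. (x $ j) ^ \<alpha> j)"
  unfolding polynomial_of_degree_at_most_def
proof (intro exI allI)
  fix x :: "real ^ 'd"
  have "\<alpha> \<in> multi_indices n"
    using assms by (simp add: multi_indices_def)
  then show "(\<Prod>j\<in>UNIV. (x $ j) ^ \<alpha> j) = (\<Sum>\<alpha>'\<in>multi_indices n. (if \<alpha>' = \<alpha> then 1 else 0) * (\<Prod>j\<in>UNIV. (x $ j) ^ \<alpha>' j))"
    by (simp add: if_distrib[of "\<lambda>c. c * _"] finite_multi_indices cong: if_cong)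
qed

lemma polynomial_of_degree_at_most_add:
  assumes "polynomial_of_degree_at_most n p" "polynomial_of_degree_at_most n p'"
  shows "polynomial_of_degree_at_most n (\<lambda>x. p x + p' x)"
proof -
  obtain a where p: "p = (\<lambda>x. \<Sum>\<alpha>\<in>multi_indices n. a \<alpha> * (\<Prod>j\<in>UNIV. (x $ j) ^ \<alpha> j))"
    by (rule polynomial_of_degree_at_mostE[OF assms(1)])
  obtain a' where p': "p' = (\<lambda>x. \<Sum>\<alpha>\<in>multi_indices n. a' \<alpha> * (\<Prod>j\<in>UNIV. (x $ j) ^ \<alpha> j))"
    by (rule polynomial_of_degree_at_mostE[OF assms(2)])
  show ?thesis
    unfolding polynomial_of_degree_at_most_def p p'
    by (intro exI[of _ "\<lambda>\<alpha>. a \<alpha> + a' \<alpha>"]) (simp add: sum.distrib distrib_right)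
qed

lemma polynomial_of_degree_at_most_cmult:
  assumes "polynomial_of_degree_at_most n p"
  shows "polynomial_of_degree_at_most n (\<lambda>x. c * p x)"
proof -
  obtain a where p: "p = (\<lambda>x. \<Sum>\<alpha>\<in>multi_indices n. a \<alpha> * (\<Prod>j\<in>UNIV. (x $ j) ^ \<alpha> j))"
    by (rule polynomial_of_degree_at_mostE[OF assms])
  show ?thesis
    unfolding polynomial_of_degree_at_most_def p
    by (intro exI[of _ "\<lambda>\<alpha>. c * a \<alpha>"]) (simp add: sum_distrib_left mult.assoc)
qed

lemma polynomial_of_degree_at_most_const:
  "polynomial_of_degree_at_most n (\<lambda>_ :: real ^ 'd::finite. c)"
  using polynomial_of_degree_at_most_cmult[OF polynomial_of_degree_at_most_monomial[of "\<lambda>_ :: 'd. 0" n], of c]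
  by simp

lemma polynomial_of_degree_at_most_sum:
  "(\<And>i. i \<in> I \<Longrightarrow> polynomial_of_degree_at_most n (p i)) \<Longrightarrow>
    polynomial_of_degree_at_most n (\<lambda>x. \<Sum>i\<in>I. p i x)"
  by (induction I rule: infinite_finite_induct)
    (simp_all add: polynomial_of_degree_at_most_const polynomial_of_degree_at_most_add)

lemma polynomial_of_degree_at_most_component:
  assumes "1 \<le> n"
  shows "polynomial_of_degree_at_most n (\<lambda>x :: real ^ 'd::finite. x $ i)"
proof -
  have "polynomial_of_degree_at_most n (\<lambda>x :: real ^ 'd. \<Prod>j\<in>UNIV. (x $ j) ^ (if j = i then 1 else 0))"
    using assms by (intro polynomial_of_degree_at_most_monomial) simp
  moreover have "(\<Prod>j\<in>UNIV. (x $ j) ^ (if j = i then 1 else 0)) = x $ i" for x :: "real ^ 'd"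
    by (simp add: if_distrib[of "\<lambda>n. _ ^ n"] cong: if_cong)
  ultimately show ?thesis by simp
qed

lemma polynomial_of_degree_at_most_mult:
  assumes p: "polynomial_of_degree_at_most m p" and p': "polynomial_of_degree_at_most m' p'"
    and n: "m + m' \<le> n"
  shows "polynomial_of_degree_at_most n (\<lambda>x :: real ^ 'd::finite. p x * p' x)"
proof -
  obtain a where pa: "p = (\<lambda>x. \<Sum>\<alpha>\<in>multi_indices m. a \<alpha> * (\<Prod>j\<in>UNIV. (x $ j) ^ \<alpha> j))"
    by (rule polynomial_of_degree_at_mostE[OF p])
  obtain a' where pa': "p' = (\<lambda>x. \<Sum>\<alpha>\<in>multi_indices m'. a' \<alpha> * (\<Prod>j\<in>UNIV. (x $ j) ^ \<alpha> j))"
    by (rule polynomial_of_degree_at_mostE[OF p'])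
  have "(\<lambda>x. p x * p' x) = (\<lambda>x. \<Sum>\<alpha>\<in>multi_indices m. \<Sum>\<alpha>'\<in>multi_indices m'.
      (a \<alpha> * a' \<alpha>') * (\<Prod>j\<in>UNIV. (x $ j) ^ (\<alpha> j + \<alpha>' j)))"
    by (simp only: pa pa' sum_product power_add prod.distrib) (simp only: mult_ac)
  then show ?thesis
    using n by (auto intro!: polynomial_of_degree_at_most_sum polynomial_of_degree_at_most_cmult
        polynomial_of_degree_at_most_monomial simp: multi_indices_def sum.distrib)
qed

lemma polynomial_of_degree_at_most_measurable:
  "polynomial_of_degree_at_most n p \<Longrightarrow> p \<in> borel_measurable borel"
  by (erule polynomial_of_degree_at_mostE) simp

lemma polynomial_of_degree_at_most_integrable:
  fixes Y :: "'a \<Rightarrow> real ^ 'd::finite"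
  assumes p: "polynomial_of_degree_at_most n p" and n: "n \<le> q" and M: "prob_space M"
    and Y: "Y \<in> borel_measurable M" and int: "integrable M (\<lambda>\<omega>. norm (Y \<omega>) ^ q)"
  shows "integrable M (\<lambda>\<omega>. p (Y \<omega>))"
proof -
  interpret prob_space M by (rule M)
  obtain a where a: "p = (\<lambda>x. \<Sum>\<alpha>\<in>multi_indices n. a \<alpha> * (\<Prod>j\<in>UNIV. (x $ j) ^ \<alpha> j))"
    by (rule polynomial_of_degree_at_mostE[OF p])
  have "integrable M (\<lambda>\<omega>. \<Prod>j\<in>UNIV. (Y \<omega> $ j) ^ \<alpha> j)" if "\<alpha> \<in> multi_indices n" for \<alpha>
  proof (rule Bochner_Integration.integrable_bound)
    \<comment> \<open>One majorant covers all monomials of degree at most \<open>q\<close>: the 1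
      serves norms below one, the power \<open>q\<close> the others.\<close>
    show "integrable M (\<lambda>\<omega>. 1 + norm (Y \<omega>) ^ q)"
      using int by simp
    show "(\<lambda>\<omega>. \<Prod>j\<in>UNIV. (Y \<omega> $ j) ^ \<alpha> j) \<in> borel_measurable M"
      by (rule measurable_compose[OF Y, where g = "\<lambda>x. \<Prod>j\<in>UNIV. (x $ j) ^ \<alpha> j"]) simp
    have "\<bar>\<Prod>j\<in>UNIV. (x $ j) ^ \<alpha> j\<bar> \<le> 1 + norm x ^ q" for x :: "real ^ 'd"
    proof -
      have "\<bar>\<Prod>j\<in>UNIV. (x $ j) ^ \<alpha> j\<bar> \<le> (\<Prod>j\<in>UNIV. norm x ^ \<alpha> j)"
        unfolding abs_prod power_abs by (intro prod_mono conjI power_mono component_le_norm_cart) auto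
      also have "\<dots> = norm x ^ (\<Sum>j\<in>UNIV. \<alpha> j)"
        by (simp add: power_sum)
      also have "\<dots> \<le> 1 + norm x ^ q"
      proof (cases "norm x \<le> 1")
        case True
        then show ?thesis by (intro order_trans[OF power_le_one]) auto
      next
        case False
        then have "norm x ^ (\<Sum>j\<in>UNIV. \<alpha> j) \<le> norm x ^ q"
          using that n by (intro power_increasing) (auto simp: multi_indices_def)
        then show ?thesis by simp
      qed
      finally show ?thesis .
    qed
    then show "AE \<omega> in M. norm (\<Prod>j\<in>UNIV. (Y \<omega> $ j) ^ \<alpha> j) \<le> norm (1 + norm (Y \<omega>) ^ q)"
      by (simp add: abs_of_nonneg)
  qed
  then show ?thesis
    unfolding a by (intro Bochner_Integration.integrable_sum integrable_mult_right)
qed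

text \<open>With \<open>g = 2\<close> the grading records the bound on the degree of central moments, with \<open>g = 1\<close> that of
  the moments themselves.\<close>

definition graded :: "nat \<Rightarrow> (real ^ 'd::finite \<Rightarrow> real poly) \<Rightarrow> bool" where
  "graded g P \<longleftrightarrow> (\<forall>k. polynomial_of_degree_at_most (k div g) (\<lambda>x. coeff (P x) k))"

lemma graded_mult:
  assumes "graded g P" "graded g P'"
  shows "graded g (\<lambda>x. P x * P' x)"
  unfolding graded_def
proof
  fix k
  \<comment> \<open>Integer division is superadditive, so the degree bounds of two factors fit into
    that of the product.\<close>
  have "i div g + (k - i) div g \<le> k div g" if "i \<le> k" for i
    using div_add1_eq[of i "k - i" g] that by simp
  then show "polynomial_of_degree_at_most (k div g) (\<lambda>x. coeff (P x * P' x) k)"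
    using assms unfolding coeff_mult graded_def
    by (intro polynomial_of_degree_at_most_sum polynomial_of_degree_at_most_mult) auto
qed

lemma graded_exp_poly:
  assumes "graded g P"
  shows "graded g (\<lambda>x. exp_poly q (P x))"
proof -
  have "graded g (\<lambda>x. P x ^ r)" for r
  proof (induction r)
    case 0
    then show ?case by (simp add: graded_def polynomial_of_degree_at_most_const)
  next
    case (Suc r)
    then show ?case using graded_mult[OF assms] by simp
  qed
  then show ?thesis
    unfolding graded_def exp_poly_def coeff_sum coeff_smult
    by (intro allI polynomial_of_degree_at_most_sum polynomial_of_degree_at_most_cmult) auto
qed

text \<open>The expansion of minus the logarithm of the Laplace transform: the coefficient of h^k is
  the cumulant of order k times (-1)^(k+1) / k!. Prepending 0 multiplies by \<open>h\<close> and so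
  undoes the division by \<open>h\<close> in \<open>dirflow\<close>.\<close>

definition cumulant_poly :: "real poly \<Rightarrow> ('d \<Rightarrow> real poly) \<Rightarrow> real ^ 'd::finite \<Rightarrow> real poly" where
  "cumulant_poly p\<^sub>0 p x = pCons 0 (p\<^sub>0 + (\<Sum>i\<in>UNIV. smult (x $ i) (p i)))"

lemma coeff_cumulant_poly:
  "coeff (cumulant_poly p\<^sub>0 p x) 0 = 0"
  "coeff (cumulant_poly p\<^sub>0 p x) (Suc k) = coeff p\<^sub>0 k + (\<Sum>i\<in>UNIV. coeff (p i) k * x $ i)"
  by (simp_all add: cumulant_poly_def coeff_sum mult.commute)

lemma cumulant_coeff_affine:
  assumes "1 \<le> n"
  shows "polynomial_of_degree_at_most n (\<lambda>x :: real ^ 'd::finite. - coeff (cumulant_poly p\<^sub>0 p x) (Suc k))"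
proof -
  have "polynomial_of_degree_at_most n (\<lambda>x :: real ^ 'd. (- 1) * (coeff p\<^sub>0 k + (\<Sum>i\<in>UNIV. coeff (p i) k * x $ i)))"
    by (intro polynomial_of_degree_at_most_cmult polynomial_of_degree_at_most_add polynomial_of_degree_at_most_sum
        polynomial_of_degree_at_most_component polynomial_of_degree_at_most_const assms)
  then show ?thesis by (simp add: coeff_cumulant_poly)
qed

lemma graded_cumulant_poly: "graded 1 (\<lambda>x :: real ^ 'd::finite. - cumulant_poly p\<^sub>0 p x)"
  unfolding graded_def
proof
  fix k
  show "polynomial_of_degree_at_most (k div 1) (\<lambda>x :: real ^ 'd. coeff (- cumulant_poly p\<^sub>0 p x) k)"
    using cumulant_coeff_affine[of k p\<^sub>0 p "k - 1"]
    by (cases k) (simp_all add: coeff_cumulant_poly(1) polynomial_of_degree_at_most_const)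
qed

text \<open>Here the exponent \<open>k div 2\<close> originates. Once the linear term is gone,
  orders 0 and 1 vanish, and from order 2 on \<open>k div 2 \<ge> 1\<close> leaves room for an
  affine coefficient.\<close>

lemma graded_centered_cumulant_poly:
  "graded 2 (\<lambda>x :: real ^ 'd::finite. - (cumulant_poly p\<^sub>0 p x - monom (coeff (cumulant_poly p\<^sub>0 p x) 1) 1))"
  unfolding graded_def
proof
  fix k
  consider "k = 0" | "k = 1" | k' where "k = Suc (Suc k')"
    by (metis One_nat_def not0_implies_Suc)
  then show "polynomial_of_degree_at_most (k div 2)
    (\<lambda>x :: real ^ 'd. coeff (- (cumulant_poly p\<^sub>0 p x - monom (coeff (cumulant_poly p\<^sub>0 p x) 1) 1)) k)"
  proof cases
    case 3
    then show ?thesis using cumulant_coeff_affine[of "k div 2" p\<^sub>0 p "Suc k'"] by simp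
  qed (simp_all add: coeff_cumulant_poly(1) polynomial_of_degree_at_most_const)
qed

text \<open>Both sides come from the coefficient of X^n, with n = \<open>card J\<close>, in the
  product over \<open>J\<close> of exp (a j X) - 1. Each factor is divisible by X, so this
  coefficient is the product of the \<open>a j\<close>; expanding over subsets gives the alternating
  sum.\<close>

lemma polarization:
  fixes a :: "'a \<Rightarrow> real"
  assumes J: "finite J"
  shows "fact (card J) * (\<Prod>j\<in>J. a j) = (\<Sum>S\<in>Pow J. (- 1) ^ card (J - S) * (\<Sum>j\<in>S. a j) ^ card J)"
proof -
  define G where "G c = Abs_fps (\<lambda>n. c ^ Suc n / fact (Suc n))" for c :: real
  have G: "fps_exp c + (- 1) = fps_X * G c" for c
  proof (rule fps_ext)
    fix n show "fps_nth (fps_exp c + (- 1)) n = fps_nth (fps_X * G c) n"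
      by (cases n) (simp_all add: G_def distrib_right)
  qed
  have "(\<Prod>j\<in>J. fps_exp (a j) + (- 1)) = fps_X ^ card J * (\<Prod>j\<in>J. G (a j))"
    by (simp only: G prod.distrib prod_constant)
  then have "fps_nth (\<Prod>j\<in>J. fps_exp (a j) + (- 1)) (card J) = fps_nth (\<Prod>j\<in>J. G (a j)) 0"
    by (simp only: fps_X_power_mult_nth) simp
  also have "\<dots> = (\<Prod>j\<in>J. a j)"
    using J by (induction J rule: finite_induct) (simp_all add: G_def)
  finally have "(\<Prod>j\<in>J. a j) = fps_nth (\<Sum>S\<in>Pow J. (\<Prod>j\<in>S. fps_exp (a j)) * (\<Prod>j\<in>J - S. - 1)) (card J)"
    by (simp only: prod_add[OF J])
  also have "\<dots> = (\<Sum>S\<in>Pow J. (- 1) ^ card (J - S) * (\<Sum>j\<in>S. a j) ^ card J / fact (card J))"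
    unfolding fps_sum_nth
  proof (intro sum.cong refl)
    fix S assume "S \<in> Pow J"
    then have "finite S" using J finite_subset by auto
    then have S: "(\<Prod>j\<in>S. fps_exp (a j)) = fps_exp (\<Sum>j\<in>S. a j)"
      by (induction S rule: finite_induct) (simp_all add: fps_exp_add_mult)
    have neg: "(\<Prod>j\<in>J - S. - 1 :: real fps) = fps_const ((- 1) ^ card (J - S))"
      by (simp add: fps_const_power[symmetric] fps_const_neg[symmetric] del: fps_const_power fps_const_neg)
    show "fps_nth ((\<Prod>j\<in>S. fps_exp (a j)) * (\<Prod>j\<in>J - S. - 1)) (card J)
      = (- 1) ^ card (J - S) * (\<Sum>j\<in>S. a j) ^ card J / fact (card J)"
      unfolding S neg fps_mult_right_const_nth fps_exp_nth by simp
  qed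
  finally show ?thesis
    by (simp add: sum_divide_distrib[symmetric])
qed

text \<open>\<open>p\<^sub>0\<close> comes from immigration and \<open>p i\<close> from the
  component \<open>i\<close> of the flow. Neither involves \<open>x\<close>, so one choice serves
  all starting points.\<close>

lemma cumulant_expansion:
  fixes c \<beta> :: "real ^ 'd::finite"
  assumes adm: "admissible c \<beta> B \<nu> \<mu>" and flow: "cbi_flow c B \<mu> v" and q: "1 \<le> q"
    and nu_tail: "set_integrable \<nu> {z. 1 \<le> norm z} (\<lambda>z. norm z ^ q)"
    and mu_tail: "\<And>i. set_integrable (\<mu> i) {z. 1 \<le> norm z} (\<lambda>z. norm z ^ q)"
    and t: "0 \<le> t" and u: "u \<in> orthant"
  obtains p\<^sub>0 p where "\<And>x. (\<lambda>h. (x \<bullet> v t (h *\<^sub>R u) + integral {0..t} (\<lambda>s. immigration_mechanism \<beta> \<nu> (v s (h *\<^sub>R u))))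
      - poly (cumulant_poly p\<^sub>0 p x) h) \<in> o[at_right 0](\<lambda>h. h ^ q)"
proof -
  let ?\<Psi> = "\<lambda>h. integral {0..t} (\<lambda>s. immigration_mechanism \<beta> \<nu> (v s (h *\<^sub>R u)))"
  note as = adm flow q nu_tail mu_tail t u
  have "\<exists>p. (\<lambda>h. dirflow v u h t $ i - poly p h) \<in> o[at_right 0](\<lambda>h. h ^ (q - 1))" for i
    using uexp_imp_poly[OF uexp_dirflow_order[OF as order_refl]] t by simp
  then obtain p where p: "\<And>i. (\<lambda>h. dirflow v u h t $ i - poly (p i) h) \<in> o[at_right 0](\<lambda>h. h ^ (q - 1))"
    by metis
  obtain p\<^sub>0 where p\<^sub>0: "(\<lambda>h. ?\<Psi> h / h - poly p\<^sub>0 h) \<in> o[at_right 0](\<lambda>h. h ^ (q - 1))"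
    using uexp_imp_poly[OF uexp_immigration[OF as], of t] t by auto
  have "(\<lambda>h. (x \<bullet> v t (h *\<^sub>R u) + ?\<Psi> h) - poly (cumulant_poly p\<^sub>0 p x) h) \<in> o[at_right 0](\<lambda>h. h ^ q)" for x
  proof -
    have "(\<lambda>h. x $ i * (dirflow v u h t $ i - poly (p i) h)) \<in> o[at_right 0](\<lambda>h. h ^ (q - 1))" for i
      using p[of i] by simp
    then have "(\<lambda>h. (\<Sum>i\<in>UNIV. x $ i * (dirflow v u h t $ i - poly (p i) h)) + (?\<Psi> h / h - poly p\<^sub>0 h))
        \<in> o[at_right 0](\<lambda>h. h ^ (q - 1))"
      by (intro sum_in_smallo(1) p\<^sub>0 big_sum_in_smallo)
    then have "(\<lambda>h. h * ((\<Sum>i\<in>UNIV. x $ i * (dirflow v u h t $ i - poly (p i) h)) + (?\<Psi> h / h - poly p\<^sub>0 h)))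
        \<in> o[at_right 0](\<lambda>h. h * h ^ (q - 1))"
      by (intro landau_o.big_small_mult) auto
    moreover have "h * h ^ (q - 1) = h ^ q" for h :: real
      using q by (metis One_nat_def Suc_pred less_eq_Suc_le power_Suc)
    moreover have "\<forall>\<^sub>F h in at_right 0. h * ((\<Sum>i\<in>UNIV. x $ i * (dirflow v u h t $ i - poly (p i) h)) + (?\<Psi> h / h - poly p\<^sub>0 h))
        = (x \<bullet> v t (h *\<^sub>R u) + ?\<Psi> h) - poly (cumulant_poly p\<^sub>0 p x) h"
      using eventually_at_right_0_pos
    proof eventually_elim
      case (elim h)
      have "x \<bullet> v t (h *\<^sub>R u) = h * (\<Sum>i\<in>UNIV. x $ i * dirflow v u h t $ i)"
        using elim by (simp add: dirflow_def inner_vec_def sum_distrib_left)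
      then show ?case
        using elim by (simp add: cumulant_poly_def poly_sum sum_subtractf algebra_simps)
    qed
    ultimately show ?thesis
      by (simp add: landau_o.small.in_cong)
  qed
  then show ?thesis using that by blast
qed

section \<open>Moments of the transition kernels\<close>

lemma cbi_kernel_prob:
  assumes "cbi_semigroup c \<beta> B \<nu> \<mu> K" "0 \<le> t" "x \<in> orthant"
  shows "prob_space (K t x)" "sets (K t x) = sets orthant_borel" "space (K t x) = orthant"
proof -
  have "K t \<in> orthant_borel \<rightarrow>\<^sub>M prob_algebra orthant_borel"
    using assms by (auto simp: cbi_semigroup_def transition_semigroup_def)
  moreover have "x \<in> space orthant_borel"
    using assms(3) by (simp add: space_restrict_space)
  ultimately have "K t x \<in> space (prob_algebra orthant_borel)"
    by (rule measurable_space)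
  then show "prob_space (K t x)" and s: "sets (K t x) = sets orthant_borel"
    by (simp_all add: space_prob_algebra)
  show "space (K t x) = orthant"
    using sets_eq_imp_space_eq[OF s] by (simp add: space_restrict_space)
qed

lemma cbi_kernel_measurable:
  assumes "cbi_semigroup c \<beta> B \<nu> \<mu> K" "0 \<le> t" "x \<in> orthant" "f \<in> borel_measurable borel"
  shows "f \<in> borel_measurable (K t x)"
  unfolding measurable_cong_sets[OF cbi_kernel_prob(2)[OF assms(1-3)] refl]
  by (rule measurable_restrict_space1[OF assms(4)])

lemma cbi_laplace:
  assumes adm: "admissible c \<beta> B \<nu> \<mu>" and flow: "cbi_flow c B \<mu> v" and K: "cbi_semigroup c \<beta> B \<nu> \<mu> K"
    and t: "0 \<le> t" and x: "x \<in> orthant" and l: "l \<in> orthant"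
  shows "(\<integral>y. exp (- (l \<bullet> y)) \<partial>K t x) = exp (- (x \<bullet> v t l + integral {0..t} (\<lambda>s. immigration_mechanism \<beta> \<nu> (v s l))))"
proof -
  obtain v' where v': "cbi_flow c B \<mu> v'"
    and L: "(\<integral>y. exp (- (l \<bullet> y)) \<partial>K t x) = exp (- (x \<bullet> v' t l) - integral {0..t} (\<lambda>s. immigration_mechanism \<beta> \<nu> (v' s l)))"
    using K t x l unfolding cbi_semigroup_def by blast
  have "v' s l = v s l" if "0 \<le> s" for s
    by (rule cbi_flow_unique[OF adm flow v' l that])
  moreover from this have "integral {0..t} (\<lambda>s. immigration_mechanism \<beta> \<nu> (v' s l)) = integral {0..t} (\<lambda>s. immigration_mechanism \<beta> \<nu> (v s l))"
    by (intro integral_cong) auto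
  ultimately show ?thesis using L t by simp
qed

text \<open>\<open>R\<close> controls the growth in \<open>x\<close> of the raw moments, which are
  later integrated over the law of the starting point; \<open>C\<close> carries the sharper degree
  bound. Both are chosen before the semigroup and the starting point.\<close>

lemma kernel_moments:
  fixes c \<beta> :: "real ^ 'd::finite"
  assumes adm: "admissible c \<beta> B \<nu> \<mu>" and q: "1 \<le> q"
    and nu_tail: "set_integrable \<nu> {z. 1 \<le> norm z} (\<lambda>z. norm z ^ q)"
    and mu_tail: "\<And>i. set_integrable (\<mu> i) {z. 1 \<le> norm z} (\<lambda>z. norm z ^ q)"
    and t: "0 \<le> t" and u: "u \<in> orthant" and j: "j \<le> q"
  shows "\<exists>R C. polynomial_of_degree_at_most j R \<and> polynomial_of_degree_at_most (j div 2) C \<and>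
    (\<forall>K x. cbi_semigroup c \<beta> B \<nu> \<mu> K \<longrightarrow> x \<in> orthant \<longrightarrow>
      integrable (K t x) (\<lambda>y. (u \<bullet> y) ^ j) \<and> (\<integral>y. (u \<bullet> y) ^ j \<partial>K t x) = R x \<and>
      integrable (K t x) (\<lambda>y. (u \<bullet> y - (\<integral>y. u \<bullet> y \<partial>K t x)) ^ j) \<and>
      (\<integral>y. (u \<bullet> y - (\<integral>y. u \<bullet> y \<partial>K t x)) ^ j \<partial>K t x) = C x)"
proof (cases "\<exists>v. cbi_flow c B \<mu> v")
  \<comment> \<open>Existence of the flow is not proved: without a flow there is no semigroup, and
    any polynomials do.\<close>
  case False
  then have "\<not> cbi_semigroup c \<beta> B \<nu> \<mu> K" for K
    by (auto simp: cbi_semigroup_def)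
  then show ?thesis
    using polynomial_of_degree_at_most_const by blast
next
  case True
  then obtain v where flow: "cbi_flow c B \<mu> v" by blast
  obtain p\<^sub>0 p where p: "\<And>x. (\<lambda>h. (x \<bullet> v t (h *\<^sub>R u) + integral {0..t} (\<lambda>s. immigration_mechanism \<beta> \<nu> (v s (h *\<^sub>R u))))
      - poly (cumulant_poly p\<^sub>0 p x) h) \<in> o[at_right 0](\<lambda>h. h ^ q)"
    by (rule cumulant_expansion[OF adm flow q nu_tail mu_tail t u]) (rule that)
  define R where "R x = (- 1) ^ j * fact j * coeff (exp_poly q (- cumulant_poly p\<^sub>0 p x)) j" for x
  define C where "C x = (- 1) ^ j * fact j *
    coeff (exp_poly q (- (cumulant_poly p\<^sub>0 p x - monom (coeff (cumulant_poly p\<^sub>0 p x) 1) 1))) j" for x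
  have "polynomial_of_degree_at_most j R"
    using graded_exp_poly[OF graded_cumulant_poly, of q p\<^sub>0 p] unfolding R_def graded_def
    by (intro polynomial_of_degree_at_most_cmult) (metis div_by_1)
  moreover have "polynomial_of_degree_at_most (j div 2) C"
    using graded_exp_poly[OF graded_centered_cumulant_poly, of q p\<^sub>0 p] unfolding C_def graded_def
    by (intro polynomial_of_degree_at_most_cmult) blast
  moreover have "integrable (K t x) (\<lambda>y. (u \<bullet> y) ^ j) \<and> (\<integral>y. (u \<bullet> y) ^ j \<partial>K t x) = R x \<and>
      integrable (K t x) (\<lambda>y. (u \<bullet> y - (\<integral>y. u \<bullet> y \<partial>K t x)) ^ j) \<and>
      (\<integral>y. (u \<bullet> y - (\<integral>y. u \<bullet> y \<partial>K t x)) ^ j \<partial>K t x) = C x"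
    if K: "cbi_semigroup c \<beta> B \<nu> \<mu> K" and x: "x \<in> orthant" for K x
  proof -
    have m: "(\<lambda>y. u \<bullet> y) \<in> borel_measurable (K t x)"
      by (intro cbi_kernel_measurable[OF K t x]) simp
    have nn: "0 \<le> u \<bullet> y" if "y \<in> space (K t x)" for y
      using that u by (intro orthant_inner_nonneg) (simp_all add: cbi_kernel_prob(3)[OF K t x])
    have L: "(\<integral>y. exp (- (h * (u \<bullet> y))) \<partial>K t x)
        = exp (- (x \<bullet> v t (h *\<^sub>R u) + integral {0..t} (\<lambda>s. immigration_mechanism \<beta> \<nu> (v s (h *\<^sub>R u)))))" if "0 < h" for h
      using cbi_laplace[OF adm flow K t x orthant_scaleR[OF u, of h]] that by simp
    note moments = central_moments_of_cumulant_expansion[OF cbi_kernel_prob(1)[OF K t x] m nn p coeff_cumulant_poly(1) q L j]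
    show ?thesis
      using moments unfolding R_def C_def by blast
  qed
  ultimately show ?thesis by blast
qed

lemma inner_sum_axis:
  fixes y :: "real ^ 'd::finite"
  shows "(\<Sum>j\<in>S. axis (i j) 1) \<bullet> y = (\<Sum>j\<in>S. y $ i j)"
  by (simp add: inner_sum_left inner_axis')

lemma sum_axis_orthant: "(\<Sum>j\<in>S. axis (i j) 1) \<in> orthant"
  by (auto simp: orthant_def sum_component axis_def intro!: sum_nonneg)

text \<open>Polarization by subset sums, rather than by signs, keeps every direction
  \<open>u S\<close> in the orthant, where the Laplace transform is given.\<close>

lemma kernel_central_moments:
  fixes c \<beta> :: "real ^ 'd::finite" and i :: "nat \<Rightarrow> 'd"
  assumes adm: "admissible c \<beta> B \<nu> \<mu>" and q: "1 \<le> q"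
    and nu_tail: "set_integrable \<nu> {z. 1 \<le> norm z} (\<lambda>z. norm z ^ q)"
    and mu_tail: "\<And>i. set_integrable (\<mu> i) {z. 1 \<le> norm z} (\<lambda>z. norm z ^ q)"
    and t: "0 \<le> t" and k: "k \<le> q"
  shows "\<exists>P. polynomial_of_degree_at_most (k div 2) P \<and>
    (\<forall>K x. cbi_semigroup c \<beta> B \<nu> \<mu> K \<longrightarrow> x \<in> orthant \<longrightarrow>
      (\<integral>y. (\<Prod>j\<in>{1..k}. (y $ i j - (\<integral>y. y $ i j \<partial>K t x))) \<partial>K t x) = P x)"
proof -
  define u :: "nat set \<Rightarrow> real ^ 'd" where "u S = (\<Sum>j\<in>S. axis (i j) 1)" for S
  have "\<exists>C. polynomial_of_degree_at_most (k div 2) C \<and>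
    (\<forall>K x. cbi_semigroup c \<beta> B \<nu> \<mu> K \<longrightarrow> x \<in> orthant \<longrightarrow>
      integrable (K t x) (\<lambda>y. (u S \<bullet> y - (\<integral>y. u S \<bullet> y \<partial>K t x)) ^ k) \<and>
      (\<integral>y. (u S \<bullet> y - (\<integral>y. u S \<bullet> y \<partial>K t x)) ^ k \<partial>K t x) = C x)" for S
    using kernel_moments[OF adm q nu_tail mu_tail t _ k, of "u S"] sum_axis_orthant unfolding u_def by blast
  then obtain C where C: "\<And>S. polynomial_of_degree_at_most (k div 2) (C S)"
    and CK: "\<And>S K x. cbi_semigroup c \<beta> B \<nu> \<mu> K \<Longrightarrow> x \<in> orthant \<Longrightarrow>
      integrable (K t x) (\<lambda>y. (u S \<bullet> y - (\<integral>y. u S \<bullet> y \<partial>K t x)) ^ k) \<and>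
      (\<integral>y. (u S \<bullet> y - (\<integral>y. u S \<bullet> y \<partial>K t x)) ^ k \<partial>K t x) = C S x"
    by metis
  define P where "P x = (\<Sum>S\<in>Pow {1..k}. (- 1) ^ card ({1..k} - S) / fact k * C S x)" for x
  have "polynomial_of_degree_at_most (k div 2) P"
    unfolding P_def by (intro polynomial_of_degree_at_most_sum polynomial_of_degree_at_most_cmult C)
  moreover have "(\<integral>y. (\<Prod>j\<in>{1..k}. (y $ i j - (\<integral>y. y $ i j \<partial>K t x))) \<partial>K t x) = P x"
    if K: "cbi_semigroup c \<beta> B \<nu> \<mu> K" and x: "x \<in> orthant" for K x
  proof -
    have int: "integrable (K t x) (\<lambda>y. y $ l)" for l
    proof -
      have "axis l 1 \<in> (orthant :: (real ^ 'd) set)"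
        by (auto simp: orthant_def axis_def)
      from kernel_moments[OF adm q nu_tail mu_tail t this q] K x show ?thesis
        by (auto simp: inner_axis')
    qed
    have eq: "(\<Sum>j\<in>S. y $ i j - (\<integral>y. y $ i j \<partial>K t x)) = u S \<bullet> y - (\<integral>y. u S \<bullet> y \<partial>K t x)" for S y
      unfolding u_def inner_sum_axis using int by (simp add: sum_subtractf)
    have prod: "(\<Prod>j\<in>{1..k}. (y $ i j - (\<integral>y. y $ i j \<partial>K t x)))
      = (\<Sum>S\<in>Pow {1..k}. (- 1) ^ card ({1..k} - S) / fact k * (u S \<bullet> y - (\<integral>y. u S \<bullet> y \<partial>K t x)) ^ k)" for y
      using polarization[of "{1..k}" "\<lambda>j. y $ i j - (\<integral>y. y $ i j \<partial>K t x)"] unfolding eq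
      by (simp add: sum_divide_distrib[symmetric] field_simps)
    show ?thesis
      unfolding prod P_def using CK[OF K x] by (subst Bochner_Integration.integral_sum) auto
  qed
  ultimately show ?thesis by blast
qed

subsection \<open>Transfer to the process\<close>

lemma markov_measurable:
  assumes "markov_process K M X" "0 \<le> t"
  shows "X t \<in> M \<rightarrow>\<^sub>M orthant_borel" "X t \<in> borel_measurable M" "\<omega> \<in> space M \<Longrightarrow> X t \<omega> \<in> orthant"
proof -
  show "X t \<in> M \<rightarrow>\<^sub>M orthant_borel"
    using assms by (simp add: markov_process_def)
  then show "X t \<in> borel_measurable M" "\<omega> \<in> space M \<Longrightarrow> X t \<omega> \<in> orthant"
    by (auto simp: measurable_restrict_space2_iff)
qed

lemma natural_filtration_subalgebra:
  assumes "markov_process K M X"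
  shows "subalgebra M (natural_filtration M X s)"
proof -
  have sub: "{X u -` A \<inter> space M | u A. 0 \<le> u \<and> u \<le> s \<and> A \<in> sets borel} \<subseteq> sets M"
    using measurable_sets[OF markov_measurable(2)[OF assms]] by auto
  show ?thesis
    unfolding subalgebra_def natural_filtration_def
    using sub sets.space_closed[of M]
    by (subst space_measure_of sets_measure_of, blast)+ (simp add: sets.sigma_sets_subset)
qed

text \<open>Only conditioning at time 0 enters: taking expectations in the Markov property removes
  the conditional expectation and leaves the law of \<open>X 0\<close> pushed through the
  kernel.\<close>

lemma markov_law:
  assumes K: "cbi_semigroup c \<beta> B \<nu> \<mu> K" and mk: "markov_process K M X" and t: "0 \<le> t"
  shows "distr M orthant_borel (X t) = distr M orthant_borel (X 0) \<bind> K t"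
proof (rule measure_eqI)
  interpret prob_space M
    using mk by (simp add: markov_process_def)
  interpret F: finite_measure_subalgebra M "natural_filtration M X 0"
    using natural_filtration_subalgebra[OF mk] by unfold_locales
  note X0 = markov_measurable[OF mk order_refl] and Xt = markov_measurable[OF mk t]
  have Kt: "K t \<in> orthant_borel \<rightarrow>\<^sub>M prob_algebra orthant_borel"
    using K t by (auto simp: cbi_semigroup_def transition_semigroup_def)
  have ne: "space (distr M orthant_borel (X 0)) \<noteq> {}"
    using not_empty X0(3) by (auto simp: space_restrict_space)
  have Kt': "K t \<in> distr M orthant_borel (X 0) \<rightarrow>\<^sub>M subprob_algebra orthant_borel"
    using measurable_prob_algebraD[OF Kt] by simp
  show sets_eq: "sets (distr M orthant_borel (X t)) = sets (distr M orthant_borel (X 0) \<bind> K t)"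
    using sets_bind[OF _ ne, of "K t" orthant_borel] sets_kernel[OF Kt'] by simp
  fix A assume "A \<in> sets (distr M orthant_borel (X t))"
  then have A: "A \<in> sets orthant_borel" by simp
  have KA: "(\<lambda>\<omega>. measure (K t (X 0 \<omega>)) A) \<in> borel_measurable M"
    using measurable_compose[OF X0(1) measurable_compose[OF Kt measurable_measure_prob_algebra[OF A]]] .
  have prob: "prob_space (K t (X 0 \<omega>))" if "\<omega> \<in> space M" for \<omega>
    using cbi_kernel_prob(1)[OF K t X0(3)[OF that]] .
  have ae: "AE \<omega> in M. real_cond_exp M (natural_filtration M X 0) (\<lambda>\<omega>. indicator A (X t \<omega>)) \<omega> = measure (K t (X 0 \<omega>)) A"
    using mk t A unfolding markov_process_def by force
  have int: "integrable M (\<lambda>\<omega>. indicator A (X t \<omega>) :: real)"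
    using measurable_compose[OF Xt(1) borel_measurable_indicator[OF A]]
    by (intro integrable_const_bound[where B = 1]) auto
  have "(\<integral>\<omega>. measure (K t (X 0 \<omega>)) A \<partial>M) = (\<integral>\<omega>. real_cond_exp M (natural_filtration M X 0) (\<lambda>\<omega>. indicator A (X t \<omega>)) \<omega> \<partial>M)"
    using ae KA by (intro integral_cong_AE) (auto elim: eventually_mono)
  also have "\<dots> = (\<integral>\<omega>. indicator A (X t \<omega>) \<partial>M)"
    by (rule F.real_cond_exp_int(2)[OF int])
  also have "\<dots> = (\<integral>\<omega>. indicator (X t -` A \<inter> space M) \<omega> \<partial>M)"
    by (intro Bochner_Integration.integral_cong) (auto simp: indicator_def)
  also have "\<dots> = measure M (X t -` A \<inter> space M)"
    by simp
  finally have eq: "(\<integral>\<omega>. measure (K t (X 0 \<omega>)) A \<partial>M) = measure M (X t -` A \<inter> space M)" .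
  have "emeasure (distr M orthant_borel (X 0) \<bind> K t) A = (\<integral>\<^sup>+x. emeasure (K t x) A \<partial>distr M orthant_borel (X 0))"
    by (rule emeasure_bind[OF ne Kt' A])
  also have "\<dots> = (\<integral>\<^sup>+\<omega>. emeasure (K t (X 0 \<omega>)) A \<partial>M)"
    using measurable_emeasure_kernel[OF measurable_prob_algebraD[OF Kt] A]
    by (intro nn_integral_distr X0(1)) simp
  also have "\<dots> = (\<integral>\<^sup>+\<omega>. ennreal (measure (K t (X 0 \<omega>)) A) \<partial>M)"
    using prob by (intro nn_integral_cong) (simp add: finite_measure.emeasure_eq_measure prob_space.finite_measure)
  also have "\<dots> = ennreal (\<integral>\<omega>. measure (K t (X 0 \<omega>)) A \<partial>M)"
    using KA prob by (intro nn_integral_eq_integral integrable_const_bound[where B = 1])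
      (auto intro!: prob_space.prob_le_1)
  also have "\<dots> = emeasure (distr M orthant_borel (X t)) A"
    unfolding eq using A Xt(1) by (simp add: emeasure_distr emeasure_eq_measure)
  finally show "emeasure (distr M orthant_borel (X t)) A = emeasure (distr M orthant_borel (X 0) \<bind> K t) A"
    by simp
qed

lemma markov_nn_integral:
  assumes K: "cbi_semigroup c \<beta> B \<nu> \<mu> K" and mk: "markov_process K M X" and t: "0 \<le> t"
    and f: "f \<in> borel_measurable orthant_borel"
  shows "(\<integral>\<^sup>+\<omega>. f (X t \<omega>) \<partial>M) = (\<integral>\<^sup>+\<omega>. (\<integral>\<^sup>+y. f y \<partial>K t (X 0 \<omega>)) \<partial>M)"
proof -
  have Kt: "K t \<in> orthant_borel \<rightarrow>\<^sub>M subprob_algebra orthant_borel"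
    using K t by (intro measurable_prob_algebraD) (auto simp: cbi_semigroup_def transition_semigroup_def)
  have "(\<integral>\<^sup>+\<omega>. f (X t \<omega>) \<partial>M) = (\<integral>\<^sup>+y. f y \<partial>distr M orthant_borel (X t))"
    using f by (intro nn_integral_distr[symmetric] markov_measurable(1)[OF mk t]) simp
  also have "\<dots> = (\<integral>\<^sup>+x. \<integral>\<^sup>+y. f y \<partial>K t x \<partial>distr M orthant_borel (X 0))"
    unfolding markov_law[OF K mk t] using Kt by (intro nn_integral_bind[OF f]) simp
  also have "\<dots> = (\<integral>\<^sup>+\<omega>. (\<integral>\<^sup>+y. f y \<partial>K t (X 0 \<omega>)) \<partial>M)"
    using measurable_compose[OF Kt nn_integral_measurable_subprob_algebra[OF f]]
    by (intro nn_integral_distr markov_measurable(1)[OF mk order_refl]) simp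
  finally show ?thesis .
qed

lemma markov_law_deterministic:
  assumes K: "cbi_semigroup c \<beta> B \<nu> \<mu> K" and mk: "markov_process K M X" and t: "0 \<le> t"
    and x: "AE \<omega> in M. X 0 \<omega> = x"
  shows "x \<in> orthant" "distr M orthant_borel (X t) = K t x"
proof -
  interpret prob_space M
    using mk by (simp add: markov_process_def)
  \<comment> \<open>The almost sure value is attained at some point of the space, so it lies in the
    orthant and the kernel is defined there.\<close>
  have "\<exists>\<omega>\<in>space M. X 0 \<omega> = x"
    using AE_contr[of "\<lambda>\<omega>. X 0 \<omega> = x"] x by (auto intro: ccontr)
  then show xo: "x \<in> orthant"
    using markov_measurable(3)[OF mk order_refl] by auto
  show "distr M orthant_borel (X t) = K t x"
  proof (rule measure_eqI)
    show "sets (distr M orthant_borel (X t)) = sets (K t x)"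
      using cbi_kernel_prob(2)[OF K t xo] by simp
    fix A assume "A \<in> sets (distr M orthant_borel (X t))"
    then have A: "A \<in> sets orthant_borel" by simp
    have "emeasure (distr M orthant_borel (X t)) A = (\<integral>\<^sup>+\<omega>. indicator A (X t \<omega>) \<partial>M)"
      using A nn_integral_distr[OF markov_measurable(1)[OF mk t], of "indicator A"]
      by (simp add: nn_integral_indicator)
    also have "\<dots> = (\<integral>\<^sup>+\<omega>. (\<integral>\<^sup>+y. indicator A y \<partial>K t (X 0 \<omega>)) \<partial>M)"
      using A by (intro markov_nn_integral[OF K mk t]) simp
    also have "\<dots> = (\<integral>\<^sup>+\<omega>. (\<integral>\<^sup>+y. indicator A y \<partial>K t x) \<partial>M)"
      using x by (intro nn_integral_cong_AE) (auto elim: eventually_mono)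
    also have "\<dots> = emeasure (K t x) A"
      using A cbi_kernel_prob(2)[OF K t xo] by (simp add: emeasure_space_1)
    finally show "emeasure (distr M orthant_borel (X t)) A = emeasure (K t x) A" .
  qed
qed

text \<open>Conditionally on the start the moment is a polynomial of degree at most
  \<open>j \<le> q\<close> in \<open>X 0\<close>, hence has finite mean. Nonnegative integrals allow
  this computation before integrability is known.\<close>

lemma process_moments_integrable:
  fixes c \<beta> :: "real ^ 'd::finite"
  assumes adm: "admissible c \<beta> B \<nu> \<mu>" and q: "1 \<le> q"
    and nu_tail: "set_integrable \<nu> {z. 1 \<le> norm z} (\<lambda>z. norm z ^ q)"
    and mu_tail: "\<And>i. set_integrable (\<mu> i) {z. 1 \<le> norm z} (\<lambda>z. norm z ^ q)"
    and t: "0 \<le> t" and u: "u \<in> orthant" and j: "j \<le> q"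
    and K: "cbi_semigroup c \<beta> B \<nu> \<mu> K" and mk: "markov_process K M X"
    and X0: "integrable M (\<lambda>\<omega>. norm (X 0 \<omega>) ^ q)"
  shows "integrable M (\<lambda>\<omega>. (u \<bullet> X t \<omega>) ^ j)"
proof -
  obtain R where R: "polynomial_of_degree_at_most j R"
    and KR: "\<And>x. x \<in> orthant \<Longrightarrow> integrable (K t x) (\<lambda>y. (u \<bullet> y) ^ j) \<and> (\<integral>y. (u \<bullet> y) ^ j \<partial>K t x) = R x"
    using kernel_moments[OF adm q nu_tail mu_tail t u j] K by blast
  have M: "prob_space M"
    using mk by (simp add: markov_process_def)
  have intR: "integrable M (\<lambda>\<omega>. R (X 0 \<omega>))"
    by (rule polynomial_of_degree_at_most_integrable[OF R j M markov_measurable(2)[OF mk order_refl] X0])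
  have nn: "0 \<le> (u \<bullet> y) ^ j" if "y \<in> orthant" for y
    using orthant_inner_nonneg[OF u that] by simp
  have inner: "(\<integral>\<^sup>+y. ennreal ((u \<bullet> y) ^ j) \<partial>K t x) = ennreal (R x)" and Rnn: "0 \<le> R x" if x: "x \<in> orthant" for x
  proof -
    have ae: "AE y in K t x. 0 \<le> (u \<bullet> y) ^ j"
      using nn by (intro AE_I2) (simp add: cbi_kernel_prob(3)[OF K t x])
    show "(\<integral>\<^sup>+y. ennreal ((u \<bullet> y) ^ j) \<partial>K t x) = ennreal (R x)"
      using nn_integral_eq_integral[OF _ ae] KR[OF x] by simp
    show "0 \<le> R x"
      using integral_nonneg_AE[OF ae] KR[OF x] by simp
  qed
  have "(\<lambda>y. ennreal ((u \<bullet> y) ^ j)) \<in> borel_measurable orthant_borel"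
    by (rule measurable_restrict_space1) simp
  from markov_nn_integral[OF K mk t this]
  have "(\<integral>\<^sup>+\<omega>. ennreal ((u \<bullet> X t \<omega>) ^ j) \<partial>M) = (\<integral>\<^sup>+\<omega>. ennreal (R (X 0 \<omega>)) \<partial>M)"
    using inner[OF markov_measurable(3)[OF mk order_refl]] by (simp cong: nn_integral_cong)
  also have "\<dots> = ennreal (\<integral>\<omega>. R (X 0 \<omega>) \<partial>M)"
    using Rnn[OF markov_measurable(3)[OF mk order_refl]] by (intro nn_integral_eq_integral intR AE_I2)
  also have "\<dots> < \<infinity>" by simp
  finally show ?thesis
    using nn[OF markov_measurable(3)[OF mk t]]
    by (intro integrableI_nonneg AE_I2 borel_measurable_power borel_measurable_inner
        borel_measurable_const markov_measurable(2)[OF mk t])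
qed

text \<open>\<open>P\<^sub>0\<close> is fixed before the process and is the polynomial for every
  almost surely constant start. For a random start no such choice can work in general: at
  \<open>t = 0\<close> with \<open>k = 2\<close> and equal indices, constant starts force the
  polynomial to vanish on the orthant, whereas a random coordinate may have positive variance. The
  integrability claims ensure that no integral in the identity takes the default value 0 of a
  non-integrable function.\<close>

theorem corollary4p7:
  fixes c \<beta> :: "real ^ 'd::finite"
    and B :: "real ^ 'd ^ 'd"
    and \<nu> :: "(real ^ 'd) measure"
    and \<mu> :: "'d \<Rightarrow> (real ^ 'd) measure"
    and q k :: nat
    and t :: real
    and i :: "nat \<Rightarrow> 'd"
  assumes "admissible c \<beta> B \<nu> \<mu>"
    and "1 \<le> q"
    and "set_integrable \<nu> {z. 1 \<le> norm z} (\<lambda>z. norm z ^ q)"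
    and "\<And>l. set_integrable (\<mu> l) {z. 1 \<le> norm z} (\<lambda>z. norm z ^ q)"
    and "0 \<le> t"
    and "1 \<le> k" "k \<le> q"
  shows "\<exists>P\<^sub>0 :: real ^ 'd \<Rightarrow> real.
           \<forall>(M :: 'a measure) X.
             cbi_process c \<beta> B \<nu> \<mu> M X \<and> integrable M (\<lambda>\<omega>. norm (X 0 \<omega>) ^ q) \<longrightarrow>
             (\<forall>l. integrable M (\<lambda>\<omega>. X t \<omega> $ l)) \<and>
             integrable M (\<lambda>\<omega>. \<Prod>j\<in>{1..k}. (X t \<omega> $ i j - (\<integral>\<omega>'. X t \<omega>' $ i j \<partial>M))) \<and>
             (\<exists>P. polynomial_of_degree_at_most (k div 2) P \<and>
                  integrable M (\<lambda>\<omega>. P (X 0 \<omega>)) \<and>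
                  (\<integral>\<omega>. (\<Prod>j\<in>{1..k}. (X t \<omega> $ i j - (\<integral>\<omega>'. X t \<omega>' $ i j \<partial>M))) \<partial>M)
                    = (\<integral>\<omega>. P (X 0 \<omega>) \<partial>M) \<and>
                  ((\<exists>x. AE \<omega> in M. X 0 \<omega> = x) \<longrightarrow> P = P\<^sub>0))"
proof -
  note as = assms(1-4)
  obtain P\<^sub>0 where P\<^sub>0: "polynomial_of_degree_at_most (k div 2) P\<^sub>0"
    and central: "\<And>K x. cbi_semigroup c \<beta> B \<nu> \<mu> K \<Longrightarrow> x \<in> orthant \<Longrightarrow>
      (\<integral>y. (\<Prod>j\<in>{1..k}. (y $ i j - (\<integral>y. y $ i j \<partial>K t x))) \<partial>K t x) = P\<^sub>0 x"
    using kernel_central_moments[OF as \<open>0 \<le> t\<close> \<open>k \<le> q\<close>] by blast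
  show ?thesis
  proof (intro exI[of _ P\<^sub>0] allI impI)
    fix M :: "'a measure" and X
    assume asm: "cbi_process c \<beta> B \<nu> \<mu> M X \<and> integrable M (\<lambda>\<omega>. norm (X 0 \<omega>) ^ q)"
    then obtain K where K: "cbi_semigroup c \<beta> B \<nu> \<mu> K" and mk: "markov_process K M X"
      unfolding cbi_process_def by blast
    interpret prob_space M
      using mk by (simp add: markov_process_def)
    have mom: "integrable M (\<lambda>\<omega>. (u \<bullet> X t \<omega>) ^ j)" if "u \<in> orthant" "j \<le> q" for u j
      using process_moments_integrable[OF as \<open>0 \<le> t\<close> that K mk] asm by blast
    have "axis l 1 \<in> (orthant :: (real ^ 'd) set)" for l
      by (auto simp: orthant_def axis_def)
    then have int: "integrable M (\<lambda>\<omega>. X t \<omega> $ l)" for l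
      using mom[of "axis l 1" 1] \<open>1 \<le> q\<close> by (simp add: inner_axis')
    define e where "e j = (\<integral>\<omega>. X t \<omega> $ i j \<partial>M)" for j
    define W where "W \<omega> = (\<Prod>j\<in>{1..k}. (X t \<omega> $ i j - e j))" for \<omega>
    \<comment> \<open>Polarization reduces integrability of the mixed product to powers of single
      directions, recentred by the constants \<open>e j\<close>.\<close>
    have "integrable M (\<lambda>\<omega>. (\<Sum>j\<in>S. X t \<omega> $ i j - e j) ^ k)" for S
    proof -
      have "integrable M (\<lambda>\<omega>. ((\<Sum>j\<in>S. axis (i j) 1) \<bullet> X t \<omega> - (\<Sum>j\<in>S. e j)) ^ k)"
        using \<open>k \<le> q\<close> by (intro integrable_power_diff_const mom sum_axis_orthant) simp
      then show ?thesis
        by (simp add: inner_sum_axis sum_subtractf)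
    qed
    then have "integrable M (\<lambda>\<omega>. (\<Sum>S\<in>Pow {1..k}. (- 1) ^ card ({1..k} - S) * (\<Sum>j\<in>S. X t \<omega> $ i j - e j) ^ card {1..k}) / fact k)"
      by (intro integrable_divide Bochner_Integration.integrable_sum integrable_mult_right) simp
    then have intW: "integrable M W"
      unfolding W_def[abs_def] polarization[OF finite_atLeastAtMost, symmetric] by simp
    have "\<exists>P. polynomial_of_degree_at_most (k div 2) P \<and> integrable M (\<lambda>\<omega>. P (X 0 \<omega>)) \<and>
        (\<integral>\<omega>. W \<omega> \<partial>M) = (\<integral>\<omega>. P (X 0 \<omega>) \<partial>M) \<and> ((\<exists>x. AE \<omega> in M. X 0 \<omega> = x) \<longrightarrow> P = P\<^sub>0)"
    proof (cases "\<exists>x. AE \<omega> in M. X 0 \<omega> = x")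
      case False
      then show ?thesis
        by (intro exI[of _ "\<lambda>_. \<integral>\<omega>. W \<omega> \<partial>M"]) (simp add: polynomial_of_degree_at_most_const prob_space)
    next
      case True
      then obtain x where x: "AE \<omega> in M. X 0 \<omega> = x" by blast
      note law = markov_law_deterministic[OF K mk \<open>0 \<le> t\<close> x]
      have transfer: "(\<integral>\<omega>. g (X t \<omega>) \<partial>M) = (\<integral>y. g y \<partial>K t x)" if "g \<in> borel_measurable borel" for g :: "real ^ 'd \<Rightarrow> real"
        using integral_distr[OF markov_measurable(1)[OF mk \<open>0 \<le> t\<close>] measurable_restrict_space1[OF that]] law(2)
        by simp
      have "e j = (\<integral>y. y $ i j \<partial>K t x)" for j
        unfolding e_def by (rule transfer) simp
      then have "(\<integral>\<omega>. W \<omega> \<partial>M) = P\<^sub>0 x"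
        unfolding W_def using transfer[of "\<lambda>y. \<Prod>j\<in>{1..k}. (y $ i j - e j)"] central[OF K law(1)] by simp
      moreover have AE_P: "AE \<omega> in M. P\<^sub>0 (X 0 \<omega>) = P\<^sub>0 x"
        using x by eventually_elim simp
      have meas: "(\<lambda>\<omega>. P\<^sub>0 (X 0 \<omega>)) \<in> borel_measurable M"
        by (rule measurable_compose[OF markov_measurable(2)[OF mk order_refl]
            polynomial_of_degree_at_most_measurable[OF P\<^sub>0]])
      have "(\<integral>\<omega>. P\<^sub>0 (X 0 \<omega>) \<partial>M) = (\<integral>\<omega>. P\<^sub>0 x \<partial>M)"
        by (intro integral_cong_AE meas AE_P) simp
      moreover have "integrable M (\<lambda>\<omega>. P\<^sub>0 (X 0 \<omega>)) \<longleftrightarrow> integrable M (\<lambda>\<omega>. P\<^sub>0 x)"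
        by (intro integrable_cong_AE meas AE_P) simp
      ultimately show ?thesis
        using P\<^sub>0 by (intro exI[of _ P\<^sub>0]) (simp add: prob_space)
    qed
    then show "(\<forall>l. integrable M (\<lambda>\<omega>. X t \<omega> $ l)) \<and>
             integrable M (\<lambda>\<omega>. \<Prod>j\<in>{1..k}. (X t \<omega> $ i j - (\<integral>\<omega>'. X t \<omega>' $ i j \<partial>M))) \<and>
             (\<exists>P. polynomial_of_degree_at_most (k div 2) P \<and>
                  integrable M (\<lambda>\<omega>. P (X 0 \<omega>)) \<and>
                  (\<integral>\<omega>. (\<Prod>j\<in>{1..k}. (X t \<omega> $ i j - (\<integral>\<omega>'. X t \<omega>' $ i j \<partial>M))) \<partial>M)
                    = (\<integral>\<omega>. P (X 0 \<omega>) \<partial>M) \<and>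
                  ((\<exists>x. AE \<omega> in M. X 0 \<omega> = x) \<longrightarrow> P = P\<^sub>0))"
      using int intW unfolding W_def[abs_def] e_def by blast
  qed
qed

end
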